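(* Let $d,N\in\mathbb{N}$, $s\in(0,\infty)$, and let $V$ be a pair interaction potential such that: $V:\mathbb{R}\to[-b,\infty)$ for some $b\in[0,\infty)$, $V$ is continuously differentiable and symmetric ($V(-r)=V(r)$ for all $r\in\mathbb{R}$), $\int_{\mathbb{R}}\exp(-V(r))\,dr<\infty$, and $\mathbb{V}'(x,\cdot)\in L^2\big(\overline{\Omega^+_{d,N}};\mu_{N^d,s,\varrho}\big)$ for all $x\in D_{d,N}$. Then $$\mathcal{E}^{N^d,s,\varrho}(F,G)=\sum_{\varnothing\ne B\subset D_{d,N}}\mathcal{E}_B^{N^d,s,\varrho}(F,G),\quad F,G\in\mathcal{D}=C_c^2\big(\overline{\Omega^+_{d,N}}\big),$$ with $$\mathcal{E}_B^{N^d,s,\varrho}(F,G)=\sum_{x\in B}\int_{\Omega_{d,N,B}^{+,\mathrm{wet}}}\partial_xF\,\partial_xG\,d\mu_B^{N^d,s,\varrho},\quad\varnothing\ne B\subset D_{d,N},$$ is a densely defined, positive definite (i.e. $\mathcal{E}^{N^d,s,\varrho}(F,F)\ge0$), symmetric bilinear form, which is closable on $L^2\big(\overline{\Omega^+_{d,N}};\mu_{N^d,s,\varrho}\big)$. Its closure $\big(\mathcal{E}^{N^d,s,\varrho},D(\mathcal{E}^{N^d,s,\varrho})\big)$ is a conservative, strongly local, regular, symmetric Dirichlet form on $L^2\big(\overline{\Omega^+_{d,N}};\mu_{N^d,s,\varrho}\big)$.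
   Context: $D_{d,N}=\{1,\dots,N\}^d$, $\partial D_{d,N}=\{x\in\mathbb{Z}^d\setminus D_{d,N}:|x-y|_{\rm euc}=1\text{ for some }y\in D_{d,N}\}$, $\overline{D_{d,N}}=D_{d,N}\cup\partial D_{d,N}$. The state space is $\overline{\Omega^+_{d,N}}=[0,\infty)^{D_{d,N}}$, whose elements $\phi=(\phi_x)_{x\in D_{d,N}}$ (interfaces) are extended by $\phi_x=0$ for $x\in\partial D_{d,N}$. The Hamiltonian is $H^V_{d,N}(\phi)=\frac12\sum_{x,y\in\overline{D_{d,N}},\,|x-y|_{\rm euc}=1}V(\phi_x-\phi_y)$, and $\mathbb{V}'(x,\phi)=\sum_{y\in\overline{D_{d,N}},\,|x-y|_{\rm euc}=1}V'(\phi_x-\phi_y)$. The density is $\varrho(\phi)=\frac1{Z}\exp(-H^V_{d,N}(\phi))$, and $\mu_{N^d,s,\varrho}$ is the probability measure $d\mu_{N^d,s,\varrho}(\phi)=\varrho(\phi)\prod_{x\in D_{d,N}}\big(s\,d\delta_0^x+d\phi_+^x\big)$, where $d\delta_0^x$ is the Dirac measure at $0$ and $d\phi_+^x$ Lebesgue measure on $[0,\infty)$ in the coordinate $\phi_x$, and $Z=Z_{d,N}^{V,s}$ is the normalizing constant. For $B\subset D_{d,N}$ (equality allowed), $\Omega^{+,\mathrm{wet}}_{d,N,B}=\{\phi\in\overline{\Omega^+_{d,N}}:\{x\in D_{d,N}:\phi_x>0\}=B\}$ and $\mu_B^{N^d,s,\varrho}$ is the restriction of $\mu_{N^d,s,\varrho}$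 to $\Omega^{+,\mathrm{wet}}_{d,N,B}$. $C_c^2(\overline{\Omega^+_{d,N}})$ is the set of compactly supported real functions on $\overline{\Omega^+_{d,N}}$ that are twice continuously differentiable on the interior $(0,\infty)^{D_{d,N}}$ and all of whose partial derivatives of order at most $2$ extend continuously to $\overline{\Omega^+_{d,N}}$; $\partial_x$ is the partial derivative with respect to $\phi_x$ (extended to the boundary). *)

theory Defs
  imports "HOL-Analysis.Analysis"
begin

section \<open>Symmetric forms on \<open>L\<^sup>2\<close>\<close>

text \<open>
  Elements of \<open>L\<^sup>2(M)\<close> are represented by square integrable functions, two functions being
  identified when they agree almost everywhere; a form is a domain of such functions together with
  a real-valued function of two arguments. Values outside \<open>space M\<close> are irrelevant. The
  topology on the underlying space is the subspace topology of \<open>space M\<close>.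
\<close>

definition L2_space :: "'a measure \<Rightarrow> ('a \<Rightarrow> real) set" where
  "L2_space M = {f. f \<in> borel_measurable M \<and> integrable M (\<lambda>p. (f p)\<^sup>2)}"

definition L2_inner :: "'a measure \<Rightarrow> ('a \<Rightarrow> real) \<Rightarrow> ('a \<Rightarrow> real) \<Rightarrow> real" where
  "L2_inner M f g = (\<integral>p. f p * g p \<partial>M)"

definition L2_norm :: "'a measure \<Rightarrow> ('a \<Rightarrow> real) \<Rightarrow> real" where
  "L2_norm M f = sqrt (L2_inner M f f)"

type_synonym 'a bilin = "('a \<Rightarrow> real) \<Rightarrow> ('a \<Rightarrow> real) \<Rightarrow> real"

definition densely_defined :: "'a measure \<Rightarrow> ('a \<Rightarrow> real) set \<Rightarrow> bool" where
  "densely_defined M D \<longleftrightarrow>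
     D \<subseteq> L2_space M \<and>
     (\<forall>f\<in>L2_space M. \<forall>e>0. \<exists>g\<in>D. L2_norm M (\<lambda>p. f p - g p) < e)"

text \<open>
  The last conjunct says that the form is well defined on almost-everywhere classes.
\<close>

definition symmetric_bilinear_form ::
    "'a measure \<Rightarrow> ('a \<Rightarrow> real) set \<Rightarrow> 'a bilin \<Rightarrow> bool" where
  "symmetric_bilinear_form M D E \<longleftrightarrow>
     (\<lambda>_. 0) \<in> D \<and>
     (\<forall>u\<in>D. \<forall>v\<in>D. (\<lambda>p. u p + v p) \<in> D) \<and>
     (\<forall>c. \<forall>u\<in>D. (\<lambda>p. c * u p) \<in> D) \<and>
     (\<forall>u\<in>D. \<forall>v\<in>D. \<forall>w\<in>D. E (\<lambda>p. u p + v p) w = E u w + E v w) \<and>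
     (\<forall>c. \<forall>u\<in>D. \<forall>v\<in>D. E (\<lambda>p. c * u p) v = c * E u v) \<and>
     (\<forall>u\<in>D. \<forall>v\<in>D. E u v = E v u) \<and>
     (\<forall>u\<in>D. \<forall>u'\<in>D. \<forall>v\<in>D. (AE p in M. u p = u' p) \<longrightarrow> E u v = E u' v)"

definition positive_definite_form :: "('a \<Rightarrow> real) set \<Rightarrow> 'a bilin \<Rightarrow> bool" where
  "positive_definite_form D E \<longleftrightarrow> (\<forall>u\<in>D. E u u \<ge> 0)"

definition form_Cauchy :: "'a bilin \<Rightarrow> (nat \<Rightarrow> 'a \<Rightarrow> real) \<Rightarrow> bool" where
  "form_Cauchy E U \<longleftrightarrow>
     (\<forall>e>0. \<exists>n0. \<forall>m\<ge>n0. \<forall>n\<ge>n0.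
        E (\<lambda>p. U m p - U n p) (\<lambda>p. U m p - U n p) < e)"

definition closable :: "'a measure \<Rightarrow> ('a \<Rightarrow> real) set \<Rightarrow> 'a bilin \<Rightarrow> bool" where
  "closable M D E \<longleftrightarrow>
     (\<forall>U. (\<forall>n. U n \<in> D) \<and> form_Cauchy E U \<and> (\<lambda>n. L2_norm M (U n)) \<longlonglongrightarrow> 0
        \<longrightarrow> (\<lambda>n. E (U n) (U n)) \<longlonglongrightarrow> 0)"

definition approximates ::
    "'a measure \<Rightarrow> ('a \<Rightarrow> real) set \<Rightarrow> 'a bilin \<Rightarrow> (nat \<Rightarrow> 'a \<Rightarrow> real) \<Rightarrow> ('a \<Rightarrow> real) \<Rightarrow> bool" where
  "approximates M D E U u \<longleftrightarrow>
     (\<forall>n. U n \<in> D) \<and> form_Cauchy E U \<and> (\<lambda>n. L2_norm M (\<lambda>p. U n p - u p)) \<longlonglongrightarrow> 0"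

definition closure_dom :: "'a measure \<Rightarrow> ('a \<Rightarrow> real) set \<Rightarrow> 'a bilin \<Rightarrow> ('a \<Rightarrow> real) set" where
  "closure_dom M D E = {u \<in> L2_space M. \<exists>U. approximates M D E U u}"

definition closure_form :: "'a measure \<Rightarrow> ('a \<Rightarrow> real) set \<Rightarrow> 'a bilin \<Rightarrow> 'a bilin" where
  "closure_form M D E u v =
     (THE l. \<exists>U W. approximates M D E U u \<and> approximates M D E W v \<and>
                   (\<lambda>n. E (U n) (W n)) \<longlonglongrightarrow> l)"

definition form1 :: "'a measure \<Rightarrow> 'a bilin \<Rightarrow> 'a bilin" where
  "form1 M E u v = E u v + L2_inner M u v"

definition closed_form :: "'a measure \<Rightarrow> ('a \<Rightarrow> real) set \<Rightarrow> 'a bilin \<Rightarrow> bool" where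
  "closed_form M D E \<longleftrightarrow>
     (\<forall>U. (\<forall>n. U n \<in> D) \<and> form_Cauchy (form1 M E) U \<longrightarrow>
        (\<exists>u\<in>D. (\<lambda>n. form1 M E (\<lambda>p. U n p - u p) (\<lambda>p. U n p - u p)) \<longlonglongrightarrow> 0))"

definition symmetric_Dirichlet_form ::
    "'a measure \<Rightarrow> ('a \<Rightarrow> real) set \<Rightarrow> 'a bilin \<Rightarrow> bool" where
  "symmetric_Dirichlet_form M D E \<longleftrightarrow>
     densely_defined M D \<and> symmetric_bilinear_form M D E \<and> positive_definite_form D E \<and>
     closed_form M D E \<and>
     (\<forall>u\<in>D. (\<lambda>p. min (max (u p) 0) 1) \<in> D \<and>
            E (\<lambda>p. min (max (u p) 0) 1) (\<lambda>p. min (max (u p) 0) 1) \<le> E u u)"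

text \<open>
  For a closed form with generator \<open>A\<close> the resolvent \<open>G\<^sub>\<alpha> = (\<alpha> - A)\<inverse>\<close> is given by the Riesz
  representation theorem, and the associated semigroup is
  \<open>T\<^sub>t f = exp (t A) f = lim\<^sub>n (1 - (t / n) A)\<^sup>-\<^sup>n f = lim\<^sub>n (\<alpha> G\<^sub>\<alpha>)\<^sup>n f\<close> with \<open>\<alpha> = n / t\<close>,
  the limit being taken in \<open>L\<^sup>2(M)\<close>. Both operators are determined up to equality
  almost everywhere, whence the choice operator.
\<close>

definition form_resolvent ::
    "'a measure \<Rightarrow> ('a \<Rightarrow> real) set \<Rightarrow> 'a bilin \<Rightarrow> real \<Rightarrow> ('a \<Rightarrow> real) \<Rightarrow> ('a \<Rightarrow> real)" where
  "form_resolvent M D E a f =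
     (SOME g. g \<in> D \<and> (\<forall>v\<in>D. E g v + a * L2_inner M g v = L2_inner M f v))"

definition form_semigroup ::
    "'a measure \<Rightarrow> ('a \<Rightarrow> real) set \<Rightarrow> 'a bilin \<Rightarrow> real \<Rightarrow> ('a \<Rightarrow> real) \<Rightarrow> ('a \<Rightarrow> real)" where
  "form_semigroup M D E t f =
     (SOME g. g \<in> L2_space M \<and>
        (\<lambda>n. L2_norm M (\<lambda>p.
            ((\<lambda>h q. (real n / t) * form_resolvent M D E (real n / t) h q) ^^ n) f p - g p))
          \<longlonglongrightarrow> 0)"

text \<open>
  For finite \<open>M\<close>, so that the constant function \<open>1\<close> is in \<open>L\<^sup>2(M)\<close>.
\<close>

definition conservative_form :: "'a measure \<Rightarrow> ('a \<Rightarrow> real) set \<Rightarrow> 'a bilin \<Rightarrow> bool" where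
  "conservative_form M D E \<longleftrightarrow>
     (\<lambda>_. 1) \<in> L2_space M \<and>
     (\<forall>t>0. AE p in M. form_semigroup M D E t (\<lambda>_. 1) p = 1)"

text \<open>
  The support of the measure \<open>\<bar>u\<bar> \<cdot> M\<close>, which depends only on the class of \<open>u\<close>.
\<close>

definition ess_support :: "'a::topological_space measure \<Rightarrow> ('a \<Rightarrow> real) \<Rightarrow> 'a set" where
  "ess_support M u =
     space M - \<Union>{U. openin (top_of_set (space M)) U \<and> (AE p in M. p \<in> U \<longrightarrow> u p = 0)}"

definition strongly_local ::
    "'a::topological_space measure \<Rightarrow> ('a \<Rightarrow> real) set \<Rightarrow> 'a bilin \<Rightarrow> bool" where
  "strongly_local M D E \<longleftrightarrow>
     (\<forall>u\<in>D. \<forall>v\<in>D.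
        compact (ess_support M u) \<and> compact (ess_support M v) \<and>
        (\<exists>c U. openin (top_of_set (space M)) U \<and> ess_support M u \<subseteq> U \<and>
               (AE p in M. p \<in> U \<longrightarrow> v p = c))
        \<longrightarrow> E u v = 0)"

definition Cc :: "'a::topological_space set \<Rightarrow> ('a \<Rightarrow> real) set" where
  "Cc X = {f. continuous_on X f \<and> (\<exists>K. compact K \<and> K \<subseteq> X \<and> (\<forall>p\<in>X - K. f p = 0))}"

definition regular_form ::
    "'a::topological_space measure \<Rightarrow> ('a \<Rightarrow> real) set \<Rightarrow> 'a bilin \<Rightarrow> bool" where
  "regular_form M D E \<longleftrightarrow>
     (\<forall>u\<in>D. \<forall>e>0. \<exists>g\<in>D \<inter> Cc (space M).
        form1 M E (\<lambda>p. u p - g p) (\<lambda>p. u p - g p) < e) \<and>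
     (\<forall>f\<in>Cc (space M). \<forall>e>0. \<exists>g\<in>D \<inter> Cc (space M). \<forall>p\<in>space M. \<bar>f p - g p\<bar> < e)"


section \<open>The wetting model\<close>

text \<open>Points of \<open>\<int>\<^sup>d\<close> are extensional functions on \<open>{..<d}\<close>.\<close>

type_synonym site = "nat \<Rightarrow> int"
type_synonym interface = "site \<Rightarrow> real"

definition int_lattice :: "nat \<Rightarrow> site set" where
  "int_lattice d = ({..<d} \<rightarrow>\<^sub>E UNIV)"

definition site_box :: "nat \<Rightarrow> nat \<Rightarrow> site set" where
  "site_box d N = ({..<d} \<rightarrow>\<^sub>E {1..int N})"

definition euc_dist :: "nat \<Rightarrow> site \<Rightarrow> site \<Rightarrow> real" where
  "euc_dist d x y = L2_set (\<lambda>i. real_of_int (x i - y i)) {..<d}"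

definition site_boundary :: "nat \<Rightarrow> nat \<Rightarrow> site set" where
  "site_boundary d N = {x \<in> int_lattice d - site_box d N. \<exists>y\<in>site_box d N. euc_dist d x y = 1}"

definition site_closure :: "nat \<Rightarrow> nat \<Rightarrow> site set" where
  "site_closure d N = site_box d N \<union> site_boundary d N"

definition state_space :: "nat \<Rightarrow> nat \<Rightarrow> interface set" where
  "state_space d N = (site_box d N \<rightarrow>\<^sub>E {0..})"

definition ext0 :: "nat \<Rightarrow> nat \<Rightarrow> interface \<Rightarrow> interface" where
  "ext0 d N \<phi> x = (if x \<in> site_box d N then \<phi> x else 0)"

definition Hamiltonian :: "nat \<Rightarrow> nat \<Rightarrow> (real \<Rightarrow> real) \<Rightarrow> interface \<Rightarrow> real" where
  "Hamiltonian d N V \<phi> =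
     (1 / 2) * (\<Sum>(x, y) \<in> {(x, y). x \<in> site_closure d N \<and> y \<in> site_closure d N \<and> euc_dist d x y = 1}.
                  V (ext0 d N \<phi> x - ext0 d N \<phi> y))"

definition force :: "nat \<Rightarrow> nat \<Rightarrow> (real \<Rightarrow> real) \<Rightarrow> site \<Rightarrow> interface \<Rightarrow> real" where
  "force d N V x \<phi> =
     (\<Sum>y \<in> {y \<in> site_closure d N. euc_dist d x y = 1}. deriv V (ext0 d N \<phi> x - ext0 d N \<phi> y))"

text \<open>The measure \<open>s \<delta>\<^sub>0 + Lebesgue\<close> on \<open>[0, \<infinity>)\<close>.\<close>

definition site_measure :: "real \<Rightarrow> real measure" where
  "site_measure s =
     measure_of {0..} (sets (restrict_space borel {0..}))
       (\<lambda>A. ennreal s * indicator A 0 + emeasure lborel A)"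

definition reference_measure :: "nat \<Rightarrow> nat \<Rightarrow> real \<Rightarrow> interface measure" where
  "reference_measure d N s = (\<Pi>\<^sub>M x\<in>site_box d N. site_measure s)"

definition partition_function :: "nat \<Rightarrow> nat \<Rightarrow> (real \<Rightarrow> real) \<Rightarrow> real \<Rightarrow> real" where
  "partition_function d N V s =
     (\<integral>\<phi>. exp (- Hamiltonian d N V \<phi>) \<partial>reference_measure d N s)"

definition gibbs_density :: "nat \<Rightarrow> nat \<Rightarrow> (real \<Rightarrow> real) \<Rightarrow> real \<Rightarrow> interface \<Rightarrow> real" where
  "gibbs_density d N V s \<phi> = 1 / partition_function d N V s * exp (- Hamiltonian d N V \<phi>)"

definition gibbs_measure :: "nat \<Rightarrow> nat \<Rightarrow> (real \<Rightarrow> real) \<Rightarrow> real \<Rightarrow> interface measure" where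
  "gibbs_measure d N V s =
     density (reference_measure d N s) (\<lambda>\<phi>. ennreal (gibbs_density d N V s \<phi>))"

definition wet_region :: "nat \<Rightarrow> nat \<Rightarrow> site set \<Rightarrow> interface set" where
  "wet_region d N B = {\<phi> \<in> state_space d N. {x \<in> site_box d N. \<phi> x > 0} = B}"

definition gibbs_wet ::
    "nat \<Rightarrow> nat \<Rightarrow> (real \<Rightarrow> real) \<Rightarrow> real \<Rightarrow> site set \<Rightarrow> interface measure" where
  "gibbs_wet d N V s B = restrict_space (gibbs_measure d N V s) (wet_region d N B)"

definition interior_space :: "nat \<Rightarrow> nat \<Rightarrow> interface set" where
  "interior_space d N = (site_box d N \<rightarrow>\<^sub>E {0<..})"

definition partial :: "site \<Rightarrow> (interface \<Rightarrow> real) \<Rightarrow> interface \<Rightarrow> real" where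
  "partial x F \<phi> = deriv (\<lambda>t. F (\<phi>(x := t))) (\<phi> x)"

text \<open>
  \<open>partial_ext\<close> is the extension of \<open>partial\<close> from the interior to the whole state space by
  continuity; it agrees with \<open>partial\<close> on the interior when the latter is continuous there.
\<close>

definition partial_ext :: "nat \<Rightarrow> nat \<Rightarrow> site \<Rightarrow> (interface \<Rightarrow> real) \<Rightarrow> interface \<Rightarrow> real" where
  "partial_ext d N x F \<phi> = Lim (at \<phi> within interior_space d N) (partial x F)"

text \<open>
  The partial derivative with respect to \<open>\<phi>\<^sub>x\<close> exists on the interior and extends continuously to the
  state space; in particular it is continuous on the interior.
\<close>

definition has_partial_ext :: "nat \<Rightarrow> nat \<Rightarrow> site \<Rightarrow> (interface \<Rightarrow> real) \<Rightarrow> bool" where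
  "has_partial_ext d N x F \<longleftrightarrow>
     (\<forall>\<phi>\<in>interior_space d N. (\<lambda>t. F (\<phi>(x := t))) differentiable (at (\<phi> x))) \<and>
     (\<exists>g. continuous_on (state_space d N) g \<and> (\<forall>\<phi>\<in>interior_space d N. g \<phi> = partial x F \<phi>))"

definition Cc2 :: "nat \<Rightarrow> nat \<Rightarrow> (interface \<Rightarrow> real) set" where
  "Cc2 d N =
     {F \<in> Cc (state_space d N).
        \<forall>x\<in>site_box d N. has_partial_ext d N x F \<and>
          (\<forall>y\<in>site_box d N. has_partial_ext d N y (partial x F))}"

definition wet_form ::
    "nat \<Rightarrow> nat \<Rightarrow> (real \<Rightarrow> real) \<Rightarrow> real \<Rightarrow> site set \<Rightarrow> interface bilin" where
  "wet_form d N V s B F G =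
     (\<Sum>x\<in>B. \<integral>\<phi>. partial_ext d N x F \<phi> * partial_ext d N x G \<phi> \<partial>gibbs_wet d N V s B)"

definition wetting_form :: "nat \<Rightarrow> nat \<Rightarrow> (real \<Rightarrow> real) \<Rightarrow> real \<Rightarrow> interface bilin" where
  "wetting_form d N V s F G = (\<Sum>B | B \<noteq> {} \<and> B \<subseteq> site_box d N. wet_form d N V s B F G)"

end

theory Submission
  imports Defs
begin

text \<open>
  For \<open>x\<close> in the box let \<open>\<nabla>\<^sub>x F\<close> be \<open>\<partial>\<^sub>x F\<close> where \<open>\<phi> x > 0\<close> and \<open>0\<close> where \<open>\<phi> x = 0\<close>. The strata indexed by the
  sets \<open>B\<close> containing \<open>x\<close> partition \<open>{\<phi>. \<phi> x > 0}\<close>, so the form is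
  \<open>\<E>(F, G) = \<Sum>\<^sub>x \<integral> \<nabla>\<^sub>x F \<nabla>\<^sub>x G d\<mu>\<close> (\<open>wetting_form_eq\<close>): it comes from an operator
  \<open>\<nabla> = (\<nabla>\<^sub>x)\<^sub>x\<close> into finitely many copies of \<open>L\<^sup>2(\<mu>)\<close>. The proof has an abstract half, about forms given by
  such a gradient on a finite measure space, and a concrete half, about this gradient.

  Abstract half. If \<open>\<nabla>\<close> is closable, every \<open>u\<close> in the domain of the closed form has a weak gradient, the
  \<open>L\<^sup>2\<close>-limit of the gradients of any approximating sequence, and the closed form is again the sum of the
  integrals of products of gradients (\<open>closure_form_eq\<close>). Closedness follows from completeness of \<open>L\<^sup>2\<close>.
  The other properties come from the chain rule \<open>\<nabla> \<eta>(u) = \<eta>'(u) \<nabla> u\<close>, extended to pointwise limits of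
  smooth \<open>\<eta>\<close> and \<open>\<eta>'\<close> (\<open>weak_grad_compose_limit\<close>). Smooth approximations of \<open>min (max t 0) 1\<close> give the unit
  contraction. Functions \<open>\<eta>\<^sub>n \<rightarrow> 0\<close> whose derivatives tend to the indicator of \<open>{c}\<close> show that \<open>\<nabla> u = 0\<close> almost
  everywhere on \<open>{u = c}\<close> (\<open>weak_grad_level_set\<close>), which is strong locality. If \<open>1\<close> is in the domain with
  gradient \<open>0\<close>, then \<open>\<alpha> G\<^sub>\<alpha> 1 = 1\<close>, and the form is conservative.

  Concrete half. The partition function is finite because the potential energy of the bonds from each
  site to its neighbour one step down in the first coordinate already makes \<open>exp (- H)\<close> integrable: these
  bonds form a forest rooted in the boundary, which can be integrated out site by site (\<open>nn_integral_tree_bound\<close>, \<open>Hamiltonian_lower_bound\<close>). Density of the test functions in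
  \<open>L\<^sup>2(\<mu>)\<close> is a Dynkin argument starting from boxes, uniform density is the Stone-Weierstrass theorem, and
  smooth cutoffs at radius \<open>R\<close> tend to \<open>1\<close> with gradients of order \<open>1 / R\<close>. Closability of \<open>\<nabla>\<close> rests on the
  identity \<open>\<integral> 1\<^sub>{\<phi> x > 0} (\<phi> x \<partial>\<^sub>x F + F) d\<nu> = 0\<close> for the reference measure \<open>\<nu>\<close>, that is on
  \<open>\<integral> (t f(t))' dt = 0\<close> along each line (\<open>integration_by_parts\<close>). If \<open>U\<^sub>n \<rightarrow> 0\<close> and \<open>\<nabla>\<^sub>x U\<^sub>n \<rightarrow> w\<close> in \<open>L\<^sup>2(\<mu>)\<close>, the
  identity for \<open>U\<^sub>n G\<close> passes to the limit and says that \<open>w\<close>, multiplied by a weight that is positive where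
  \<open>\<phi> x > 0\<close>, is orthogonal to all test functions \<open>G\<close>; hence \<open>w = 0\<close> (\<open>wet_grad_closable\<close>). Here the Gibbs
  density may be divided out since it is bounded below on cubes.
\<close>

section \<open>Convergence in \<open>L\<^sup>2\<close> of a finite measure\<close>

lemma L2_spaceI: "f \<in> borel_measurable M \<Longrightarrow> integrable M (\<lambda>p. (f p)\<^sup>2) \<Longrightarrow> f \<in> L2_space M"
  by (simp add: L2_space_def)

lemma L2_measurable [measurable_dest]: "f \<in> L2_space M \<Longrightarrow> f \<in> borel_measurable M"
  by (simp add: L2_space_def)

lemma L2_square_integrable: "f \<in> L2_space M \<Longrightarrow> integrable M (\<lambda>p. (f p)\<^sup>2)"
  by (simp add: L2_space_def)

lemma L2_zero: "(\<lambda>_. 0) \<in> L2_space M"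
  by (simp add: L2_space_def)

lemma L2_mult_integrable:
  assumes "f \<in> L2_space M" "g \<in> L2_space M"
  shows "integrable M (\<lambda>p. f p * g p)"
proof (rule Bochner_Integration.integrable_bound)
  show "integrable M (\<lambda>p. (f p)\<^sup>2 + (g p)\<^sup>2)"
    using assms by (auto simp: L2_space_def)
  show "(\<lambda>p. f p * g p) \<in> borel_measurable M"
    using assms by (auto simp: L2_space_def)
  have "\<bar>f p * g p\<bar> \<le> (f p)\<^sup>2 + (g p)\<^sup>2" for p
    using sum_squares_bound[of "\<bar>f p\<bar>" "\<bar>g p\<bar>"] abs_ge_zero[of "f p * g p"]
    unfolding abs_mult power2_abs by linarith
  then show "AE p in M. norm (f p * g p) \<le> norm ((f p)\<^sup>2 + (g p)\<^sup>2)"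
    by (intro AE_I2) (simp add: abs_of_nonneg)
qed

lemma L2_add:
  assumes "f \<in> L2_space M" "g \<in> L2_space M"
  shows "(\<lambda>p. f p + g p) \<in> L2_space M"
proof (rule L2_spaceI)
  have "integrable M (\<lambda>p. (f p)\<^sup>2 + (g p)\<^sup>2 + 2 * (f p * g p))"
    by (intro Bochner_Integration.integrable_add L2_square_integrable integrable_mult_right
        L2_mult_integrable assms)
  then show "integrable M (\<lambda>p. (f p + g p)\<^sup>2)"
    by (simp add: power2_sum mult.assoc)
qed (use assms in \<open>auto simp: L2_space_def\<close>)

lemma L2_scale: "f \<in> L2_space M \<Longrightarrow> (\<lambda>p. c * f p) \<in> L2_space M"
  by (auto simp: L2_space_def power_mult_distrib)

lemma L2_diff: "f \<in> L2_space M \<Longrightarrow> g \<in> L2_space M \<Longrightarrow> (\<lambda>p. f p - g p) \<in> L2_space M"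
  using L2_add[of f M "\<lambda>p. (-1) * g p"] L2_scale[of g M "-1"] by simp

lemma L2_bound:
  assumes "f \<in> L2_space M" "g \<in> borel_measurable M" "\<And>p. p \<in> space M \<Longrightarrow> \<bar>g p\<bar> \<le> C * \<bar>f p\<bar>"
  shows "g \<in> L2_space M"
proof (rule L2_spaceI)
  show "integrable M (\<lambda>p. (g p)\<^sup>2)"
  proof (rule Bochner_Integration.integrable_bound)
    show "integrable M (\<lambda>p. (C * f p)\<^sup>2)"
      by (rule L2_square_integrable[OF L2_scale[OF assms(1)]])
    have "(g p)\<^sup>2 \<le> (C * f p)\<^sup>2" if "p \<in> space M" for p
    proof -
      have "\<bar>g p\<bar> \<le> \<bar>C * f p\<bar>"
        using assms(3)[OF that] mult_right_mono[OF abs_ge_self[of C] abs_ge_zero[of "f p"]]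
        unfolding abs_mult by linarith
      then show ?thesis by (simp add: abs_le_square_iff)
    qed
    then show "AE p in M. norm ((g p)\<^sup>2) \<le> norm ((C * f p)\<^sup>2)" by (intro AE_I2) auto
  qed (use assms in auto)
qed fact

lemma L2_bounded:
  assumes "finite_measure M" "g \<in> borel_measurable M" "\<And>p. p \<in> space M \<Longrightarrow> \<bar>g p\<bar> \<le> C"
  shows "g \<in> L2_space M"
proof -
  interpret finite_measure M by fact
  have "(\<lambda>_. 1) \<in> L2_space M" by (simp add: L2_space_def)
  from L2_bound[OF this assms(2), of C] assms(3) show ?thesis by simp
qed

lemma L2_add_bound:
  assumes "f \<in> L2_space M" "g \<in> L2_space M"
  shows "(\<integral>p. (f p + g p)\<^sup>2 \<partial>M) \<le> 2 * (\<integral>p. (f p)\<^sup>2 \<partial>M) + 2 * (\<integral>p. (g p)\<^sup>2 \<partial>M)"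
proof -
  have "(\<integral>p. (f p + g p)\<^sup>2 \<partial>M) \<le> (\<integral>p. 2 * (f p)\<^sup>2 + 2 * (g p)\<^sup>2 \<partial>M)"
  proof (rule integral_mono)
    show "integrable M (\<lambda>p. (f p + g p)\<^sup>2)"
      by (intro L2_square_integrable L2_add assms)
    show "integrable M (\<lambda>p. 2 * (f p)\<^sup>2 + 2 * (g p)\<^sup>2)"
      using assms by (auto simp: L2_space_def)
    show "(f p + g p)\<^sup>2 \<le> 2 * (f p)\<^sup>2 + 2 * (g p)\<^sup>2" for p
      using sum_squares_bound[of "f p" "g p"] by (simp add: power2_sum)
  qed
  also have "\<dots> = 2 * (\<integral>p. (f p)\<^sup>2 \<partial>M) + 2 * (\<integral>p. (g p)\<^sup>2 \<partial>M)"
    using assms by (simp add: L2_space_def)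
  finally show ?thesis .
qed

text \<open>
  Square norms are used throughout instead of norms: the quasi-triangle inequality \<open>L2_add_bound\<close> is
  enough for convergence.
\<close>

definition L2_conv :: "'a measure \<Rightarrow> (nat \<Rightarrow> 'a \<Rightarrow> real) \<Rightarrow> ('a \<Rightarrow> real) \<Rightarrow> bool" where
  "L2_conv M U u \<longleftrightarrow> (\<forall>n. U n \<in> L2_space M) \<and> u \<in> L2_space M \<and>
     (\<lambda>n. \<integral>p. (U n p - u p)\<^sup>2 \<partial>M) \<longlonglongrightarrow> 0"

lemma L2_norm_tendsto_iff:
  "(\<lambda>n. L2_norm M (f n)) \<longlonglongrightarrow> 0 \<longleftrightarrow> (\<lambda>n. \<integral>p. (f n p)\<^sup>2 \<partial>M) \<longlonglongrightarrow> 0"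
proof -
  have "(\<lambda>n. L2_norm M (f n)) = (\<lambda>n. sqrt (\<integral>p. (f n p)\<^sup>2 \<partial>M))"
    by (simp add: L2_norm_def L2_inner_def power2_eq_square)
  moreover have "(\<lambda>n. sqrt (\<integral>p. (f n p)\<^sup>2 \<partial>M)) \<longlonglongrightarrow> 0 \<longleftrightarrow> (\<lambda>n. \<integral>p. (f n p)\<^sup>2 \<partial>M) \<longlonglongrightarrow> 0"
  proof
    assume "(\<lambda>n. sqrt (\<integral>p. (f n p)\<^sup>2 \<partial>M)) \<longlonglongrightarrow> 0"
    from tendsto_power[OF this, of 2] show "(\<lambda>n. \<integral>p. (f n p)\<^sup>2 \<partial>M) \<longlonglongrightarrow> 0" by simp
  next
    assume "(\<lambda>n. \<integral>p. (f n p)\<^sup>2 \<partial>M) \<longlonglongrightarrow> 0"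
    from tendsto_real_sqrt[OF this] show "(\<lambda>n. sqrt (\<integral>p. (f n p)\<^sup>2 \<partial>M)) \<longlonglongrightarrow> 0" by simp
  qed
  ultimately show ?thesis by simp
qed

lemma L2_conv_iff_norm:
  "L2_conv M U u \<longleftrightarrow> (\<forall>n. U n \<in> L2_space M) \<and> u \<in> L2_space M \<and>
     (\<lambda>n. L2_norm M (\<lambda>p. U n p - u p)) \<longlonglongrightarrow> 0"
  by (simp add: L2_conv_def L2_norm_tendsto_iff)

lemma L2_conv_mem: "L2_conv M U u \<Longrightarrow> U n \<in> L2_space M" "L2_conv M U u \<Longrightarrow> u \<in> L2_space M"
  by (auto simp: L2_conv_def)

lemma L2_conv_const: "u \<in> L2_space M \<Longrightarrow> L2_conv M (\<lambda>_. u) u"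
  by (simp add: L2_conv_def)

lemma L2_conv_cong_AE:
  assumes "L2_conv M U u" "v \<in> borel_measurable M" "AE p in M. u p = v p"
  shows "L2_conv M U v"
proof -
  have [measurable]: "u \<in> borel_measurable M" "v \<in> borel_measurable M"
    "\<And>n. U n \<in> borel_measurable M"
    using assms by (auto simp: L2_conv_def L2_space_def)
  have "integrable M (\<lambda>p. (v p)\<^sup>2)"
  proof (rule iffD1[OF integrable_cong_AE, rotated -1])
    show "integrable M (\<lambda>p. (u p)\<^sup>2)" using assms(1) by (simp add: L2_conv_def L2_space_def)
    show "AE p in M. (u p)\<^sup>2 = (v p)\<^sup>2" using assms(3) by eventually_elim simp
  qed auto
  then have "v \<in> L2_space M" by (simp add: L2_space_def)
  moreover have "(\<integral>p. (U n p - u p)\<^sup>2 \<partial>M) = (\<integral>p. (U n p - v p)\<^sup>2 \<partial>M)" for n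
    by (rule integral_cong_AE) (use assms(3) in auto)
  ultimately show ?thesis using assms(1) by (simp add: L2_conv_def)
qed

lemma L2_conv_cong:
  assumes "L2_conv M U u" "\<And>n p. p \<in> space M \<Longrightarrow> U n p = W n p"
  shows "L2_conv M W u"
proof -
  have "W n \<in> L2_space M" for n
    using assms(1) measurable_cong[of M "U n" "W n" borel] assms(2)[of _ n]
      Bochner_Integration.integrable_cong[of M M "\<lambda>p. (U n p)\<^sup>2" "\<lambda>p. (W n p)\<^sup>2"]
    by (simp add: L2_conv_def L2_space_def)
  moreover have "(\<integral>p. (U n p - u p)\<^sup>2 \<partial>M) = (\<integral>p. (W n p - u p)\<^sup>2 \<partial>M)" for n
    by (rule Bochner_Integration.integral_cong) (use assms(2) in auto)
  ultimately show ?thesis using assms(1) by (simp add: L2_conv_def)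
qed

lemma L2_conv_add:
  assumes "L2_conv M U u" "L2_conv M W w"
  shows "L2_conv M (\<lambda>n p. U n p + W n p) (\<lambda>p. u p + w p)"
  unfolding L2_conv_def
proof (intro conjI allI)
  note m = L2_conv_mem[OF assms(1)] L2_conv_mem[OF assms(2)]
  show "(\<lambda>p. U n p + W n p) \<in> L2_space M" for n by (intro L2_add m)
  show "(\<lambda>p. u p + w p) \<in> L2_space M" by (intro L2_add m)
  have le: "(\<integral>p. (U n p + W n p - (u p + w p))\<^sup>2 \<partial>M)
      \<le> 2 * (\<integral>p. (U n p - u p)\<^sup>2 \<partial>M) + 2 * (\<integral>p. (W n p - w p)\<^sup>2 \<partial>M)" for n
    using L2_add_bound[OF L2_diff[OF m(1,2)] L2_diff[OF m(3,4)], of n n]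
    by (simp add: algebra_simps)
  have lim: "(\<lambda>n. 2 * (\<integral>p. (U n p - u p)\<^sup>2 \<partial>M) + 2 * (\<integral>p. (W n p - w p)\<^sup>2 \<partial>M)) \<longlonglongrightarrow> 0"
    using assms by (auto simp: L2_conv_def intro!: tendsto_eq_intros)
  show "(\<lambda>n. \<integral>p. (U n p + W n p - (u p + w p))\<^sup>2 \<partial>M) \<longlonglongrightarrow> 0"
    by (rule tendsto_sandwich[OF _ _ tendsto_const lim]) (use le in auto)
qed

lemma L2_conv_scale:
  assumes "L2_conv M U u"
  shows "L2_conv M (\<lambda>n p. c * U n p) (\<lambda>p. c * u p)"
proof -
  have "(\<integral>p. (c * U n p - c * u p)\<^sup>2 \<partial>M) = c\<^sup>2 * (\<integral>p. (U n p - u p)\<^sup>2 \<partial>M)" for n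
    by (simp add: power_mult_distrib flip: right_diff_distrib)
  then show ?thesis
    using assms by (auto simp: L2_conv_def L2_scale intro!: tendsto_eq_intros)
qed

lemma L2_conv_diff:
  assumes "L2_conv M U u" "L2_conv M W w"
  shows "L2_conv M (\<lambda>n p. U n p - W n p) (\<lambda>p. u p - w p)"
  using L2_conv_add[OF assms(1) L2_conv_scale[OF assms(2), of "-1"]] by simp

lemma L2_conv_square:
  assumes "L2_conv M U u"
  shows "(\<lambda>n. \<integral>p. (U n p)\<^sup>2 \<partial>M) \<longlonglongrightarrow> (\<integral>p. (u p)\<^sup>2 \<partial>M)"
proof -
  note m = L2_conv_mem[OF assms]
  define a where "a n = (\<integral>p. (U n p - u p)\<^sup>2 \<partial>M)" for n
  define c where "c = (\<integral>p. (u p)\<^sup>2 \<partial>M)"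
  have a0: "a \<longlonglongrightarrow> 0" using assms by (simp add: L2_conv_def a_def[abs_def])
  have a_nn: "a n \<ge> 0" for n by (simp add: a_def)
  \<comment> \<open>Young's inequality with a free weight \<open>r\<close> for the cross term; below, \<open>r\<close> is fixed so that
    \<open>r * c\<close> is at most \<open>e / 2\<close>, and then \<open>n\<close> is taken large.\<close>
  have bd: "\<bar>(\<integral>p. (U n p)\<^sup>2 \<partial>M) - c\<bar> \<le> a n + (a n / r + r * c)" if "r > 0" for n r
  proof -
    have i: "integrable M (\<lambda>p. (U n p - u p)\<^sup>2)" "integrable M (\<lambda>p. (u p)\<^sup>2)"
      "integrable M (\<lambda>p. (U n p - u p) * u p)" "integrable M (\<lambda>p. (U n p)\<^sup>2)"
      by (intro L2_square_integrable L2_mult_integrable L2_diff m)+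
    have "(\<integral>p. (U n p)\<^sup>2 \<partial>M) = (\<integral>p. (U n p - u p)\<^sup>2 + 2 * ((U n p - u p) * u p) + (u p)\<^sup>2 \<partial>M)"
      by (simp add: power2_eq_square algebra_simps)
    also have "\<dots> = a n + 2 * (\<integral>p. (U n p - u p) * u p \<partial>M) + c"
      using i by (simp add: a_def c_def)
    finally have eq: "(\<integral>p. (U n p)\<^sup>2 \<partial>M) - c = a n + 2 * (\<integral>p. (U n p - u p) * u p \<partial>M)" by simp
    have y: "\<bar>2 * (x * y)\<bar> \<le> x\<^sup>2 / r + r * y\<^sup>2" for x y :: real
    proof -
      have "0 \<le> (\<bar>x\<bar> - r * \<bar>y\<bar>)\<^sup>2" by simp
      then have "2 * r * (\<bar>x\<bar> * \<bar>y\<bar>) \<le> x\<^sup>2 + r\<^sup>2 * y\<^sup>2"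
        by (simp add: power2_diff power_mult_distrib algebra_simps)
      then show ?thesis using that by (simp add: field_simps abs_mult power2_eq_square)
    qed
    have "\<bar>2 * (\<integral>p. (U n p - u p) * u p \<partial>M)\<bar> = \<bar>\<integral>p. 2 * ((U n p - u p) * u p) \<partial>M\<bar>" by simp
    also have "\<dots> \<le> (\<integral>p. \<bar>2 * ((U n p - u p) * u p)\<bar> \<partial>M)"
      by (rule integral_abs_bound)
    also have "\<dots> \<le> (\<integral>p. (U n p - u p)\<^sup>2 / r + r * (u p)\<^sup>2 \<partial>M)"
      by (intro integral_mono) (use i y in auto)
    also have "\<dots> = a n / r + r * c" using i by (simp add: a_def c_def)
    finally show ?thesis using eq a_nn[of n] by linarith
  qed
  show ?thesis
  proof (rule LIMSEQ_I)
    fix e :: real assume e: "e > 0"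
    define r where "r = e / (2 * (c + 1))"
    have c: "c \<ge> 0" by (simp add: c_def)
    have r: "r > 0" using e c by (simp add: r_def)
    have rc: "r * c \<le> e / 2" using e c by (simp add: r_def field_simps)
    have "(\<lambda>n. a n + a n / r) \<longlonglongrightarrow> 0" using r a0 by (auto intro!: tendsto_eq_intros)
    from LIMSEQ_D[OF this, of "e/2"] e obtain N where N: "\<And>n. n \<ge> N \<Longrightarrow> \<bar>a n + a n / r\<bar> < e / 2"
      by auto
    show "\<exists>N. \<forall>n\<ge>N. norm ((\<integral>p. (U n p)\<^sup>2 \<partial>M) - (\<integral>p. (u p)\<^sup>2 \<partial>M)) < e"
    proof (intro exI allI impI)
      fix n assume "n \<ge> N"
      from N[OF this] bd[OF r, of n] rc
      show "norm ((\<integral>p. (U n p)\<^sup>2 \<partial>M) - (\<integral>p. (u p)\<^sup>2 \<partial>M)) < e"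
        unfolding c_def real_norm_def by linarith
    qed
  qed
qed

text \<open>
  By polarization, inner products converge because square norms do.
\<close>

lemma L2_conv_inner:
  assumes "L2_conv M U u" "L2_conv M W w"
  shows "(\<lambda>n. \<integral>p. U n p * W n p \<partial>M) \<longlonglongrightarrow> (\<integral>p. u p * w p \<partial>M)"
proof -
  have pol: "(\<integral>p. f p * g p \<partial>M) = ((\<integral>p. (f p + g p)\<^sup>2 \<partial>M) - (\<integral>p. (f p)\<^sup>2 \<partial>M) - (\<integral>p. (g p)\<^sup>2 \<partial>M)) / 2"
    if "f \<in> L2_space M" "g \<in> L2_space M" for f g
  proof -
    have "(\<integral>p. (f p + g p)\<^sup>2 \<partial>M) = (\<integral>p. (f p)\<^sup>2 + (g p)\<^sup>2 + 2 * (f p * g p) \<partial>M)"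
      by (simp add: power2_sum mult.assoc)
    also have "\<dots> = (\<integral>p. (f p)\<^sup>2 \<partial>M) + (\<integral>p. (g p)\<^sup>2 \<partial>M) + 2 * (\<integral>p. f p * g p \<partial>M)"
      using that L2_mult_integrable[OF that] by (simp add: L2_space_def)
    finally show ?thesis by simp
  qed
  note m = L2_conv_mem[OF assms(1)] L2_conv_mem[OF assms(2)]
  show ?thesis
    unfolding pol[OF m(1,3)] pol[OF m(2,4)]
    by (intro tendsto_divide tendsto_diff L2_conv_square L2_conv_add assms tendsto_const) simp
qed

lemma L2_AE_zero_iff:
  assumes "f \<in> L2_space M"
  shows "(\<integral>p. (f p)\<^sup>2 \<partial>M) = 0 \<longleftrightarrow> (AE p in M. f p = 0)"
  using integral_nonneg_eq_0_iff_AE[OF L2_square_integrable[OF assms]] by simp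

lemma L2_conv_unique:
  assumes "L2_conv M U u" "L2_conv M U v"
  shows "AE p in M. u p = v p"
proof -
  have "L2_conv M (\<lambda>n p. 0) (\<lambda>p. u p - v p)"
    using L2_conv_diff[OF assms] by simp
  from L2_conv_square[OF this] have "(\<integral>p. (u p - v p)\<^sup>2 \<partial>M) = 0"
    by (simp add: LIMSEQ_const_iff)
  with L2_AE_zero_iff[OF L2_diff[OF L2_conv_mem(2)[OF assms(1)] L2_conv_mem(2)[OF assms(2)]]]
  show ?thesis by simp
qed

lemma L2_conv_subseq:
  assumes "L2_conv M U u" "strict_mono r"
  shows "L2_conv M (\<lambda>n. U (r n)) u"
  using assms LIMSEQ_subseq_LIMSEQ[of "\<lambda>n. \<integral>p. (U n p - u p)\<^sup>2 \<partial>M" 0 r]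
  by (auto simp: L2_conv_def o_def)

lemma L2_conv_AE_subseq:
  assumes "L2_conv M U u"
  obtains r :: "nat \<Rightarrow> nat" where "strict_mono r" "AE p in M. (\<lambda>n. U (r n) p) \<longlonglongrightarrow> u p"
proof -
  have "\<exists>r::nat\<Rightarrow>nat. strict_mono r \<and> (AE p in M. (\<lambda>n. (U (r n) p - u p)\<^sup>2) \<longlonglongrightarrow> 0)"
    using assms
    by (intro tendsto_L1_AE_subseq L2_square_integrable L2_diff) (auto simp: L2_conv_def)
  then obtain r :: "nat \<Rightarrow> nat" where r: "strict_mono r" "AE p in M. (\<lambda>n. (U (r n) p - u p)\<^sup>2) \<longlonglongrightarrow> 0"
    by blast
  from r(2) have "AE p in M. (\<lambda>n. U (r n) p) \<longlonglongrightarrow> u p"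
  proof eventually_elim
    fix p assume "(\<lambda>n. (U (r n) p - u p)\<^sup>2) \<longlonglongrightarrow> 0"
    from tendsto_real_sqrt[OF this] have "(\<lambda>n. U (r n) p - u p) \<longlonglongrightarrow> 0"
      by (simp add: tendsto_rabs_zero_iff)
    then show "(\<lambda>n. U (r n) p) \<longlonglongrightarrow> u p" by (simp add: LIM_zero_iff)
  qed
  with r(1) that show ?thesis by blast
qed

lemma L2_conv_dominated:
  assumes h: "h \<in> L2_space M" and m: "\<And>n. U n \<in> borel_measurable M" "u \<in> borel_measurable M"
    and lim: "AE p in M. (\<lambda>n. U n p) \<longlonglongrightarrow> u p"
    and bd: "\<And>n. AE p in M. \<bar>U n p\<bar> \<le> \<bar>h p\<bar>"
  shows "L2_conv M U u"
proof -
  note [measurable] = m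
  have hm [measurable]: "h \<in> borel_measurable M" using h by (rule L2_measurable)
  have all: "AE p in M. \<forall>n. \<bar>U n p\<bar> \<le> \<bar>h p\<bar>" using bd by (simp add: AE_all_countable)
  have ubd: "AE p in M. \<bar>u p\<bar> \<le> \<bar>h p\<bar>"
    using all lim by eventually_elim (auto intro!: LIMSEQ_le_const2[OF tendsto_rabs])
  have dom: "f \<in> L2_space M" if [measurable]: "f \<in> borel_measurable M"
    and b: "AE p in M. \<bar>f p\<bar> \<le> \<bar>h p\<bar>" for f
  proof (rule L2_spaceI[OF that(1)], rule Bochner_Integration.integrable_bound)
    show "integrable M (\<lambda>p. (h p)\<^sup>2)" by (rule L2_square_integrable[OF h])
    show "AE p in M. norm ((f p)\<^sup>2) \<le> norm ((h p)\<^sup>2)"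
      using b by eventually_elim (simp add: abs_le_square_iff)
  qed auto
  have "(\<lambda>n. \<integral>p. (U n p - u p)\<^sup>2 \<partial>M) \<longlonglongrightarrow> (\<integral>p. 0 \<partial>M)"
  proof (rule integral_dominated_convergence[where w="\<lambda>p. (2 * h p)\<^sup>2"])
    show "integrable M (\<lambda>p. (2 * h p)\<^sup>2)" by (rule L2_square_integrable[OF L2_scale[OF h]])
    show "AE p in M. (\<lambda>n. (U n p - u p)\<^sup>2) \<longlonglongrightarrow> 0"
      using lim by eventually_elim (auto intro!: tendsto_eq_intros)
    show "AE p in M. norm ((U n p - u p)\<^sup>2) \<le> (2 * h p)\<^sup>2" for n
      using ubd all
    proof eventually_elim
      fix p assume a: "\<bar>u p\<bar> \<le> \<bar>h p\<bar>" "\<forall>n. \<bar>U n p\<bar> \<le> \<bar>h p\<bar>"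
      have "\<bar>U n p - u p\<bar> \<le> \<bar>2 * h p\<bar>" using a(1) spec[OF a(2), of n] by linarith
      then show "norm ((U n p - u p)\<^sup>2) \<le> (2 * h p)\<^sup>2" by (simp only: abs_le_square_iff) simp
    qed
  qed auto
  then show ?thesis using dom[OF m(1) bd] dom[OF m(2) ubd] by (simp add: L2_conv_def)
qed

definition L2_Cauchy :: "'a measure \<Rightarrow> (nat \<Rightarrow> 'a \<Rightarrow> real) \<Rightarrow> bool" where
  "L2_Cauchy M U \<longleftrightarrow> (\<forall>e>0. \<exists>n0. \<forall>m\<ge>n0. \<forall>n\<ge>n0. (\<integral>p. (U m p - U n p)\<^sup>2 \<partial>M) < e)"

text \<open>
  On a finite measure space an \<open>L\<^sup>2\<close>-Cauchy sequence is \<open>L\<^sup>1\<close>-Cauchy, so a subsequence converges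
  almost everywhere; Fatou's lemma shows that the sequence tends to its limit in \<open>L\<^sup>2\<close>.
\<close>

lemma L2_complete:
  assumes fin: "finite_measure M" and U: "\<And>n. U n \<in> L2_space M" and C: "L2_Cauchy M U"
  obtains u where "L2_conv M U u"
proof -
  interpret finite_measure M by fact
  note [measurable] = L2_measurable[OF U]
  have one: "(\<lambda>_. 1) \<in> L2_space M" by (simp add: L2_space_def)
  have int: "integrable M (U n)" for n
    using L2_mult_integrable[OF U[of n] one] by simp
  have L1: "\<exists>N. \<forall>i\<ge>N. \<forall>j\<ge>N. (\<integral>p. norm (U i p - U j p) \<partial>M) < e" if e: "e > 0" for e
  proof -
    define K where "K = measure M (space M) + 1"
    have K: "K > 0" by (simp add: K_def add_nonneg_pos)
    define d where "d = e / (2 * K)"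
    have d: "d > 0" using e K by (simp add: d_def)
    obtain n0 where n0: "\<And>m n. m \<ge> n0 \<Longrightarrow> n \<ge> n0 \<Longrightarrow> (\<integral>p. (U m p - U n p)\<^sup>2 \<partial>M) < d * e / 2"
      using C d e unfolding L2_Cauchy_def by (metis half_gt_zero mult_pos_pos)
    show ?thesis
    proof (intro exI allI impI)
      fix i j assume ij: "i \<ge> n0" "j \<ge> n0"
      have s: "integrable M (\<lambda>p. (U i p - U j p)\<^sup>2)" by (intro L2_square_integrable L2_diff U)
      have "(\<integral>p. norm (U i p - U j p) \<partial>M) \<le> (\<integral>p. (U i p - U j p)\<^sup>2 / d + d \<partial>M)"
      proof (rule integral_mono)
        show "integrable M (\<lambda>p. norm (U i p - U j p))" using int by auto
        show "integrable M (\<lambda>p. (U i p - U j p)\<^sup>2 / d + d)" using s by auto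
        have "\<bar>x\<bar> \<le> x\<^sup>2 / d + d" for x
        proof -
          have "d * \<bar>x\<bar> \<le> x\<^sup>2 + d * d"
          proof -
            have "0 \<le> d * \<bar>x\<bar>" using d by simp
            moreover have "2 * (d * \<bar>x\<bar>) \<le> x\<^sup>2 + d * d"
              using sum_squares_bound[of "\<bar>x\<bar>" d] by (simp add: power2_eq_square mult.commute mult.left_commute)
            ultimately show ?thesis by linarith
          qed
          then have "(d * \<bar>x\<bar>) / d \<le> (x\<^sup>2 + d * d) / d" using d by (intro divide_right_mono) auto
          then show ?thesis using d by (simp add: add_divide_distrib)
        qed
        then show "norm (U i p - U j p) \<le> (U i p - U j p)\<^sup>2 / d + d" for p by simp
      qed
      also have "\<dots> = (\<integral>p. (U i p - U j p)\<^sup>2 \<partial>M) / d + d * measure M (space M)"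
        using s by simp
      also have "\<dots> < e / 2 + e / 2"
      proof (rule add_strict_mono)
        show "(\<integral>p. (U i p - U j p)\<^sup>2 \<partial>M) / d < e / 2"
          using n0[OF ij] d by (simp add: field_simps)
        show "d * measure M (space M) < e / 2"
          using e K by (simp add: d_def K_def field_simps)
      qed
      finally show "(\<integral>p. norm (U i p - U j p) \<partial>M) < e" by simp
    qed
  qed
  obtain r :: "nat \<Rightarrow> nat" where r: "strict_mono r" "AE p in M. Cauchy (\<lambda>i. U (r i) p)"
    using cauchy_L1_AE_cauchy_subseq[OF int L1] by blast
  define u where "u p = lim (\<lambda>i. U (r i) p)" for p
  have um [measurable]: "u \<in> borel_measurable M" unfolding u_def[abs_def] by measurable
  have lim: "AE p in M. (\<lambda>i. U (r i) p) \<longlonglongrightarrow> u p"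
    using r(2) by eventually_elim (simp add: u_def Cauchy_convergent_iff convergent_LIMSEQ_iff)
  have bound: "(\<integral>\<^sup>+p. ennreal ((U n p - u p)\<^sup>2) \<partial>M) \<le> ennreal e"
    if n0: "\<And>m n. m \<ge> n0 \<Longrightarrow> n \<ge> n0 \<Longrightarrow> (\<integral>p. (U m p - U n p)\<^sup>2 \<partial>M) < e" and n: "n \<ge> n0" for e n0 n
  proof -
    have "(\<integral>\<^sup>+p. ennreal ((U n p - u p)\<^sup>2) \<partial>M)
        = (\<integral>\<^sup>+p. liminf (\<lambda>i. ennreal ((U n p - U (r i) p)\<^sup>2)) \<partial>M)"
    proof (rule nn_integral_cong_AE)
      show "AE p in M. ennreal ((U n p - u p)\<^sup>2) = liminf (\<lambda>i. ennreal ((U n p - U (r i) p)\<^sup>2))"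
        using lim
      proof eventually_elim
        fix p assume "(\<lambda>i. U (r i) p) \<longlonglongrightarrow> u p"
        then have "(\<lambda>i. ennreal ((U n p - U (r i) p)\<^sup>2)) \<longlonglongrightarrow> ennreal ((U n p - u p)\<^sup>2)"
          by (intro tendsto_intros)
        then show "ennreal ((U n p - u p)\<^sup>2) = liminf (\<lambda>i. ennreal ((U n p - U (r i) p)\<^sup>2))"
          by (rule lim_imp_Liminf[OF sequentially_bot, symmetric])
      qed
    qed
    also have "\<dots> \<le> liminf (\<lambda>i. \<integral>\<^sup>+p. ennreal ((U n p - U (r i) p)\<^sup>2) \<partial>M)"
      by (rule nn_integral_liminf) measurable
    also have "\<dots> \<le> ennreal e"
    proof (rule Liminf_le)
      show "\<forall>\<^sub>F i in sequentially. (\<integral>\<^sup>+p. ennreal ((U n p - U (r i) p)\<^sup>2) \<partial>M) \<le> ennreal e"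
        using eventually_ge_at_top[of n0]
      proof eventually_elim
        fix i assume "i \<ge> n0"
        then have "r i \<ge> n0" using seq_suble[OF r(1), of i] by linarith
        from n0[OF n this] have "(\<integral>p. (U n p - U (r i) p)\<^sup>2 \<partial>M) \<le> e" by simp
        then show "(\<integral>\<^sup>+p. ennreal ((U n p - U (r i) p)\<^sup>2) \<partial>M) \<le> ennreal e"
          by (subst nn_integral_eq_integral) (auto intro!: L2_square_integrable L2_diff U ennreal_leI)
      qed
    qed simp
    finally show ?thesis .
  qed
  have dL2: "(\<lambda>p. U n p - u p) \<in> L2_space M" if n0: "\<And>m n. m \<ge> n0 \<Longrightarrow> n \<ge> n0 \<Longrightarrow> (\<integral>p. (U m p - U n p)\<^sup>2 \<partial>M) < e"
    and n: "n \<ge> n0" for e n0 n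
  proof (rule L2_spaceI)
    show "integrable M (\<lambda>p. (U n p - u p)\<^sup>2)"
      using bound[OF n0 n] by (intro integrableI_bounded) (auto simp: le_less_trans)
  qed auto
  obtain n1 where n1: "\<And>m n. m \<ge> n1 \<Longrightarrow> n \<ge> n1 \<Longrightarrow> (\<integral>p. (U m p - U n p)\<^sup>2 \<partial>M) < 1"
    using C unfolding L2_Cauchy_def by (meson zero_less_one)
  have uL2: "u \<in> L2_space M"
  proof -
    have "(\<lambda>p. U n1 p - u p) \<in> L2_space M" by (rule dL2[OF n1]) auto
    from L2_diff[OF U[of n1] this] show ?thesis by simp
  qed
  have "(\<lambda>n. \<integral>p. (U n p - u p)\<^sup>2 \<partial>M) \<longlonglongrightarrow> 0"
  proof (rule LIMSEQ_I)
    fix e :: real assume e: "e > 0"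
    obtain n0 where n0: "\<And>m n. m \<ge> n0 \<Longrightarrow> n \<ge> n0 \<Longrightarrow> (\<integral>p. (U m p - U n p)\<^sup>2 \<partial>M) < e / 2"
      using C e unfolding L2_Cauchy_def by (meson half_gt_zero)
    have "(\<integral>p. (U n p - u p)\<^sup>2 \<partial>M) \<le> e / 2" if n: "n \<ge> n0" for n
    proof -
      have i: "integrable M (\<lambda>p. (U n p - u p)\<^sup>2)" by (intro L2_square_integrable L2_diff U uL2)
      have "ennreal (\<integral>p. (U n p - u p)\<^sup>2 \<partial>M) \<le> ennreal (e / 2)"
        using bound[OF n0 n] nn_integral_eq_integral[OF i] by simp
      then show ?thesis using e by (simp add: ennreal_le_iff)
    qed
    then show "\<exists>n0. \<forall>n\<ge>n0. norm ((\<integral>p. (U n p - u p)\<^sup>2 \<partial>M) - 0) < e"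
      using e by (intro exI[of _ n0]) (fastforce simp: abs_of_nonneg)
  qed
  then have "L2_conv M U u" using U uL2 by (simp add: L2_conv_def)
  then show thesis by (rule that)
qed

section \<open>Closable gradient forms\<close>

text \<open>
  The form is determined by a linear operator \<open>grad\<close>. The assumption \<open>grad_closable\<close> is closability of this
  operator; the chain rule is assumed for \<open>C\<^sup>2\<close> functions fixing \<open>0\<close>, since composition
  with these preserves \<open>C\<^sup>2\<close> regularity and compact support.
\<close>

locale gradient_form = finite_measure M
  for M :: "'a measure" +
  fixes D :: "('a \<Rightarrow> real) set" and I :: "'i set"
    and grad :: "'i \<Rightarrow> ('a \<Rightarrow> real) \<Rightarrow> 'a \<Rightarrow> real" and E :: "'a bilin"
  assumes finite_I: "finite I"
    and dense_D: "densely_defined M D"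
    and D_zero: "(\<lambda>_. 0) \<in> D"
    and D_add: "u \<in> D \<Longrightarrow> v \<in> D \<Longrightarrow> (\<lambda>p. u p + v p) \<in> D"
    and D_scale: "u \<in> D \<Longrightarrow> (\<lambda>p. c * u p) \<in> D"
    and grad_L2: "u \<in> D \<Longrightarrow> i \<in> I \<Longrightarrow> grad i u \<in> L2_space M"
    and grad_add: "u \<in> D \<Longrightarrow> v \<in> D \<Longrightarrow> i \<in> I \<Longrightarrow> p \<in> space M \<Longrightarrow>
          grad i (\<lambda>p. u p + v p) p = grad i u p + grad i v p"
    and grad_scale: "u \<in> D \<Longrightarrow> i \<in> I \<Longrightarrow> p \<in> space M \<Longrightarrow> grad i (\<lambda>p. c * u p) p = c * grad i u p"
    and E_eq: "u \<in> D \<Longrightarrow> v \<in> D \<Longrightarrow> E u v = (\<Sum>i\<in>I. \<integral>p. grad i u p * grad i v p \<partial>M)"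
    and grad_closable: "(\<And>n. U n \<in> D) \<Longrightarrow> L2_conv M U (\<lambda>_. 0) \<Longrightarrow>
          (\<And>j. j \<in> I \<Longrightarrow> L2_conv M (\<lambda>n. grad j (U n)) (w j)) \<Longrightarrow> i \<in> I \<Longrightarrow>
          AE p in M. w i p = 0"
    and D_compose: "u \<in> D \<Longrightarrow> \<eta> 0 = 0 \<Longrightarrow> (\<And>t. (\<eta> has_real_derivative \<eta>' t) (at t)) \<Longrightarrow>
          (\<And>t. (\<eta>' has_real_derivative \<eta>'' t) (at t)) \<Longrightarrow> continuous_on UNIV \<eta>'' \<Longrightarrow>
          (\<lambda>p. \<eta> (u p)) \<in> D"
    and grad_compose: "u \<in> D \<Longrightarrow> \<eta> 0 = 0 \<Longrightarrow> (\<And>t. (\<eta> has_real_derivative \<eta>' t) (at t)) \<Longrightarrow>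
          (\<And>t. (\<eta>' has_real_derivative \<eta>'' t) (at t)) \<Longrightarrow> continuous_on UNIV \<eta>'' \<Longrightarrow>
          i \<in> I \<Longrightarrow> p \<in> space M \<Longrightarrow> grad i (\<lambda>p. \<eta> (u p)) p = \<eta>' (u p) * grad i u p"
begin

lemma D_L2: "u \<in> D \<Longrightarrow> u \<in> L2_space M"
  using dense_D by (auto simp: densely_defined_def)

lemma D_diff: "u \<in> D \<Longrightarrow> v \<in> D \<Longrightarrow> (\<lambda>p. u p - v p) \<in> D"
  using D_add[of u "\<lambda>p. (-1) * v p"] D_scale[of v "-1"] by simp

lemma grad_diff:
  assumes "u \<in> D" "v \<in> D" "i \<in> I" "p \<in> space M"
  shows "grad i (\<lambda>p. u p - v p) p = grad i u p - grad i v p"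
  using grad_add[OF assms(1) D_scale[OF assms(2), of "-1"] assms(3,4)]
    grad_scale[OF assms(2-4), of "-1"] by simp

lemma E_diff_eq:
  assumes "u \<in> D" "v \<in> D"
  shows "E (\<lambda>p. u p - v p) (\<lambda>p. u p - v p) = (\<Sum>i\<in>I. \<integral>p. (grad i u p - grad i v p)\<^sup>2 \<partial>M)"
  unfolding E_eq[OF D_diff[OF assms] D_diff[OF assms]]
  by (intro sum.cong refl Bochner_Integration.integral_cong)
     (simp add: grad_diff[OF assms] power2_eq_square)

definition weak_grad :: "('a \<Rightarrow> real) \<Rightarrow> ('i \<Rightarrow> 'a \<Rightarrow> real) \<Rightarrow> bool" where
  "weak_grad u w \<longleftrightarrow> (\<exists>U. (\<forall>n. U n \<in> D) \<and> L2_conv M U u \<and> (\<forall>i\<in>I. L2_conv M (\<lambda>n. grad i (U n)) (w i)))"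

lemma weak_grad_L2: "weak_grad u w \<Longrightarrow> u \<in> L2_space M" "weak_grad u w \<Longrightarrow> i \<in> I \<Longrightarrow> w i \<in> L2_space M"
  by (auto simp: weak_grad_def L2_conv_def)

lemma weak_grad_D: "u \<in> D \<Longrightarrow> weak_grad u (\<lambda>i. grad i u)"
  unfolding weak_grad_def
  by (intro exI[of _ "\<lambda>_. u"]) (simp add: L2_conv_const D_L2 grad_L2)

lemma weak_grad_add:
  assumes "weak_grad u w" "weak_grad v z"
  shows "weak_grad (\<lambda>p. u p + v p) (\<lambda>i p. w i p + z i p)"
proof -
  obtain U W where U: "\<And>n. U n \<in> D" "L2_conv M U u" "\<And>i. i \<in> I \<Longrightarrow> L2_conv M (\<lambda>n. grad i (U n)) (w i)"
    and W: "\<And>n. W n \<in> D" "L2_conv M W v" "\<And>i. i \<in> I \<Longrightarrow> L2_conv M (\<lambda>n. grad i (W n)) (z i)"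
    using assms unfolding weak_grad_def by metis
  show ?thesis unfolding weak_grad_def
  proof (intro exI conjI allI ballI)
    show "(\<lambda>p. U n p + W n p) \<in> D" for n by (intro D_add U W)
    show "L2_conv M (\<lambda>n p. U n p + W n p) (\<lambda>p. u p + v p)" by (intro L2_conv_add U W)
    show "L2_conv M (\<lambda>n. grad i (\<lambda>p. U n p + W n p)) (\<lambda>p. w i p + z i p)" if "i \<in> I" for i
      by (rule L2_conv_cong[OF L2_conv_add[OF U(3)[OF that] W(3)[OF that]]])
         (simp add: grad_add[OF U(1) W(1) that])
  qed
qed

lemma weak_grad_scale:
  assumes "weak_grad u w"
  shows "weak_grad (\<lambda>p. c * u p) (\<lambda>i p. c * w i p)"
proof -
  obtain U where U: "\<And>n. U n \<in> D" "L2_conv M U u" "\<And>i. i \<in> I \<Longrightarrow> L2_conv M (\<lambda>n. grad i (U n)) (w i)"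
    using assms unfolding weak_grad_def by metis
  show ?thesis unfolding weak_grad_def
  proof (intro exI conjI allI ballI)
    show "(\<lambda>p. c * U n p) \<in> D" for n by (intro D_scale U)
    show "L2_conv M (\<lambda>n p. c * U n p) (\<lambda>p. c * u p)" by (intro L2_conv_scale U)
    show "L2_conv M (\<lambda>n. grad i (\<lambda>p. c * U n p)) (\<lambda>p. c * w i p)" if "i \<in> I" for i
      by (rule L2_conv_cong[OF L2_conv_scale[OF U(3)[OF that]]]) (simp add: grad_scale[OF U(1) that])
  qed
qed

lemma weak_grad_diff:
  assumes "weak_grad u w" "weak_grad v z"
  shows "weak_grad (\<lambda>p. u p - v p) (\<lambda>i p. w i p - z i p)"
  using weak_grad_add[OF assms(1) weak_grad_scale[OF assms(2), of "-1"]] by simp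

lemma weak_grad_unique:
  assumes "weak_grad u w" "weak_grad u z" "i \<in> I"
  shows "AE p in M. w i p = z i p"
proof -
  have "weak_grad (\<lambda>p. 0) (\<lambda>i p. w i p - z i p)"
    using weak_grad_diff[OF assms(1,2)] by simp
  then obtain U where U: "\<And>n. U n \<in> D" "L2_conv M U (\<lambda>_. 0)"
    "\<And>i. i \<in> I \<Longrightarrow> L2_conv M (\<lambda>n. grad i (U n)) (\<lambda>p. w i p - z i p)"
    unfolding weak_grad_def by metis
  from grad_closable[OF U assms(3)] show ?thesis by simp
qed

lemma weak_grad_cong_AE:
  assumes "weak_grad u w" "v \<in> borel_measurable M" "AE p in M. u p = v p"
  shows "weak_grad v w"
  using assms L2_conv_cong_AE[OF _ assms(2,3)] unfolding weak_grad_def by metis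

lemma L2_conv_near:
  assumes "L2_conv M U u" "\<And>n. V n \<in> L2_space M"
    and "\<And>n. (\<integral>p. (V n p - U n p)\<^sup>2 \<partial>M) \<le> inverse (real (Suc n))"
  shows "L2_conv M V u"
proof -
  have "(\<lambda>n. \<integral>p. (V n p - U n p)\<^sup>2 \<partial>M) \<longlonglongrightarrow> 0"
    by (rule tendsto_sandwich[OF _ _ tendsto_const LIMSEQ_inverse_real_of_nat]) (use assms(3) in auto)
  then have "L2_conv M (\<lambda>n p. V n p - U n p) (\<lambda>_. 0)"
    using L2_conv_mem(1)[OF assms(1)] assms(2) by (simp add: L2_conv_def L2_zero L2_diff)
  from L2_conv_add[OF assms(1) this] show ?thesis by simp
qed

text \<open>
  Diagonal argument: the graph of the weak gradient is an \<open>L\<^sup>2\<close>-closed set, being a closure.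
\<close>

lemma weak_grad_closed:
  assumes wg: "\<And>n. weak_grad (u n) (w n)" and u: "L2_conv M u v"
    and w: "\<And>i. i \<in> I \<Longrightarrow> L2_conv M (\<lambda>n. w n i) (z i)"
  shows "weak_grad v z"
proof -
  have "\<exists>V. V \<in> D \<and> (\<integral>p. (V p - u n p)\<^sup>2 \<partial>M) \<le> inverse (real (Suc n)) \<and>
      (\<forall>i\<in>I. (\<integral>p. (grad i V p - w n i p)\<^sup>2 \<partial>M) \<le> inverse (real (Suc n)))" for n
  proof -
    obtain U where U: "\<And>k. U k \<in> D" "L2_conv M U (u n)"
      "\<And>i. i \<in> I \<Longrightarrow> L2_conv M (\<lambda>k. grad i (U k)) (w n i)"
      using wg[of n] unfolding weak_grad_def by metis
    have pos: "0 < inverse (real (Suc n))" by simp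
    have ev: "eventually (\<lambda>k. (\<integral>p. (F k p - f p)\<^sup>2 \<partial>M) < inverse (real (Suc n))) sequentially"
      if "L2_conv M F f" for F f
    proof -
      have "(\<lambda>k. \<integral>p. (F k p - f p)\<^sup>2 \<partial>M) \<longlonglongrightarrow> 0" using that unfolding L2_conv_def by blast
      from order_tendstoD(2)[OF this pos] show ?thesis .
    qed
    have "eventually (\<lambda>k. (\<integral>p. (U k p - u n p)\<^sup>2 \<partial>M) < inverse (real (Suc n)) \<and>
        (\<forall>i\<in>I. (\<integral>p. (grad i (U k) p - w n i p)\<^sup>2 \<partial>M) < inverse (real (Suc n)))) sequentially"
      using ev[OF U(2)] ev[OF U(3)] by (intro eventually_conj eventually_ball_finite finite_I) auto
    then obtain k where "(\<integral>p. (U k p - u n p)\<^sup>2 \<partial>M) < inverse (real (Suc n))"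
        "\<forall>i\<in>I. (\<integral>p. (grad i (U k) p - w n i p)\<^sup>2 \<partial>M) < inverse (real (Suc n))"
      using eventually_happens'[OF sequentially_bot] by blast
    with U(1)[of k] show ?thesis by (meson less_imp_le)
  qed
  then have "\<forall>n. \<exists>V. V \<in> D \<and> (\<integral>p. (V p - u n p)\<^sup>2 \<partial>M) \<le> inverse (real (Suc n)) \<and>
      (\<forall>i\<in>I. (\<integral>p. (grad i V p - w n i p)\<^sup>2 \<partial>M) \<le> inverse (real (Suc n)))" by blast
  from choice[OF this] obtain V where V: "\<And>n. V n \<in> D" "\<And>n. (\<integral>p. (V n p - u n p)\<^sup>2 \<partial>M) \<le> inverse (real (Suc n))"
    "\<And>n i. i \<in> I \<Longrightarrow> (\<integral>p. (grad i (V n) p - w n i p)\<^sup>2 \<partial>M) \<le> inverse (real (Suc n))"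
    by blast
  show ?thesis unfolding weak_grad_def
  proof (intro exI conjI allI ballI)
    show "V n \<in> D" for n by fact
    show "L2_conv M V v" by (rule L2_conv_near[OF u D_L2 V(2)]) (rule V(1))
    show "L2_conv M (\<lambda>n. grad i (V n)) (z i)" if "i \<in> I" for i
      by (rule L2_conv_near[OF w[OF that] grad_L2[OF V(1) that] V(3)[OF that]])
  qed
qed

lemma weak_grad_subseq_AE:
  assumes "weak_grad u w"
  obtains U where "\<And>n. U n \<in> D" "L2_conv M U u" "\<And>i. i \<in> I \<Longrightarrow> L2_conv M (\<lambda>n. grad i (U n)) (w i)"
    "AE p in M. (\<lambda>n. U n p) \<longlonglongrightarrow> u p"
proof -
  obtain U where U: "\<And>n. U n \<in> D" "L2_conv M U u" "\<And>i. i \<in> I \<Longrightarrow> L2_conv M (\<lambda>n. grad i (U n)) (w i)"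
    using assms unfolding weak_grad_def by metis
  obtain r :: "nat \<Rightarrow> nat" where r: "strict_mono r" "AE p in M. (\<lambda>n. U (r n) p) \<longlonglongrightarrow> u p"
    using L2_conv_AE_subseq[OF U(2)] by blast
  show thesis
    by (rule that[of "\<lambda>n. U (r n)"])
       (use U r L2_conv_subseq[OF U(2) r(1)] L2_conv_subseq[OF U(3) r(1)] in auto)
qed

text \<open>
  Along a subsequence with \<open>U n \<rightarrow> u\<close> almost everywhere, the gradient of \<open>\<eta> (U n)\<close> differs from
  \<open>\<eta>' (u) w\<close> by \<open>\<eta>' (U n) (grad (U n) - w) + (\<eta>' (U n) - \<eta>' (u)) w\<close>. The first summand tends to \<open>0\<close> as \<open>\<eta>'\<close> is
  bounded, the second by dominated convergence.
\<close>

lemma weak_grad_compose: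
  assumes wg: "weak_grad u w" and \<eta>0: "\<eta> 0 = 0"
    and d1: "\<And>t. (\<eta> has_real_derivative \<eta>' t) (at t)"
    and d2: "\<And>t. (\<eta>' has_real_derivative \<eta>'' t) (at t)" and c: "continuous_on UNIV \<eta>''"
    and bd: "\<And>t. \<bar>\<eta>' t\<bar> \<le> C"
  shows "weak_grad (\<lambda>p. \<eta> (u p)) (\<lambda>i p. \<eta>' (u p) * w i p)"
proof -
  obtain U where U: "\<And>n. U n \<in> D" "L2_conv M U u" "\<And>i. i \<in> I \<Longrightarrow> L2_conv M (\<lambda>n. grad i (U n)) (w i)"
    and ae: "AE p in M. (\<lambda>n. U n p) \<longlonglongrightarrow> u p"
    using weak_grad_subseq_AE[OF wg] by blast
  have C0: "C \<ge> 0" using bd[of 0] by linarith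
  have ct1: "continuous_on UNIV \<eta>" "continuous_on UNIV \<eta>'"
    using d1 d2 DERIV_continuous_on by blast+
  have [measurable]: "\<eta> \<in> borel_measurable borel" "\<eta>' \<in> borel_measurable borel"
    using ct1 borel_measurable_continuous_onI by blast+
  have lip: "\<bar>\<eta> x - \<eta> y\<bar> \<le> C * \<bar>x - y\<bar>" for x y
    using field_differentiable_bound[of UNIV \<eta> \<eta>' C x y] d1 bd by simp
  have um [measurable]: "u \<in> borel_measurable M" "\<And>n. U n \<in> borel_measurable M"
    using L2_conv_mem[OF U(2)] by (auto dest: L2_measurable)
  have wm [measurable]: "w i \<in> borel_measurable M" if "i \<in> I" for i
    using L2_measurable[OF weak_grad_L2(2)[OF wg that]] .
  have eU: "(\<lambda>p. \<eta> (f p)) \<in> L2_space M" if "f \<in> L2_space M" for f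
    by (rule L2_bound[OF that, where C=C]) (use lip[of _ 0] \<eta>0 L2_measurable[OF that] in auto)
  have conv0: "L2_conv M (\<lambda>n p. \<eta> (U n p)) (\<lambda>p. \<eta> (u p))"
    unfolding L2_conv_def
  proof (intro conjI allI)
    show "(\<lambda>p. \<eta> (U n p)) \<in> L2_space M" "(\<lambda>p. \<eta> (u p)) \<in> L2_space M" for n
      using eU L2_conv_mem[OF U(2)] by blast+
    have le: "(\<integral>p. (\<eta> (U n p) - \<eta> (u p))\<^sup>2 \<partial>M) \<le> C\<^sup>2 * (\<integral>p. (U n p - u p)\<^sup>2 \<partial>M)" for n
    proof -
      have "(\<integral>p. (\<eta> (U n p) - \<eta> (u p))\<^sup>2 \<partial>M) \<le> (\<integral>p. C\<^sup>2 * (U n p - u p)\<^sup>2 \<partial>M)"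
      proof (rule integral_mono)
        show "integrable M (\<lambda>p. (\<eta> (U n p) - \<eta> (u p))\<^sup>2)"
          by (intro L2_square_integrable L2_diff eU L2_conv_mem[OF U(2)])
        show "integrable M (\<lambda>p. C\<^sup>2 * (U n p - u p)\<^sup>2)"
          by (intro integrable_mult_right L2_square_integrable L2_diff L2_conv_mem[OF U(2)])
        show "(\<eta> (U n p) - \<eta> (u p))\<^sup>2 \<le> C\<^sup>2 * (U n p - u p)\<^sup>2" for p
        proof -
          have "\<bar>\<eta> (U n p) - \<eta> (u p)\<bar> \<le> \<bar>C * (U n p - u p)\<bar>"
            using lip[of "U n p" "u p"] C0 by (simp add: abs_mult)
          then show ?thesis by (simp only: abs_le_square_iff power_mult_distrib)
        qed
      qed
      then show ?thesis by simp
    qed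
    have lim: "(\<lambda>n. C\<^sup>2 * (\<integral>p. (U n p - u p)\<^sup>2 \<partial>M)) \<longlonglongrightarrow> 0"
      using U(2) by (auto simp: L2_conv_def intro!: tendsto_eq_intros)
    show "(\<lambda>n. \<integral>p. (\<eta> (U n p) - \<eta> (u p))\<^sup>2 \<partial>M) \<longlonglongrightarrow> 0"
      by (rule tendsto_sandwich[OF _ _ tendsto_const lim]) (use le in auto)
  qed
  have conv1: "L2_conv M (\<lambda>n. grad i (\<lambda>p. \<eta> (U n p))) (\<lambda>p. \<eta>' (u p) * w i p)" if i: "i \<in> I" for i
  proof -
    note [measurable] = wm[OF i] L2_measurable[OF grad_L2[OF U(1) i]]
    have wL: "w i \<in> L2_space M" by (rule weak_grad_L2(2)[OF wg i])
    have gL: "(\<lambda>p. grad i (U n) p - w i p) \<in> L2_space M" for n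
      by (intro L2_diff grad_L2 U wL i)
    have A: "L2_conv M (\<lambda>n p. \<eta>' (U n p) * w i p) (\<lambda>p. \<eta>' (u p) * w i p)"
    proof (rule L2_conv_dominated[OF L2_scale[OF wL, of C]])
      show "AE p in M. (\<lambda>n. \<eta>' (U n p) * w i p) \<longlonglongrightarrow> \<eta>' (u p) * w i p"
        using ae
      proof eventually_elim
        fix p assume "(\<lambda>n. U n p) \<longlonglongrightarrow> u p"
        then have "(\<lambda>n. \<eta>' (U n p)) \<longlonglongrightarrow> \<eta>' (u p)"
          using ct1(2) by (auto simp: continuous_on_eq_continuous_at intro: isCont_tendsto_compose)
        then show "(\<lambda>n. \<eta>' (U n p) * w i p) \<longlonglongrightarrow> \<eta>' (u p) * w i p" by (intro tendsto_intros)
      qed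
      show "AE p in M. \<bar>\<eta>' (U n p) * w i p\<bar> \<le> \<bar>C * w i p\<bar>" for n
        using bd C0 by (intro AE_I2) (auto simp: abs_mult intro!: mult_right_mono)
    qed measurable
    have B: "L2_conv M (\<lambda>n p. \<eta>' (U n p) * (grad i (U n) p - w i p)) (\<lambda>p. 0)"
      unfolding L2_conv_def
    proof (intro conjI allI L2_zero)
      show m: "(\<lambda>p. \<eta>' (U n p) * (grad i (U n) p - w i p)) \<in> L2_space M" for n
        by (rule L2_bound[OF gL[of n], where C=C]) (use bd in \<open>auto simp: abs_mult intro!: mult_right_mono\<close>)
      have le: "(\<integral>p. (\<eta>' (U n p) * (grad i (U n) p - w i p) - 0)\<^sup>2 \<partial>M)
          \<le> C\<^sup>2 * (\<integral>p. (grad i (U n) p - w i p)\<^sup>2 \<partial>M)" for n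
      proof -
        have "(\<integral>p. (\<eta>' (U n p) * (grad i (U n) p - w i p) - 0)\<^sup>2 \<partial>M)
          \<le> (\<integral>p. C\<^sup>2 * (grad i (U n) p - w i p)\<^sup>2 \<partial>M)"
        proof (rule integral_mono)
          show "integrable M (\<lambda>p. (\<eta>' (U n p) * (grad i (U n) p - w i p) - 0)\<^sup>2)"
            using L2_square_integrable[OF m] by simp
          show "integrable M (\<lambda>p. C\<^sup>2 * (grad i (U n) p - w i p)\<^sup>2)"
            by (intro integrable_mult_right L2_square_integrable gL)
          show "(\<eta>' (U n p) * (grad i (U n) p - w i p) - 0)\<^sup>2 \<le> C\<^sup>2 * (grad i (U n) p - w i p)\<^sup>2" for p
          proof -
            have "(\<eta>' (U n p))\<^sup>2 \<le> C\<^sup>2" using bd C0 by (intro abs_le_square_iff[THEN iffD1]) auto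
            then show ?thesis by (simp add: power_mult_distrib mult_right_mono)
          qed
        qed
        then show ?thesis by simp
      qed
      have lim: "(\<lambda>n. C\<^sup>2 * (\<integral>p. (grad i (U n) p - w i p)\<^sup>2 \<partial>M)) \<longlonglongrightarrow> 0"
        using U(3)[OF i] by (auto simp: L2_conv_def intro!: tendsto_eq_intros)
      show "(\<lambda>n. \<integral>p. (\<eta>' (U n p) * (grad i (U n) p - w i p) - 0)\<^sup>2 \<partial>M) \<longlonglongrightarrow> 0"
        by (rule tendsto_sandwich[OF _ _ tendsto_const lim]) (use le in auto)
    qed
    have S: "L2_conv M (\<lambda>n p. \<eta>' (U n p) * grad i (U n) p) (\<lambda>p. \<eta>' (u p) * w i p)"
      using L2_conv_add[OF A B] by (simp add: algebra_simps)
    show ?thesis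
      by (rule L2_conv_cong[OF S]) (simp add: grad_compose[OF U(1) \<eta>0 d1 d2 c i])
  qed
  show ?thesis unfolding weak_grad_def
    using conv0 conv1 D_compose[OF U(1) \<eta>0 d1 d2 c] by (intro exI[of _ "\<lambda>n p. \<eta> (U n p)"]) blast
qed

text \<open>
  The chain rule survives pointwise limits \<open>\<psi>\<close>, \<open>g\<close> of \<open>\<eta>\<^sub>n\<close>, \<open>\<eta>\<^sub>n'\<close>, where \<open>g\<close> may be discontinuous:
  with \<open>u\<close> and its weak gradient held fixed, dominated convergence applies. This yields both the
  unit contraction and the vanishing of the gradient on level sets, without weak compactness.
\<close>

lemma weak_grad_compose_limit:
  assumes wg: "weak_grad u w" and \<eta>0: "\<And>n. \<eta> n 0 = 0"
    and d1: "\<And>n t. (\<eta> n has_real_derivative \<eta>' n t) (at t)"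
    and d2: "\<And>n t. (\<eta>' n has_real_derivative \<eta>'' n t) (at t)"
    and c: "\<And>n. continuous_on UNIV (\<eta>'' n)"
    and bd: "\<And>n t. \<bar>\<eta>' n t\<bar> \<le> C"
    and l0: "\<And>t. (\<lambda>n. \<eta> n t) \<longlonglongrightarrow> \<psi> t" and l1: "\<And>t. (\<lambda>n. \<eta>' n t) \<longlonglongrightarrow> g t"
  shows "weak_grad (\<lambda>p. \<psi> (u p)) (\<lambda>i p. g (u p) * w i p)"
proof (rule weak_grad_closed)
  have C0: "C \<ge> 0" using bd[of 0 0] by linarith
  have [measurable]: "\<eta> n \<in> borel_measurable borel" "\<eta>' n \<in> borel_measurable borel" for n
    by (rule borel_measurable_continuous_onI DERIV_continuous_on d1 d2)+
  have [measurable]: "\<psi> \<in> borel_measurable borel" "g \<in> borel_measurable borel"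
    by (rule borel_measurable_LIMSEQ_real[OF l0], measurable)
       (rule borel_measurable_LIMSEQ_real[OF l1], measurable)
  have uL: "u \<in> L2_space M" by (rule weak_grad_L2(1)[OF wg])
  note [measurable] = L2_measurable[OF uL]
  have lip: "\<bar>\<eta> n x\<bar> \<le> C * \<bar>x\<bar>" for n x
    using field_differentiable_bound[of UNIV "\<eta> n" "\<eta>' n" C x 0] d1 bd \<eta>0 by simp
  show "weak_grad (\<lambda>p. \<eta> n (u p)) (\<lambda>i p. \<eta>' n (u p) * w i p)" for n
    by (rule weak_grad_compose[OF wg \<eta>0 d1 d2 c bd])
  show "L2_conv M (\<lambda>n p. \<eta> n (u p)) (\<lambda>p. \<psi> (u p))"
    by (rule L2_conv_dominated[OF L2_scale[OF uL, of C]]) (use l0 lip C0 in \<open>auto simp: abs_mult\<close>)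
  show "L2_conv M (\<lambda>n p. \<eta>' n (u p) * w i p) (\<lambda>p. g (u p) * w i p)" if i: "i \<in> I" for i
  proof (rule L2_conv_dominated)
    have wL: "w i \<in> L2_space M" by (rule weak_grad_L2(2)[OF wg i])
    note [measurable] = L2_measurable[OF wL]
    show "(\<lambda>p. C * w i p) \<in> L2_space M" by (rule L2_scale[OF wL])
    show "(\<lambda>p. \<eta>' n (u p) * w i p) \<in> borel_measurable M" "(\<lambda>p. g (u p) * w i p) \<in> borel_measurable M" for n
      by measurable
    show "AE p in M. (\<lambda>n. \<eta>' n (u p) * w i p) \<longlonglongrightarrow> g (u p) * w i p"
      by (intro AE_I2 tendsto_intros l1)
    show "AE p in M. \<bar>\<eta>' n (u p) * w i p\<bar> \<le> \<bar>C * w i p\<bar>" for n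
      using bd C0 by (intro AE_I2) (auto simp: abs_mult intro!: mult_right_mono)
  qed
qed

text \<open>
  The functions \<open>t \<mapsto> arctan (n (t - c)) / n\<close>, up to constants, tend to \<open>0\<close> while their derivatives tend to
  the indicator of \<open>{c}\<close>. In the limit \<open>1\<^sub>{u = c} w\<close> is a weak gradient of \<open>0\<close>.
\<close>

lemma weak_grad_level_set:
  assumes wg: "weak_grad u w" and i: "i \<in> I"
  shows "AE p in M. u p = c \<longrightarrow> w i p = 0"
proof -
  define K :: "nat \<Rightarrow> real" where "K n = real (Suc n)" for n
  have K: "K n > 0" for n by (simp add: K_def)
  define \<eta> where "\<eta> n t = (arctan (K n * (t - c)) - arctan (K n * (0 - c))) / K n" for n t
  define \<eta>' where "\<eta>' n t = 1 / (1 + (K n * (t - c))\<^sup>2)" for n t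
  define \<eta>'' where "\<eta>'' n t = - (2 * (K n)\<^sup>2 * (t - c)) / (1 + (K n * (t - c))\<^sup>2)\<^sup>2" for n t
  have pos: "1 + (x::real)\<^sup>2 > 0" for x by (simp add: add_pos_nonneg)
  have Kinf: "filterlim K at_top sequentially"
    unfolding K_def by (rule filterlim_compose[OF filterlim_real_sequentially filterlim_Suc])
  have inv: "(\<lambda>n. inverse (K n)) \<longlonglongrightarrow> 0" unfolding K_def by (rule LIMSEQ_inverse_real_of_nat)
  have "weak_grad (\<lambda>p. (\<lambda>_. 0) (u p)) (\<lambda>i p. (if u p = c then 1 else 0) * w i p)"
  proof (rule weak_grad_compose_limit[OF wg, where \<eta>=\<eta> and \<eta>'=\<eta>' and \<eta>''=\<eta>'' and C=1])
    show "\<eta> n 0 = 0" for n by (simp add: \<eta>_def)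
    show "(\<eta> n has_real_derivative \<eta>' n t) (at t)" for n t
    proof -
      have "((\<lambda>t. (arctan (K n * (t - c)) - arctan (K n * (0 - c))) / K n)
          has_real_derivative (K n / (1 + (K n * (t - c))\<^sup>2)) / K n) (at t)"
        by (auto intro!: derivative_eq_intros simp: divide_inverse)
      then show ?thesis using K[of n] by (simp add: \<eta>_def[abs_def] \<eta>'_def)
    qed
    show "(\<eta>' n has_real_derivative \<eta>'' n t) (at t)" for n t
      unfolding \<eta>'_def[abs_def] \<eta>''_def using pos[of "K n * (t - c)"]
      by (auto intro!: derivative_eq_intros simp: power2_eq_square algebra_simps)
    show "continuous_on UNIV (\<eta>'' n)" for n
      unfolding \<eta>''_def[abs_def] by (auto intro!: continuous_intros simp: less_imp_neq[OF pos, symmetric])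
    show "\<bar>\<eta>' n t\<bar> \<le> 1" for n t using pos[of "K n * (t - c)"] by (simp add: \<eta>'_def)
    show "(\<lambda>n. \<eta> n t) \<longlonglongrightarrow> 0" for t
    proof (rule tendsto_rabs_zero_cancel, rule tendsto_sandwich[OF _ _ tendsto_const])
      show "\<forall>\<^sub>F n in sequentially. \<bar>\<eta> n t\<bar> \<le> 4 * inverse (K n)"
      proof (intro always_eventually allI)
        fix n
        have b: "\<bar>arctan x\<bar> \<le> 2" for x using arctan_bounded[of x] pi_less_4 by auto
        have "\<bar>arctan (K n * (t - c)) - arctan (K n * (0 - c))\<bar> \<le> 4"
          using b[of "K n * (t - c)"] b[of "K n * (0 - c)"] by linarith
        then show "\<bar>\<eta> n t\<bar> \<le> 4 * inverse (K n)"
          using K[of n] unfolding \<eta>_def divide_inverse abs_mult by (intro mult_mono) auto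
      qed
      show "(\<lambda>n. 4 * inverse (K n)) \<longlonglongrightarrow> 0" using tendsto_mult_right_zero[OF inv] by simp
    qed simp
    show "(\<lambda>n. \<eta>' n t) \<longlonglongrightarrow> (if t = c then 1 else 0)" for t
    proof (cases "t = c")
      case False
      have "filterlim (\<lambda>n. \<bar>t - c\<bar> * K n) at_top sequentially"
        using False by (intro filterlim_tendsto_pos_mult_at_top[OF tendsto_const _ Kinf]) auto
      then have "filterlim (\<lambda>n. (\<bar>t - c\<bar> * K n)\<^sup>2) at_top sequentially"
        by (rule filterlim_pow_at_top[rotated]) simp
      then have "filterlim (\<lambda>n. 1 + (\<bar>t - c\<bar> * K n)\<^sup>2) at_top sequentially"
        by (rule filterlim_tendsto_add_at_top[OF tendsto_const])
      then have "(\<lambda>n. 1 / (1 + (\<bar>t - c\<bar> * K n)\<^sup>2)) \<longlonglongrightarrow> 0"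
        by (rule tendsto_divide_0[OF tendsto_const filterlim_at_top_imp_at_infinity])
      then show ?thesis using False by (simp add: \<eta>'_def power_mult_distrib mult.commute)
    qed (simp add: \<eta>'_def)
  qed
  moreover have "weak_grad (\<lambda>p. 0) (\<lambda>i p. 0 * w i p)"
    using weak_grad_scale[OF wg, of 0] by simp
  ultimately have "AE p in M. (if u p = c then 1 else 0) * w i p = 0 * w i p"
    using i weak_grad_unique[of "\<lambda>_. 0" "\<lambda>i p. (if u p = c then 1 else 0) * w i p" "\<lambda>i p. 0 * w i p" i] by simp
  then show ?thesis by eventually_elim (auto split: if_splits)
qed

text \<open>
  The factor \<open>g\<close> is the derivative of \<open>min (max t 0) 1\<close>, with value \<open>1 / 2\<close> at the corners as the limit of
  symmetric smooth approximations. The contraction property of the form follows from \<open>0 \<le> g \<le> 1\<close>.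
\<close>

lemma weak_grad_unit_contraction:
  assumes wg: "weak_grad u w"
  shows "\<exists>g. (\<forall>t. 0 \<le> g t \<and> g t \<le> (1::real)) \<and>
     weak_grad (\<lambda>p. min (max (u p) 0) 1) (\<lambda>i p. g (u p) * w i p)"
proof -
  define e :: "nat \<Rightarrow> real" where "e n = inverse (real (Suc n))" for n
  have e: "e n > 0" for n by (simp add: e_def)
  have elim: "e \<longlonglongrightarrow> 0" unfolding e_def by (rule LIMSEQ_inverse_real_of_nat)
  \<comment> \<open>\<open>A n\<close> smooths \<open>\<bar>t\<bar>\<close>, and \<open>min (max t 0) 1 = (\<bar>t\<bar> - \<bar>t - 1\<bar> + 1) / 2\<close>.\<close>
  define A where "A n t = sqrt (t\<^sup>2 + e n)" for n t
  define B where "B n t = t / sqrt (t\<^sup>2 + e n)" for n t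
  have pos: "x\<^sup>2 + e n > 0" for x n using e[of n] by (simp add: add_nonneg_pos)
  have sq: "sqrt (x\<^sup>2 + e n) > 0" for x n using pos by simp
  have dA: "(A n has_real_derivative B n t) (at t)" for n t
    unfolding A_def[abs_def] B_def using pos[of t n]
    by (auto intro!: derivative_eq_intros simp: field_simps)
  have dB: "(B n has_real_derivative e n / (sqrt (t\<^sup>2 + e n)) ^ 3) (at t)" for n t
  proof -
    define s where "s = sqrt (t\<^sup>2 + e n)"
    have s: "s > 0" "s\<^sup>2 = t\<^sup>2 + e n" using sq[of t n] pos[of t n] by (auto simp: s_def)
    have "(B n has_real_derivative (1 * s - t * B n t) / (s * s)) (at t)"
      unfolding B_def[abs_def] s_def
      by (rule DERIV_divide[OF DERIV_ident dA[unfolded A_def[abs_def] B_def]]) (use sq[of t n] in simp)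
    also have "(1 * s - t * B n t) / (s * s) = (s\<^sup>2 - t\<^sup>2) / s ^ 3"
      using s(1) unfolding B_def s_def[symmetric]
      by (simp add: divide_simps power2_eq_square power3_eq_cube)
    also have "\<dots> = e n / s ^ 3" using s(2) by simp
    finally show ?thesis by (simp add: s_def)
  qed
  have Bmono: "B n x \<le> B n y" if "x \<le> y" for n x y
    by (rule DERIV_nonneg_imp_nondecreasing[OF that]) (use dB e sq in \<open>fastforce simp: less_imp_le\<close>)
  have Bbd: "\<bar>B n x\<bar> \<le> 1" for n x
  proof -
    have "\<bar>x\<bar> \<le> sqrt (x\<^sup>2 + e n)" using e[of n] by (intro real_le_rsqrt) simp
    then have "\<bar>x\<bar> \<le> \<bar>sqrt (x\<^sup>2 + e n)\<bar>" using sq[of x n] by linarith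
    moreover have "\<bar>sqrt (x\<^sup>2 + e n)\<bar> > 0" using sq[of x n] by linarith
    ultimately show ?thesis unfolding B_def abs_divide by (simp only: divide_le_eq_1_pos)
  qed
  define \<eta> where "\<eta> n t = (A n t - A n (t - 1) + (A n (-1) - A n 0)) / 2" for n t
  define \<eta>' where "\<eta>' n t = (B n t - B n (t - 1)) / 2" for n t
  define \<eta>'' where "\<eta>'' n t = (e n / (sqrt (t\<^sup>2 + e n)) ^ 3 - e n / (sqrt ((t-1)\<^sup>2 + e n)) ^ 3) / 2" for n t
  define g where "g t = (sgn t - sgn (t - 1)) / (2::real)" for t
  have sh: "((\<lambda>t. f (t - 1)) has_real_derivative f') (at t)"
    if "(f has_real_derivative f') (at (t - 1))" for f f' and t :: real
  proof -
    have "((\<lambda>t. t - 1) has_real_derivative 1) (at t)" by (auto intro!: derivative_eq_intros)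
    from DERIV_chain2[of f f' "\<lambda>t. t - 1" t 1 UNIV, OF that this] show ?thesis by simp
  qed
  have limA: "(\<lambda>n. A n t) \<longlonglongrightarrow> \<bar>t\<bar>" for t
  proof -
    have "(\<lambda>n. A n t) \<longlonglongrightarrow> sqrt (t\<^sup>2 + 0)" unfolding A_def by (intro tendsto_intros elim)
    then show ?thesis by simp
  qed
  have limB: "(\<lambda>n. B n t) \<longlonglongrightarrow> sgn t" for t
  proof (cases "t = 0")
    case False
    have "(\<lambda>n. t / A n t) \<longlonglongrightarrow> t / \<bar>t\<bar>" using False by (intro tendsto_divide tendsto_const limA) auto
    moreover have "t / \<bar>t\<bar> = sgn t" using False by (simp add: sgn_real_def)
    ultimately show ?thesis by (simp add: A_def B_def)
  qed (simp add: B_def)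
  have "weak_grad (\<lambda>p. (\<lambda>t. min (max t 0) 1) (u p)) (\<lambda>i p. g (u p) * w i p)"
  proof (rule weak_grad_compose_limit[OF wg, where \<eta>=\<eta> and \<eta>'=\<eta>' and \<eta>''=\<eta>'' and C=1])
    show "\<eta> n 0 = 0" for n by (simp add: \<eta>_def)
    show "(\<eta> n has_real_derivative \<eta>' n t) (at t)" for n t
      unfolding \<eta>_def[abs_def] \<eta>'_def
      by (rule derivative_eq_intros dA sh[OF dA] refl)+ (simp_all add: field_simps)
    show "(\<eta>' n has_real_derivative \<eta>'' n t) (at t)" for n t
      unfolding \<eta>''_def \<eta>'_def[abs_def]
      by (rule derivative_eq_intros dB sh[OF dB] refl)+ (simp_all add: field_simps)
    show "continuous_on UNIV (\<eta>'' n)" for n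
      unfolding \<eta>''_def[abs_def] using pos by (auto intro!: continuous_intros simp: less_imp_neq[OF pos, symmetric])
    show "\<bar>\<eta>' n t\<bar> \<le> 1" for n t
      using Bbd[of n t] Bbd[of n "t - 1"] by (simp add: \<eta>'_def abs_le_iff)
    show "(\<lambda>n. \<eta> n t) \<longlonglongrightarrow> min (max t 0) 1" for t
    proof -
      have "(\<lambda>n. \<eta> n t) \<longlonglongrightarrow> (\<bar>t\<bar> - \<bar>t - 1\<bar> + (\<bar>-1\<bar> - \<bar>0\<bar>)) / 2"
        unfolding \<eta>_def by (intro tendsto_intros limA) simp
      moreover have "(\<bar>t\<bar> - \<bar>t - 1\<bar> + (\<bar>-1\<bar> - \<bar>0\<bar>)) / 2 = min (max t 0) 1"
        by (simp add: abs_if min_def max_def)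
      ultimately show ?thesis by simp
    qed
    show "(\<lambda>n. \<eta>' n t) \<longlonglongrightarrow> g t" for t
      unfolding \<eta>'_def g_def by (intro tendsto_intros limB) simp
  qed
  moreover have "0 \<le> g t \<and> g t \<le> 1" for t by (simp add: g_def sgn_real_def)
  ultimately show ?thesis by (intro exI[of _ g]) simp
qed

lemma E_tendsto:
  assumes "\<And>n. U n \<in> D" "\<And>n. W n \<in> D"
    and "\<And>i. i \<in> I \<Longrightarrow> L2_conv M (\<lambda>n. grad i (U n)) (w i)"
    and "\<And>i. i \<in> I \<Longrightarrow> L2_conv M (\<lambda>n. grad i (W n)) (z i)"
  shows "(\<lambda>n. E (U n) (W n)) \<longlonglongrightarrow> (\<Sum>i\<in>I. \<integral>p. w i p * z i p \<partial>M)"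
  unfolding E_eq[OF assms(1,2)] by (intro tendsto_sum L2_conv_inner assms)

text \<open>
  Each component of the gradient is controlled by the form, so form-Cauchy sequences have
  \<open>L\<^sup>2\<close>-convergent gradients.
\<close>

lemma approximates_imp_grad_conv:
  assumes "approximates M D E U u" "u \<in> L2_space M"
  obtains w where "L2_conv M U u" "\<And>i. i \<in> I \<Longrightarrow> L2_conv M (\<lambda>n. grad i (U n)) (w i)"
proof -
  have U: "\<And>n. U n \<in> D" and C: "form_Cauchy E U" and "(\<lambda>n. L2_norm M (\<lambda>p. U n p - u p)) \<longlonglongrightarrow> 0"
    using assms(1) by (auto simp: approximates_def)
  then have conv: "L2_conv M U u" using assms(2) D_L2[OF U] by (simp add: L2_conv_iff_norm)
  have "\<exists>v. L2_conv M (\<lambda>n. grad i (U n)) v" if i: "i \<in> I" for i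
  proof -
    have "L2_Cauchy M (\<lambda>n. grad i (U n))" unfolding L2_Cauchy_def
    proof (intro allI impI)
      fix e :: real assume "e > 0"
      then obtain n0 where n0: "\<forall>m\<ge>n0. \<forall>n\<ge>n0. E (\<lambda>p. U m p - U n p) (\<lambda>p. U m p - U n p) < e"
        using C unfolding form_Cauchy_def by blast
      have "(\<integral>p. (grad i (U m) p - grad i (U n) p)\<^sup>2 \<partial>M) \<le> E (\<lambda>p. U m p - U n p) (\<lambda>p. U m p - U n p)" for m n
        unfolding E_diff_eq[OF U U]
        by (rule member_le_sum[OF i, of "\<lambda>i. \<integral>p. (grad i (U m) p - grad i (U n) p)\<^sup>2 \<partial>M"])
           (auto simp: finite_I)
      then show "\<exists>n0. \<forall>m\<ge>n0. \<forall>n\<ge>n0. (\<integral>p. (grad i (U m) p - grad i (U n) p)\<^sup>2 \<partial>M) < e"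
        using n0 le_less_trans by blast
    qed
    moreover have "grad i (U n) \<in> L2_space M" for n by (rule grad_L2[OF U i])
    ultimately show ?thesis using L2_complete[of M "\<lambda>n. grad i (U n)"] finite_measure_axioms by metis
  qed
  then have "\<forall>i\<in>I. \<exists>v. L2_conv M (\<lambda>n. grad i (U n)) v" by blast
  from bchoice[OF this] conv that show thesis by blast
qed

lemma grad_conv_imp_approximates:
  assumes U: "\<And>n. U n \<in> D" and conv: "L2_conv M U u"
    and w: "\<And>i. i \<in> I \<Longrightarrow> L2_conv M (\<lambda>n. grad i (U n)) (w i)"
  shows "approximates M D E U u"
proof -
  define a where "a n = (\<Sum>i\<in>I. \<integral>p. (grad i (U n) p - w i p)\<^sup>2 \<partial>M)" for n
  have "a \<longlonglongrightarrow> (\<Sum>i\<in>I. 0)" unfolding a_def[abs_def] using w by (intro tendsto_sum) (simp add: L2_conv_def)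
  then have a0: "a \<longlonglongrightarrow> 0" by simp
  have le: "E (\<lambda>p. U m p - U n p) (\<lambda>p. U m p - U n p) \<le> 2 * a m + 2 * a n" for m n
  proof -
    have "(\<integral>p. (grad i (U m) p - grad i (U n) p)\<^sup>2 \<partial>M)
        \<le> 2 * (\<integral>p. (grad i (U m) p - w i p)\<^sup>2 \<partial>M) + 2 * (\<integral>p. (grad i (U n) p - w i p)\<^sup>2 \<partial>M)" if i: "i \<in> I" for i
    proof -
      note m = L2_conv_mem[OF w[OF i]]
      have "(\<integral>p. (grad i (U m) p - grad i (U n) p)\<^sup>2 \<partial>M)
          = (\<integral>p. ((grad i (U m) p - w i p) + (w i p - grad i (U n) p))\<^sup>2 \<partial>M)" by simp
      also have "\<dots> \<le> 2 * (\<integral>p. (grad i (U m) p - w i p)\<^sup>2 \<partial>M) + 2 * (\<integral>p. (w i p - grad i (U n) p)\<^sup>2 \<partial>M)"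
        by (intro L2_add_bound L2_diff m)
      finally show ?thesis by (simp add: power2_commute)
    qed
    then have "E (\<lambda>p. U m p - U n p) (\<lambda>p. U m p - U n p)
        \<le> (\<Sum>i\<in>I. 2 * (\<integral>p. (grad i (U m) p - w i p)\<^sup>2 \<partial>M) + 2 * (\<integral>p. (grad i (U n) p - w i p)\<^sup>2 \<partial>M))"
      unfolding E_diff_eq[OF U U] by (rule sum_mono)
    then show ?thesis by (simp add: a_def sum.distrib sum_distrib_left)
  qed
  have "form_Cauchy E U" unfolding form_Cauchy_def
  proof (intro allI impI)
    fix e :: real assume "e > 0"
    then obtain n0 where n0: "\<And>n. n \<ge> n0 \<Longrightarrow> \<bar>a n\<bar> < e / 4"
      using LIMSEQ_D[OF a0, of "e / 4"] by auto
    have "E (\<lambda>p. U m p - U n p) (\<lambda>p. U m p - U n p) < e" if "m \<ge> n0" "n \<ge> n0" for m n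
      using le[of m n] n0[OF that(1)] n0[OF that(2)] by linarith
    then show "\<exists>n0. \<forall>m\<ge>n0. \<forall>n\<ge>n0. E (\<lambda>p. U m p - U n p) (\<lambda>p. U m p - U n p) < e" by blast
  qed
  then show ?thesis using U conv by (simp add: approximates_def L2_conv_iff_norm)
qed

text \<open>
  The limit of the gradients exists by completeness and is \<open>0\<close> by closability of the operator.
\<close>

lemma closable_form: "closable M D E"
  unfolding closable_def
proof (intro allI impI, elim conjE)
  fix U assume U': "\<forall>n. U n \<in> D" and C: "form_Cauchy E U" and z: "(\<lambda>n. L2_norm M (U n)) \<longlonglongrightarrow> 0"
  have U: "U n \<in> D" for n using U' by blast
  have "approximates M D E U (\<lambda>_. 0)" using U' C z by (simp add: approximates_def)
  from approximates_imp_grad_conv[OF this L2_zero] obtain w where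
    w: "L2_conv M U (\<lambda>_. 0)" "\<And>i. i \<in> I \<Longrightarrow> L2_conv M (\<lambda>n. grad i (U n)) (w i)" by blast
  have "(\<lambda>n. E (U n) (U n)) \<longlonglongrightarrow> (\<Sum>i\<in>I. \<integral>p. w i p * w i p \<partial>M)"
    by (rule E_tendsto[OF U U w(2) w(2)])
  moreover have "(\<integral>p. w i p * w i p \<partial>M) = 0" if "i \<in> I" for i
  proof (rule integral_eq_zero_AE)
    have "AE p in M. w i p = 0" by (rule grad_closable[OF U w(1) _ that]) (rule w(2))
    then show "AE p in M. w i p * w i p = 0" by eventually_elim simp
  qed
  ultimately show "(\<lambda>n. E (U n) (U n)) \<longlonglongrightarrow> 0" by simp
qed

lemma closure_dom_eq: "closure_dom M D E = {u. \<exists>w. weak_grad u w}"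
proof safe
  fix u assume "u \<in> closure_dom M D E"
  then obtain U where U: "u \<in> L2_space M" "approximates M D E U u" by (auto simp: closure_dom_def)
  from approximates_imp_grad_conv[OF U(2,1)] U(2) show "\<exists>w. weak_grad u w"
    unfolding weak_grad_def approximates_def by metis
next
  fix u w assume wg: "weak_grad u w"
  then obtain U where "\<And>n. U n \<in> D" "L2_conv M U u" "\<And>i. i \<in> I \<Longrightarrow> L2_conv M (\<lambda>n. grad i (U n)) (w i)"
    unfolding weak_grad_def by metis
  from grad_conv_imp_approximates[OF this] weak_grad_L2(1)[OF wg]
  show "u \<in> closure_dom M D E" by (auto simp: closure_dom_def)
qed

text \<open>
  The limit defining the closed form does not depend on the approximating sequences, since weak gradients
  are unique.
\<close>

lemma closure_form_eq:
  assumes wg: "weak_grad u w" and vz: "weak_grad v z"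
  shows "closure_form M D E u v = (\<Sum>i\<in>I. \<integral>p. w i p * z i p \<partial>M)"
  unfolding closure_form_def
proof (rule the_equality)
  obtain U W where U: "\<And>n. U n \<in> D" "L2_conv M U u" "\<And>i. i \<in> I \<Longrightarrow> L2_conv M (\<lambda>n. grad i (U n)) (w i)"
    and W: "\<And>n. W n \<in> D" "L2_conv M W v" "\<And>i. i \<in> I \<Longrightarrow> L2_conv M (\<lambda>n. grad i (W n)) (z i)"
    using wg vz unfolding weak_grad_def by metis
  show "\<exists>U W. approximates M D E U u \<and> approximates M D E W v \<and>
      (\<lambda>n. E (U n) (W n)) \<longlonglongrightarrow> (\<Sum>i\<in>I. \<integral>p. w i p * z i p \<partial>M)"
    using grad_conv_imp_approximates[OF U] grad_conv_imp_approximates[OF W] E_tendsto[OF U(1) W(1) U(3) W(3)]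
    by blast
next
  fix l assume "\<exists>U W. approximates M D E U u \<and> approximates M D E W v \<and> (\<lambda>n. E (U n) (W n)) \<longlonglongrightarrow> l"
  then obtain U W where U: "approximates M D E U u" and W: "approximates M D E W v"
    and l: "(\<lambda>n. E (U n) (W n)) \<longlonglongrightarrow> l" by blast
  have UD: "U n \<in> D" "W n \<in> D" for n using U W by (auto simp: approximates_def)
  obtain w' where w': "L2_conv M U u" "\<And>i. i \<in> I \<Longrightarrow> L2_conv M (\<lambda>n. grad i (U n)) (w' i)"
    using approximates_imp_grad_conv[OF U weak_grad_L2(1)[OF wg]] by blast
  obtain z' where z': "L2_conv M W v" "\<And>i. i \<in> I \<Longrightarrow> L2_conv M (\<lambda>n. grad i (W n)) (z' i)"
    using approximates_imp_grad_conv[OF W weak_grad_L2(1)[OF vz]] by blast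
  have g: "weak_grad u w'" "weak_grad v z'"
    unfolding weak_grad_def using UD w' z' by blast+
  have "(\<integral>p. w' i p * z' i p \<partial>M) = (\<integral>p. w i p * z i p \<partial>M)" if i: "i \<in> I" for i
  proof (rule integral_cong_AE)
    note [measurable] = weak_grad_L2(2)[OF wg i, THEN L2_measurable] weak_grad_L2(2)[OF vz i, THEN L2_measurable]
      weak_grad_L2(2)[OF g(1) i, THEN L2_measurable] weak_grad_L2(2)[OF g(2) i, THEN L2_measurable]
    show "(\<lambda>p. w' i p * z' i p) \<in> borel_measurable M" "(\<lambda>p. w i p * z i p) \<in> borel_measurable M"
      by measurable
    show "AE p in M. w' i p * z' i p = w i p * z i p"
      using weak_grad_unique[OF g(1) wg i] weak_grad_unique[OF g(2) vz i] by eventually_elim simp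
  qed
  then have "(\<lambda>n. E (U n) (W n)) \<longlonglongrightarrow> (\<Sum>i\<in>I. \<integral>p. w i p * z i p \<partial>M)"
    using E_tendsto[OF UD w'(2) z'(2)] by simp
  with l show "l = (\<Sum>i\<in>I. \<integral>p. w i p * z i p \<partial>M)" by (rule LIMSEQ_unique)
qed

lemma closure_form_diff_eq:
  assumes "weak_grad u w" "weak_grad v z"
  shows "closure_form M D E (\<lambda>p. u p - v p) (\<lambda>p. u p - v p) = (\<Sum>i\<in>I. \<integral>p. (w i p - z i p)\<^sup>2 \<partial>M)"
  unfolding closure_form_eq[OF weak_grad_diff[OF assms] weak_grad_diff[OF assms]]
  by (simp add: power2_eq_square)

lemma positive_definite: "positive_definite_form D E"
  unfolding positive_definite_form_def by (auto simp: E_eq intro!: sum_nonneg)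

lemma bilinear_closure:
  "symmetric_bilinear_form M (closure_dom M D E) (closure_form M D E)"
  unfolding symmetric_bilinear_form_def closure_dom_eq
proof (intro conjI ballI allI impI; clarify?)
  show "\<exists>w. weak_grad (\<lambda>_. 0) w" using weak_grad_D[OF D_zero] by blast
next
  fix u v w z assume "weak_grad u w" "weak_grad v z"
  from weak_grad_add[OF this] show "\<exists>w. weak_grad (\<lambda>p. u p + v p) w" by blast
next
  fix c u w assume "weak_grad u w"
  from weak_grad_scale[OF this] show "\<exists>w. weak_grad (\<lambda>p. c * u p) w" by blast
next
  fix u v q w z y assume g: "weak_grad u w" "weak_grad v z" "weak_grad q y"
  have i: "i \<in> I \<Longrightarrow> integrable M (\<lambda>p. w i p * y i p)" "i \<in> I \<Longrightarrow> integrable M (\<lambda>p. z i p * y i p)" for i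
    using g by (auto intro!: L2_mult_integrable weak_grad_L2(2))
  show "closure_form M D E (\<lambda>p. u p + v p) q = closure_form M D E u q + closure_form M D E v q"
    unfolding closure_form_eq[OF weak_grad_add[OF g(1,2)] g(3)] closure_form_eq[OF g(1,3)] closure_form_eq[OF g(2,3)]
    using i by (simp add: distrib_right flip: sum.distrib)
next
  fix c u v w z assume g: "weak_grad u w" "weak_grad v z"
  show "closure_form M D E (\<lambda>p. c * u p) v = c * closure_form M D E u v"
    unfolding closure_form_eq[OF weak_grad_scale[OF g(1)] g(2)] closure_form_eq[OF g]
    by (simp add: sum_distrib_left mult.assoc)
next
  fix u v w z assume g: "weak_grad u w" "weak_grad v z"
  show "closure_form M D E u v = closure_form M D E v u"
    unfolding closure_form_eq[OF g] closure_form_eq[OF g(2,1)] by (simp add: mult.commute)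
next
  fix u u' v w w' z assume g: "weak_grad u w" "weak_grad u' w'" "weak_grad v z" "AE p in M. u p = u' p"
  have "weak_grad u' w"
    by (rule weak_grad_cong_AE[OF g(1) L2_measurable[OF weak_grad_L2(1)[OF g(2)]] g(4)])
  from closure_form_eq[OF this g(3)] closure_form_eq[OF g(1,3)]
  show "closure_form M D E u v = closure_form M D E u' v" by simp
qed

lemma closure_form_D:
  assumes "u \<in> D" "v \<in> D"
  shows "closure_form M D E u v = E u v"
  unfolding closure_form_eq[OF weak_grad_D[OF assms(1)] weak_grad_D[OF assms(2)]] E_eq[OF assms] ..

lemma D_subset_closure: "D \<subseteq> closure_dom M D E"
  unfolding closure_dom_eq using weak_grad_D by blast

text \<open>
  On its own domain the form is the restriction of its closure, from which it inherits that it is well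
  defined on almost-everywhere classes.
\<close>

lemma bilinear: "symmetric_bilinear_form M D E"
proof -
  have S: "u \<in> closure_dom M D E" if "u \<in> D" for u using that D_subset_closure by blast
  note B = bilinear_closure[unfolded symmetric_bilinear_form_def]
  show ?thesis unfolding symmetric_bilinear_form_def
  proof (intro conjI ballI allI impI)
    fix u v w assume m: "u \<in> D" "v \<in> D" "w \<in> D"
    show "E (\<lambda>p. u p + v p) w = E u w + E v w"
    proof -
      have "closure_form M D E (\<lambda>p. u p + v p) w = closure_form M D E u w + closure_form M D E v w"
        using B S[OF m(1)] S[OF m(2)] S[OF m(3)] by blast
      then show ?thesis
        unfolding closure_form_D[OF D_add[OF m(1,2)] m(3)] closure_form_D[OF m(1,3)] closure_form_D[OF m(2,3)] .
    qed
  next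
    fix c u v assume m: "u \<in> D" "v \<in> D"
    show "E (\<lambda>p. c * u p) v = c * E u v"
    proof -
      have "closure_form M D E (\<lambda>p. c * u p) v = c * closure_form M D E u v"
        using B S[OF m(1)] S[OF m(2)] by blast
      then show ?thesis unfolding closure_form_D[OF D_scale[OF m(1)] m(2)] closure_form_D[OF m] .
    qed
  next
    fix u v assume m: "u \<in> D" "v \<in> D"
    show "E u v = E v u" using m by (simp add: E_eq mult.commute)
  next
    fix u u' v assume m: "u \<in> D" "u' \<in> D" "v \<in> D" and ae: "AE p in M. u p = u' p"
    have "closure_form M D E u v = closure_form M D E u' v"
      using B S[OF m(1)] S[OF m(2)] S[OF m(3)] ae by blast
    then show "E u v = E u' v" unfolding closure_form_D[OF m(1,3)] closure_form_D[OF m(2,3)] .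
  qed (auto simp: D_zero D_add D_scale)
qed

text \<open>
  A Cauchy sequence for \<open>form1\<close> is \<open>L\<^sup>2\<close>-Cauchy together with its gradients, and the graph of the weak
  gradient is closed.
\<close>

lemma closed_closure: "closed_form M (closure_dom M D E) (closure_form M D E)"
  unfolding closed_form_def
proof (intro allI impI, elim conjE)
  fix U assume "\<forall>n. U n \<in> closure_dom M D E"
    and C: "form_Cauchy (form1 M (closure_form M D E)) U"
  then have "\<forall>n. \<exists>w. weak_grad (U n) w" by (simp add: closure_dom_eq)
  from choice[OF this] obtain w where w: "\<And>n. weak_grad (U n) (w n)" by blast
  have f1: "form1 M (closure_form M D E) (\<lambda>p. U n p - v p) (\<lambda>p. U n p - v p)
     = (\<Sum>i\<in>I. \<integral>p. (w n i p - z i p)\<^sup>2 \<partial>M) + (\<integral>p. (U n p - v p)\<^sup>2 \<partial>M)" if "weak_grad v z" for n v z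
    unfolding form1_def L2_inner_def closure_form_diff_eq[OF w that] by (simp add: power2_eq_square)
  have le: "(\<integral>p. (w m i p - w n i p)\<^sup>2 \<partial>M) \<le> form1 M (closure_form M D E) (\<lambda>p. U m p - U n p) (\<lambda>p. U m p - U n p)"
    if "i \<in> I" for m n i
  proof -
    have "(\<integral>p. (w m i p - w n i p)\<^sup>2 \<partial>M) \<le> (\<Sum>i\<in>I. \<integral>p. (w m i p - w n i p)\<^sup>2 \<partial>M)"
      by (rule member_le_sum[OF that, of "\<lambda>i. \<integral>p. (w m i p - w n i p)\<^sup>2 \<partial>M"]) (auto simp: finite_I)
    moreover have "0 \<le> (\<integral>p. (U m p - U n p)\<^sup>2 \<partial>M)" by simp
    ultimately show ?thesis unfolding f1[OF w] by linarith
  qed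
  have le': "(\<integral>p. (U m p - U n p)\<^sup>2 \<partial>M) \<le> form1 M (closure_form M D E) (\<lambda>p. U m p - U n p) (\<lambda>p. U m p - U n p)" for m n
    unfolding f1[OF w] by (simp add: sum_nonneg)
  have Cau: "L2_Cauchy M F" if "\<And>m n. (\<integral>p. (F m p - F n p)\<^sup>2 \<partial>M)
      \<le> form1 M (closure_form M D E) (\<lambda>p. U m p - U n p) (\<lambda>p. U m p - U n p)" for F
    unfolding L2_Cauchy_def
  proof (intro allI impI)
    fix e :: real assume "e > 0"
    with C obtain n0 where "\<forall>m\<ge>n0. \<forall>n\<ge>n0.
        form1 M (closure_form M D E) (\<lambda>p. U m p - U n p) (\<lambda>p. U m p - U n p) < e"
      unfolding form_Cauchy_def by blast
    then show "\<exists>n0. \<forall>m\<ge>n0. \<forall>n\<ge>n0. (\<integral>p. (F m p - F n p)\<^sup>2 \<partial>M) < e"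
      using that le_less_trans by blast
  qed
  obtain u where u: "L2_conv M U u"
    using L2_complete[of M U] finite_measure_axioms weak_grad_L2(1)[OF w] Cau[OF le'] by metis
  have "\<exists>v. L2_conv M (\<lambda>n. w n i) v" if i: "i \<in> I" for i
    using L2_complete[of M "\<lambda>n. w n i"] finite_measure_axioms weak_grad_L2(2)[OF w i]
      Cau[of "\<lambda>n. w n i", OF le[OF i]] by metis
  then have "\<forall>i\<in>I. \<exists>v. L2_conv M (\<lambda>n. w n i) v" by blast
  from bchoice[OF this] obtain z where z: "\<And>i. i \<in> I \<Longrightarrow> L2_conv M (\<lambda>n. w n i) (z i)" by blast
  have wz: "weak_grad u z" by (rule weak_grad_closed[OF w u z])
  have "(\<lambda>n. (\<Sum>i\<in>I. \<integral>p. (w n i p - z i p)\<^sup>2 \<partial>M) + (\<integral>p. (U n p - u p)\<^sup>2 \<partial>M)) \<longlonglongrightarrow> (\<Sum>i\<in>I. 0) + 0"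
    using u z by (intro tendsto_add tendsto_sum) (auto simp: L2_conv_def)
  then have "(\<lambda>n. form1 M (closure_form M D E) (\<lambda>p. U n p - u p) (\<lambda>p. U n p - u p)) \<longlonglongrightarrow> 0"
    unfolding f1[OF wz] by simp
  then show "\<exists>u\<in>closure_dom M D E.
      (\<lambda>n. form1 M (closure_form M D E) (\<lambda>p. U n p - u p) (\<lambda>p. U n p - u p)) \<longlonglongrightarrow> 0"
    using wz by (auto simp: closure_dom_eq)
qed

lemma Dirichlet_closure: "symmetric_Dirichlet_form M (closure_dom M D E) (closure_form M D E)"
  unfolding symmetric_Dirichlet_form_def
proof (intro conjI ballI bilinear_closure closed_closure)
  show "densely_defined M (closure_dom M D E)"
    using dense_D D_subset_closure weak_grad_L2(1) unfolding densely_defined_def closure_dom_eq by blast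
  show "positive_definite_form (closure_dom M D E) (closure_form M D E)"
    unfolding positive_definite_form_def closure_dom_eq
    by (auto simp: closure_form_eq intro!: sum_nonneg)
  fix u assume "u \<in> closure_dom M D E"
  then obtain w where w: "weak_grad u w" by (auto simp: closure_dom_eq)
  from weak_grad_unit_contraction[OF w] obtain g where g: "\<And>t. 0 \<le> g t" "\<And>t. g t \<le> (1::real)"
    and c: "weak_grad (\<lambda>p. min (max (u p) 0) 1) (\<lambda>i p. g (u p) * w i p)" by blast
  show "(\<lambda>p. min (max (u p) 0) 1) \<in> closure_dom M D E" using c by (auto simp: closure_dom_eq)
  show "closure_form M D E (\<lambda>p. min (max (u p) 0) 1) (\<lambda>p. min (max (u p) 0) 1) \<le> closure_form M D E u u"
    unfolding closure_form_eq[OF c c] closure_form_eq[OF w w]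
  proof (intro sum_mono integral_mono)
    fix i assume i: "i \<in> I"
    show "integrable M (\<lambda>p. g (u p) * w i p * (g (u p) * w i p))" "integrable M (\<lambda>p. w i p * w i p)"
      using weak_grad_L2(2)[OF c i] weak_grad_L2(2)[OF w i] by (auto intro: L2_mult_integrable)
    show "g (u p) * w i p * (g (u p) * w i p) \<le> w i p * w i p" for p
    proof -
      have "(g (u p))\<^sup>2 \<le> 1" using g by (intro power_le_one) auto
      then have "(g (u p))\<^sup>2 * (w i p)\<^sup>2 \<le> 1 * (w i p)\<^sup>2" by (intro mult_right_mono) auto
      then show ?thesis by (simp add: power2_eq_square mult_ac)
    qed
  qed
qed

text \<open>
  If \<open>1\<close> lies in the domain with vanishing gradient, then \<open>\<alpha> G\<^sub>\<alpha> 1 = 1\<close>, and all iterates defining the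
  semigroup are equal to \<open>1\<close> almost everywhere.
\<close>

lemma resolvent_one:
  assumes one: "weak_grad (\<lambda>_. 1) (\<lambda>_ _. 0)" and a: "a > 0" and h: "h \<in> L2_space M" "AE p in M. h p = 1"
  defines "g \<equiv> form_resolvent M (closure_dom M D E) (closure_form M D E) a h"
  shows "g \<in> L2_space M \<and> (AE p in M. a * g p = 1)"
proof -
  let ?D = "closure_dom M D E" and ?E = "closure_form M D E"
  let ?P = "\<lambda>g. g \<in> ?D \<and> (\<forall>v\<in>?D. ?E g v + a * L2_inner M g v = L2_inner M h v)"
  note [measurable] = L2_measurable[OF h(1)]
  have hv: "L2_inner M h v = (\<integral>p. v p \<partial>M)" if [measurable]: "v \<in> borel_measurable M" for v
    unfolding L2_inner_def by (rule integral_cong_AE) (use h(2) in auto)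
  have c: "weak_grad (\<lambda>_. 1 / a) (\<lambda>_ _. 0)" using weak_grad_scale[OF one, of "1/a"] by simp
  have "?P (\<lambda>_. 1 / a)"
  proof (intro conjI ballI)
    show "(\<lambda>_. 1 / a) \<in> ?D" using c by (auto simp: closure_dom_eq)
    fix v assume "v \<in> ?D"
    then obtain z where z: "weak_grad v z" by (auto simp: closure_dom_eq)
    show "?E (\<lambda>_. 1 / a) v + a * L2_inner M (\<lambda>_. 1 / a) v = L2_inner M h v"
      using a unfolding closure_form_eq[OF c z] hv[OF L2_measurable[OF weak_grad_L2(1)[OF z]]]
      by (simp add: L2_inner_def)
  qed
  from someI[of ?P, OF this] have g: "?P g" unfolding g_def form_resolvent_def .
  then obtain w where w: "weak_grad g w" by (auto simp: closure_dom_eq)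
  have d: "weak_grad (\<lambda>p. g p - 1 / a) (\<lambda>i p. w i p - 0)" by (rule weak_grad_diff[OF w c])
  note gL = weak_grad_L2(1)[OF w] and dL = weak_grad_L2(1)[OF d]
  have "(\<Sum>i\<in>I. \<integral>p. w i p * w i p \<partial>M) + a * L2_inner M g (\<lambda>p. g p - 1 / a) = (\<integral>p. g p - 1 / a \<partial>M)"
    using g d hv[OF L2_measurable[OF dL]] closure_form_eq[OF w d] by (auto simp: closure_dom_eq)
  moreover have "a * L2_inner M g (\<lambda>p. g p - 1 / a) - (\<integral>p. g p - 1 / a \<partial>M) = a * (\<integral>p. (g p - 1 / a)\<^sup>2 \<partial>M)"
  proof -
    have i1: "integrable M (\<lambda>p. g p * (g p - 1 / a))" by (rule L2_mult_integrable[OF gL dL])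
    have i2: "integrable M (\<lambda>p. g p - 1 / a)"
      using L2_mult_integrable[OF weak_grad_L2(1)[OF one] dL] by simp
    have "a * L2_inner M g (\<lambda>p. g p - 1 / a) - (\<integral>p. g p - 1 / a \<partial>M)
        = (\<integral>p. a * (g p * (g p - 1 / a)) - (g p - 1 / a) \<partial>M)"
      unfolding L2_inner_def using i1 i2 by (subst Bochner_Integration.integral_diff) auto
    also have "\<dots> = (\<integral>p. a * (g p - 1 / a)\<^sup>2 \<partial>M)"
      using a by (intro Bochner_Integration.integral_cong) (auto simp: power2_eq_square field_simps)
    finally show ?thesis by simp
  qed
  moreover have "(\<Sum>i\<in>I. \<integral>p. w i p * w i p \<partial>M) \<ge> 0" by (intro sum_nonneg) simp
  ultimately have "a * (\<integral>p. (g p - 1 / a)\<^sup>2 \<partial>M) \<le> 0" by linarith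
  then have "(\<integral>p. (g p - 1 / a)\<^sup>2 \<partial>M) \<le> 0" using a by (simp add: mult_le_0_iff)
  then have "(\<integral>p. (g p - 1 / a)\<^sup>2 \<partial>M) = 0" by (intro antisym) simp_all
  then have "AE p in M. g p - 1 / a = 0" using L2_AE_zero_iff[OF dL] by simp
  then have "AE p in M. a * g p = 1" by eventually_elim (use a in \<open>simp add: field_simps\<close>)
  with gL show ?thesis by blast
qed

lemma conservative_closure:
  assumes one: "weak_grad (\<lambda>_. 1) (\<lambda>_ _. 0)"
  shows "conservative_form M (closure_dom M D E) (closure_form M D E)"
  unfolding conservative_form_def
proof (intro conjI allI impI)
  show oneL: "(\<lambda>_. 1) \<in> L2_space M" by (rule weak_grad_L2(1)[OF one])
  fix t :: real assume t: "t > 0"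
  define T where "T n = (\<lambda>h q. (real n / t) *
      form_resolvent M (closure_dom M D E) (closure_form M D E) (real n / t) h q)" for n
  have step: "T n h \<in> L2_space M \<and> (AE p in M. T n h p = 1)"
    if "n > 0" "h \<in> L2_space M \<and> (AE p in M. h p = 1)" for n h
  proof -
    have "real n / t > 0" using that t by simp
    from resolvent_one[OF one this] that(2) show ?thesis unfolding T_def by (blast intro: L2_scale)
  qed
  have it: "(T n ^^ n) (\<lambda>_. 1) \<in> L2_space M \<and> (AE p in M. (T n ^^ n) (\<lambda>_. 1) p = 1)" for n
  proof (cases "n = 0")
    case False
    have "(T n ^^ k) (\<lambda>_. 1) \<in> L2_space M \<and> (AE p in M. (T n ^^ k) (\<lambda>_. 1) p = 1)" for k
    proof (induction k)
      case (Suc k)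
      then show ?case using step[of n "(T n ^^ k) (\<lambda>_. 1)"] False by simp
    qed (simp add: oneL)
    then show ?thesis .
  qed (simp add: oneL)
  let ?Q = "\<lambda>g. g \<in> L2_space M \<and> (\<lambda>n. L2_norm M (\<lambda>p. (T n ^^ n) (\<lambda>_. 1) p - g p)) \<longlonglongrightarrow> 0"
  have conv1: "L2_conv M (\<lambda>n. (T n ^^ n) (\<lambda>_. 1)) (\<lambda>_. 1)"
  proof -
    have "(\<integral>p. ((T n ^^ n) (\<lambda>_. 1) p - 1)\<^sup>2 \<partial>M) = 0" for n
      by (rule integral_eq_zero_AE) (use it[of n] in auto)
    then show ?thesis using it oneL by (simp add: L2_conv_def)
  qed
  then have "?Q (\<lambda>_. 1)" unfolding L2_conv_iff_norm by blast
  from someI[of ?Q, OF this] have "?Q (form_semigroup M (closure_dom M D E) (closure_form M D E) t (\<lambda>_. 1))"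
    unfolding form_semigroup_def T_def .
  then have "L2_conv M (\<lambda>n. (T n ^^ n) (\<lambda>_. 1)) (form_semigroup M (closure_dom M D E) (closure_form M D E) t (\<lambda>_. 1))"
    using it unfolding L2_conv_iff_norm by blast
  from L2_conv_unique[OF this conv1]
  show "AE p in M. form_semigroup M (closure_dom M D E) (closure_form M D E) t (\<lambda>_. 1) p = 1" .
qed

end

text \<open>
  The gradient of \<open>u\<close> vanishes almost everywhere on \<open>{u = 0}\<close> and that of \<open>v\<close> on \<open>{v = c}\<close>; by assumption
  these two sets exhaust the space up to a null set.
\<close>

lemma (in gradient_form) closure_form_eq_0:
  assumes w: "weak_grad u w" and z: "weak_grad v z" and ae: "AE p in M. u p = 0 \<or> v p = c"
  shows "closure_form M D E u v = 0"
  unfolding closure_form_eq[OF w z]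
proof (intro sum.neutral ballI integral_eq_zero_AE)
  fix i assume i: "i \<in> I"
  show "AE p in M. w i p * z i p = 0"
    using ae weak_grad_level_set[OF w i, of 0] weak_grad_level_set[OF z i, of c]
    by eventually_elim auto
qed

lemma strongly_local_closure:
  fixes M :: "'a::topological_space measure"
  assumes "gradient_form M D I grad E"
    and ess: "\<And>u. u \<in> L2_space M \<Longrightarrow> AE p in M. p \<notin> ess_support M u \<longrightarrow> u p = 0"
  shows "strongly_local M (closure_dom M D E) (closure_form M D E)"
proof -
  interpret gradient_form M D I grad E by fact
  show ?thesis unfolding strongly_local_def closure_dom_eq
  proof (intro ballI impI; clarify)
    fix u v w z c U assume g: "weak_grad u w" "weak_grad v z"
      and U: "ess_support M u \<subseteq> U" "AE p in M. p \<in> U \<longrightarrow> v p = c"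
    have "AE p in M. u p = 0 \<or> v p = c"
      using U(2) ess[OF weak_grad_L2(1)[OF g(1)]] by eventually_elim (use U(1) in auto)
    then show "closure_form M D E u v = 0" by (rule closure_form_eq_0[OF g])
  qed
qed

lemma regular_closure:
  fixes M :: "'a::topological_space measure"
  assumes "gradient_form M D I grad E" and DC: "D \<subseteq> Cc (space M)"
    and unif: "\<And>f e. f \<in> Cc (space M) \<Longrightarrow> e > 0 \<Longrightarrow> \<exists>g\<in>D. \<forall>p\<in>space M. \<bar>f p - g p\<bar> < e"
  shows "regular_form M (closure_dom M D E) (closure_form M D E)"
proof -
  interpret gradient_form M D I grad E by fact
  show ?thesis unfolding regular_form_def
  proof (intro conjI ballI allI impI)
    fix u and e :: real assume "u \<in> closure_dom M D E" and e: "e > 0"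
    then obtain w where w: "weak_grad u w" by (auto simp: closure_dom_eq)
    then obtain U where U: "\<And>n. U n \<in> D" "L2_conv M U u" "\<And>i. i \<in> I \<Longrightarrow> L2_conv M (\<lambda>n. grad i (U n)) (w i)"
      unfolding weak_grad_def by metis
    have eq: "form1 M (closure_form M D E) (\<lambda>p. u p - U n p) (\<lambda>p. u p - U n p)
      = (\<Sum>i\<in>I. \<integral>p. (grad i (U n) p - w i p)\<^sup>2 \<partial>M) + (\<integral>p. (U n p - u p)\<^sup>2 \<partial>M)" for n
      unfolding form1_def L2_inner_def closure_form_diff_eq[OF w weak_grad_D[OF U(1)]]
      by (simp add: power2_commute flip: power2_eq_square)
    have "(\<lambda>n. (\<Sum>i\<in>I. \<integral>p. (grad i (U n) p - w i p)\<^sup>2 \<partial>M) + (\<integral>p. (U n p - u p)\<^sup>2 \<partial>M)) \<longlonglongrightarrow> (\<Sum>i\<in>I. 0) + 0"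
      using U(2,3) by (intro tendsto_add tendsto_sum) (auto simp: L2_conv_def)
    then have "(\<lambda>n. form1 M (closure_form M D E) (\<lambda>p. u p - U n p) (\<lambda>p. u p - U n p)) \<longlonglongrightarrow> 0"
      unfolding eq by simp
    from order_tendstoD(2)[OF this e] obtain n where
      "form1 M (closure_form M D E) (\<lambda>p. u p - U n p) (\<lambda>p. u p - U n p) < e"
      using eventually_happens'[OF sequentially_bot] by blast
    then show "\<exists>g\<in>closure_dom M D E \<inter> Cc (space M).
        form1 M (closure_form M D E) (\<lambda>p. u p - g p) (\<lambda>p. u p - g p) < e"
      using U(1)[of n] D_subset_closure DC by (intro bexI[of _ "U n"]) auto
  next
    fix f and e :: real assume "f \<in> Cc (space M)" "e > 0"
    from unif[OF this] show "\<exists>g\<in>closure_dom M D E \<inter> Cc (space M). \<forall>p\<in>space M. \<bar>f p - g p\<bar> < e"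
      using D_subset_closure DC by blast
  qed
qed

section \<open>The state space\<close>

text \<open>
  The interface type is a function space over an uncountable index type, hence neither metrisable
  nor second countable; only finitely many coordinates matter, so topological and measurability
  questions are moved to \<open>nat \<Rightarrow> real\<close> by an enumeration of the sites.
\<close>

lemma finite_site_box: "finite (site_box d N)"
  by (auto simp: site_box_def intro!: finite_PiE)

lemma site_box_nonempty: "N \<ge> 1 \<Longrightarrow> site_box d N \<noteq> {}"
  by (auto simp: site_box_def PiE_eq_empty_iff)

lemma state_space_upd:
  "\<phi> \<in> state_space d N \<Longrightarrow> x \<in> site_box d N \<Longrightarrow> t \<ge> 0 \<Longrightarrow> \<phi>(x := t) \<in> state_space d N"
  by (auto simp: state_space_def PiE_def extensional_def)

lemma interior_space_upd:
  "\<phi> \<in> interior_space d N \<Longrightarrow> x \<in> site_box d N \<Longrightarrow> t > 0 \<Longrightarrow> \<phi>(x := t) \<in> interior_space d N"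
  by (auto simp: interior_space_def PiE_def extensional_def)

lemma interior_subset_state: "interior_space d N \<subseteq> state_space d N"
  by (auto simp: interior_space_def state_space_def PiE_def Pi_def less_imp_le)

lemma interior_space_pos: "\<phi> \<in> interior_space d N \<Longrightarrow> x \<in> site_box d N \<Longrightarrow> \<phi> x > 0"
  by (auto simp: interior_space_def)

lemma continuous_on_coord: "continuous_on S (\<lambda>\<phi>::interface. \<phi> x)"
  by (rule continuous_on_subset[OF continuous_on_product_coordinates]) simp

lemma continuous_on_upd: "continuous_on S (\<lambda>t::real. \<phi>(x := t))"
proof (rule continuous_on_coordinatewise_then_product)
  show "continuous_on S (\<lambda>t. (\<phi>(x := t)) i)" for i
    by (cases "i = x") (auto intro: continuous_intros)
qed

lemma continuous_on_upd_comp: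
  assumes "continuous_on (state_space d N) f" "\<phi> \<in> state_space d N" "x \<in> site_box d N"
  shows "continuous_on {0..} (\<lambda>t. f (\<phi>(x := t)))"
  by (rule continuous_on_compose2[OF assms(1) continuous_on_upd]) (use assms state_space_upd in auto)

text \<open>
  A path that leads from any point of the state space into the interior; it is used to extend facts about
  interior points by continuity.
\<close>

definition lift_interface :: "nat \<Rightarrow> nat \<Rightarrow> interface \<Rightarrow> real \<Rightarrow> interface" where
  "lift_interface d N \<phi> \<epsilon> = (\<lambda>x. if x \<in> site_box d N then \<phi> x + \<epsilon> else \<phi> x)"

lemma continuous_on_lift: "continuous_on S (lift_interface d N \<phi>)"
  unfolding lift_interface_def
proof (rule continuous_on_coordinatewise_then_product)
  show "continuous_on S (\<lambda>\<epsilon>. if i \<in> site_box d N then \<phi> i + \<epsilon> else \<phi> i)" for i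
    by (cases "i \<in> site_box d N") (auto intro!: continuous_intros)
qed

lemma lift_interface_0 [simp]: "lift_interface d N \<phi> 0 = \<phi>"
  by (auto simp: lift_interface_def)

lemma lift_in_state: "\<phi> \<in> state_space d N \<Longrightarrow> \<epsilon> \<ge> 0 \<Longrightarrow> lift_interface d N \<phi> \<epsilon> \<in> state_space d N"
  by (fastforce simp: lift_interface_def state_space_def PiE_def Pi_def extensional_def)

lemma lift_in_interior: "\<phi> \<in> state_space d N \<Longrightarrow> \<epsilon> > 0 \<Longrightarrow> lift_interface d N \<phi> \<epsilon> \<in> interior_space d N"
  by (fastforce simp: lift_interface_def state_space_def interior_space_def PiE_def Pi_def extensional_def
      intro: add_nonneg_pos)

lemma tendsto_lift:
  assumes "continuous_on (state_space d N) f" "\<phi> \<in> state_space d N"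
  shows "(\<lambda>n. f (lift_interface d N \<phi> (inverse (real (Suc n))))) \<longlonglongrightarrow> f \<phi>"
proof -
  have "continuous_on {0..} (\<lambda>\<epsilon>. f (lift_interface d N \<phi> \<epsilon>))"
    by (rule continuous_on_compose2[OF assms(1) continuous_on_lift]) (use lift_in_state assms in auto)
  from continuous_on_tendsto_compose[OF this LIMSEQ_inverse_real_of_nat] show ?thesis
    by simp
qed

text \<open>
  Makes the limit in the definition of \<open>partial_ext\<close> unique. A box without sites would have a one-point state
  space and no limit points, whence \<open>N \<ge> 1\<close>.
\<close>

lemma at_interior_nontrivial:
  assumes "N \<ge> 1" "\<phi> \<in> state_space d N"
  shows "at \<phi> within interior_space d N \<noteq> bot"
proof -
  obtain x where x: "x \<in> site_box d N" using site_box_nonempty[OF assms(1)] by blast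
  have "\<exists>\<psi>\<in>interior_space d N. \<psi> \<in> T \<and> \<psi> \<noteq> \<phi>" if T: "\<phi> \<in> T" "open T" for T
  proof -
    have "open (lift_interface d N \<phi> -` T)"
      using continuous_on_open_vimage[of UNIV "lift_interface d N \<phi>"] continuous_on_lift T by auto
    moreover have "0 \<in> lift_interface d N \<phi> -` T" using T by simp
    ultimately obtain e where e: "e > 0" "\<forall>y. dist y 0 < e \<longrightarrow> y \<in> lift_interface d N \<phi> -` T"
      unfolding open_dist by blast
    define \<psi> where "\<psi> = lift_interface d N \<phi> (e / 2)"
    have "\<psi> x \<noteq> \<phi> x" using e x by (simp add: \<psi>_def lift_interface_def)
    then have "\<psi> \<noteq> \<phi>" by auto
    moreover have "\<psi> \<in> T" using e by (simp add: \<psi>_def)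
    moreover have "\<psi> \<in> interior_space d N" unfolding \<psi>_def by (rule lift_in_interior) (use assms e in auto)
    ultimately show ?thesis by blast
  qed
  then have "\<phi> islimpt interior_space d N" by (auto simp: islimpt_def)
  then show ?thesis by (simp add: trivial_limit_within)
qed

lemma compact_cube:
  fixes A :: "'i set" and S :: "'i \<Rightarrow> real set"
  assumes "\<And>i. i \<in> A \<Longrightarrow> compact (S i)"
  shows "compact (PiE A S)"
proof -
  have eq: "PiE A S = PiE UNIV (\<lambda>i. if i \<in> A then S i else {undefined})"
    by (auto simp: PiE_def extensional_def Pi_def split: if_splits)
  have "compactin (product_topology (\<lambda>i. euclidean) UNIV) (PiE UNIV (\<lambda>i. if i \<in> A then S i else {undefined}))"
    unfolding compactin_PiE using assms by auto
  then show ?thesis by (simp add: eq euclidean_product_topology)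
qed

definition state_cube :: "nat \<Rightarrow> nat \<Rightarrow> real \<Rightarrow> interface set" where
  "state_cube d N R = (site_box d N \<rightarrow>\<^sub>E {0..R})"

lemma compact_state_cube: "compact (state_cube d N R)"
  unfolding state_cube_def by (rule compact_cube) simp

lemma state_cube_subset: "state_cube d N R \<subseteq> state_space d N"
  by (auto simp: state_cube_def state_space_def PiE_def Pi_def)

lemma in_state_cube_iff:
  "\<phi> \<in> state_cube d N R \<longleftrightarrow> \<phi> \<in> state_space d N \<and> (\<forall>x\<in>site_box d N. \<phi> x \<le> R)"
  by (auto simp: state_cube_def state_space_def PiE_def Pi_def)

definition supported_in :: "nat \<Rightarrow> nat \<Rightarrow> real \<Rightarrow> (interface \<Rightarrow> real) \<Rightarrow> bool" where
  "supported_in d N R F \<longleftrightarrow> (\<forall>\<phi>\<in>state_space d N. \<forall>x\<in>site_box d N. \<phi> x > R \<longrightarrow> F \<phi> = 0)"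

lemma supported_inD: "supported_in d N R F \<Longrightarrow> \<phi> \<in> state_space d N - state_cube d N R \<Longrightarrow> F \<phi> = 0"
  by (auto simp: supported_in_def in_state_cube_iff not_le)

lemma supported_in_mono: "supported_in d N R F \<Longrightarrow> R \<le> R' \<Longrightarrow> supported_in d N R' F"
  by (fastforce simp: supported_in_def)

text \<open>
  Coordinates are bounded on compact sets, and cubes are compact by Tychonoff's theorem, so compact support
  means support in a cube.
\<close>

lemma Cc_state_iff:
  "F \<in> Cc (state_space d N) \<longleftrightarrow> continuous_on (state_space d N) F \<and> (\<exists>R>0. supported_in d N R F)"
proof safe
  assume "F \<in> Cc (state_space d N)"
  then obtain K where c: "continuous_on (state_space d N) F" and K: "compact K" "K \<subseteq> state_space d N"
    "\<And>\<phi>. \<phi> \<in> state_space d N - K \<Longrightarrow> F \<phi> = 0" by (auto simp: Cc_def)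
  show "continuous_on (state_space d N) F" by fact
  have "\<forall>x. \<exists>B. \<forall>\<phi>\<in>K. \<bar>\<phi> x\<bar> \<le> B"
    using compact_imp_bounded[OF compact_continuous_image[OF continuous_on_coord K(1)]]
    by (fastforce simp: bounded_iff)
  then obtain B where B: "\<And>x \<phi>. \<phi> \<in> K \<Longrightarrow> \<bar>\<phi> x\<bar> \<le> B x" by metis
  define R where "R = Max (insert 1 (B ` site_box d N))"
  have R: "R \<ge> 1" "\<And>x. x \<in> site_box d N \<Longrightarrow> B x \<le> R"
    by (auto simp: R_def finite_site_box)
  have "supported_in d N R F" unfolding supported_in_def
  proof (intro ballI impI)
    fix \<phi> x assume "\<phi> \<in> state_space d N" "x \<in> site_box d N" "\<phi> x > R"
    with B[of \<phi> x] R(2)[of x] show "F \<phi> = 0" by (intro K(3)) auto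
  qed
  then show "\<exists>R>0. supported_in d N R F" using R(1) by (intro exI[of _ R]) auto
next
  fix R :: real assume c: "continuous_on (state_space d N) F" and "R > 0" and s: "supported_in d N R F"
  show "F \<in> Cc (state_space d N)"
    unfolding Cc_def mem_Collect_eq
    by (intro conjI c exI[of _ "state_cube d N R"] ballI compact_state_cube state_cube_subset supported_inD[OF s])
qed

lemma Cc_bounded:
  assumes "continuous_on (state_space d N) F" "supported_in d N R F"
  obtains B where "B \<ge> 0" "\<And>\<phi>. \<phi> \<in> state_space d N \<Longrightarrow> \<bar>F \<phi>\<bar> \<le> B"
proof -
  have "bounded (F ` state_cube d N R)"
    by (intro compact_imp_bounded compact_continuous_image compact_state_cube
        continuous_on_subset[OF assms(1) state_cube_subset])
  then obtain B where B: "\<And>\<phi>. \<phi> \<in> state_cube d N R \<Longrightarrow> \<bar>F \<phi>\<bar> \<le> B"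
    by (auto simp: bounded_iff)
  have "\<bar>F \<phi>\<bar> \<le> max B 0" if "\<phi> \<in> state_space d N" for \<phi>
    using B[of \<phi>] supported_inD[OF assms(2), of \<phi>] that by (cases "\<phi> \<in> state_cube d N R") auto
  then show thesis by (intro that[of "max B 0"]) auto
qed

section \<open>Calculus of twice differentiable functions on the state space\<close>

text \<open>
  A function together with its extended partial derivatives: with explicit derivatives the algebra
  of such functions reduces to one-variable rules at interior points.
\<close>

definition C2_data ::
  "nat \<Rightarrow> nat \<Rightarrow> (interface \<Rightarrow> real) \<Rightarrow> (site \<Rightarrow> interface \<Rightarrow> real) \<Rightarrow> (site \<Rightarrow> site \<Rightarrow> interface \<Rightarrow> real) \<Rightarrow> bool"
  where
  "C2_data d N F g H \<longleftrightarrow> continuous_on (state_space d N) F \<and>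
     (\<forall>x\<in>site_box d N. continuous_on (state_space d N) (g x)) \<and>
     (\<forall>x\<in>site_box d N. \<forall>\<phi>\<in>interior_space d N.
        ((\<lambda>t. F (\<phi>(x := t))) has_real_derivative g x \<phi>) (at (\<phi> x))) \<and>
     (\<forall>x\<in>site_box d N. \<forall>y\<in>site_box d N. continuous_on (state_space d N) (H x y)) \<and>
     (\<forall>x\<in>site_box d N. \<forall>y\<in>site_box d N. \<forall>\<phi>\<in>interior_space d N.
        ((\<lambda>t. g x (\<phi>(y := t))) has_real_derivative H x y \<phi>) (at (\<phi> y)))"

lemma C2_dataD:
  assumes "C2_data d N F g H"
  shows "continuous_on (state_space d N) F"
    "x \<in> site_box d N \<Longrightarrow> continuous_on (state_space d N) (g x)"
    "x \<in> site_box d N \<Longrightarrow> \<phi> \<in> interior_space d N \<Longrightarrow>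
       ((\<lambda>t. F (\<phi>(x := t))) has_real_derivative g x \<phi>) (at (\<phi> x))"
    "x \<in> site_box d N \<Longrightarrow> y \<in> site_box d N \<Longrightarrow> continuous_on (state_space d N) (H x y)"
    "x \<in> site_box d N \<Longrightarrow> y \<in> site_box d N \<Longrightarrow> \<phi> \<in> interior_space d N \<Longrightarrow>
        ((\<lambda>t. g x (\<phi>(y := t))) has_real_derivative H x y \<phi>) (at (\<phi> y))"
  using assms unfolding C2_data_def by blast+

lemma C2_data_partial:
  assumes "C2_data d N F g H" "x \<in> site_box d N" "\<phi> \<in> interior_space d N"
  shows "partial x F \<phi> = g x \<phi>"
  unfolding partial_def by (rule DERIV_imp_deriv[OF C2_dataD(3)[OF assms]])

lemma partial_ext_eq:
  assumes N: "N \<ge> 1" and c: "continuous_on (state_space d N) g"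
    and eq: "\<And>\<phi>. \<phi> \<in> interior_space d N \<Longrightarrow> partial x F \<phi> = g \<phi>" and \<phi>: "\<phi> \<in> state_space d N"
  shows "partial_ext d N x F \<phi> = g \<phi>"
  unfolding partial_ext_def
proof (rule tendsto_Lim[OF at_interior_nontrivial[OF N \<phi>]])
  have "(g \<longlongrightarrow> g \<phi>) (at \<phi> within state_space d N)"
    using c \<phi> by (auto simp: continuous_on_def)
  then have "(g \<longlongrightarrow> g \<phi>) (at \<phi> within interior_space d N)"
    by (rule tendsto_within_subset[OF _ interior_subset_state])
  moreover have "\<forall>\<^sub>F \<psi> in at \<phi> within interior_space d N. g \<psi> = partial x F \<psi>"
    by (auto simp: eventually_at_topological eq intro!: exI[of _ UNIV])
  ultimately show "(partial x F \<longlongrightarrow> g \<phi>) (at \<phi> within interior_space d N)"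
    by (rule Lim_transform_eventually)
qed

lemma C2_data_partial_ext:
  assumes "N \<ge> 1" "C2_data d N F g H" "x \<in> site_box d N" "\<phi> \<in> state_space d N"
  shows "partial_ext d N x F \<phi> = g x \<phi>"
  by (rule partial_ext_eq[OF assms(1) C2_dataD(2)[OF assms(2,3)] C2_data_partial[OF assms(2,3)] assms(4)])

text \<open>
  Near an interior point a coordinate line stays in the interior. Under a further derivative,
  \<open>partial x F\<close> may therefore be replaced by its continuous extension.
\<close>

lemma line_deriv_cong:
  assumes "\<phi> \<in> interior_space d N" "y \<in> site_box d N"
    and "\<And>\<psi>. \<psi> \<in> interior_space d N \<Longrightarrow> f \<psi> = f' \<psi>"
  shows "((\<lambda>t. f (\<phi>(y := t))) has_real_derivative l) (at (\<phi> y)) \<longleftrightarrow>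
         ((\<lambda>t. f' (\<phi>(y := t))) has_real_derivative l) (at (\<phi> y))"
proof (rule DERIV_cong_ev[OF refl _ refl])
  have "\<forall>\<^sub>F t in nhds (\<phi> y). t > 0"
    using interior_space_pos[OF assms(1,2)] order_tendstoD(1)[OF tendsto_ident_at] 
    by (intro eventually_nhds_in_open[of "{0<..}", simplified]) auto
  then show "\<forall>\<^sub>F t in nhds (\<phi> y). f (\<phi>(y := t)) = f' (\<phi>(y := t))"
    by eventually_elim (use interior_space_upd[OF assms(1,2)] assms(3) in auto)
qed

lemma has_partial_extI:
  assumes "continuous_on (state_space d N) g"
    and "\<And>\<phi>. \<phi> \<in> interior_space d N \<Longrightarrow> ((\<lambda>t. F (\<phi>(x := t))) has_real_derivative g \<phi>) (at (\<phi> x))"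
  shows "has_partial_ext d N x F"
  unfolding has_partial_ext_def
proof (intro conjI ballI exI[of _ g])
  fix \<phi> assume \<phi>: "\<phi> \<in> interior_space d N"
  show "(\<lambda>t. F (\<phi>(x := t))) differentiable (at (\<phi> x))"
    using assms(2)[OF \<phi>] real_differentiable_def by blast
  show "g \<phi> = partial x F \<phi>" unfolding partial_def by (rule DERIV_imp_deriv[OF assms(2)[OF \<phi>], symmetric])
qed fact

lemma has_partial_extE:
  assumes "has_partial_ext d N x F"
  obtains g where "continuous_on (state_space d N) g"
    "\<And>\<phi>. \<phi> \<in> interior_space d N \<Longrightarrow> ((\<lambda>t. F (\<phi>(x := t))) has_real_derivative g \<phi>) (at (\<phi> x))"
    "\<And>\<phi>. \<phi> \<in> interior_space d N \<Longrightarrow> partial x F \<phi> = g \<phi>"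
proof -
  obtain g where g: "continuous_on (state_space d N) g" "\<And>\<phi>. \<phi> \<in> interior_space d N \<Longrightarrow> g \<phi> = partial x F \<phi>"
    using assms unfolding has_partial_ext_def by blast
  show thesis
  proof (rule that[OF g(1)])
    fix \<phi> assume \<phi>: "\<phi> \<in> interior_space d N"
    show "((\<lambda>t. F (\<phi>(x := t))) has_real_derivative g \<phi>) (at (\<phi> x))"
      using assms \<phi> unfolding has_partial_ext_def g(2)[OF \<phi>] partial_def
      by (simp add: DERIV_deriv_iff_real_differentiable)
    show "partial x F \<phi> = g \<phi>" using g(2)[OF \<phi>] by simp
  qed
qed

lemma Cc2_iff:
  "F \<in> Cc2 d N \<longleftrightarrow> (\<exists>g H. C2_data d N F g H) \<and> (\<exists>R>0. supported_in d N R F)"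
proof
  assume F: "F \<in> Cc2 d N"
  then have Cc: "continuous_on (state_space d N) F" "\<exists>R>0. supported_in d N R F"
    by (auto simp: Cc2_def Cc_state_iff)
  have "\<exists>g. continuous_on (state_space d N) g \<and>
    (\<forall>\<phi>\<in>interior_space d N. ((\<lambda>t. F (\<phi>(x := t))) has_real_derivative g \<phi>) (at (\<phi> x))) \<and>
    (\<forall>\<phi>\<in>interior_space d N. partial x F \<phi> = g \<phi>)" if "x \<in> site_box d N" for x
  proof -
    have "has_partial_ext d N x F" using F that by (auto simp: Cc2_def)
    then show ?thesis by (rule has_partial_extE) blast
  qed
  then have "\<forall>x\<in>site_box d N. \<exists>g. continuous_on (state_space d N) g \<and>
    (\<forall>\<phi>\<in>interior_space d N. ((\<lambda>t. F (\<phi>(x := t))) has_real_derivative g \<phi>) (at (\<phi> x))) \<and>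
    (\<forall>\<phi>\<in>interior_space d N. partial x F \<phi> = g \<phi>)" by blast
  from bchoice[OF this] obtain g where g: "\<And>x. x \<in> site_box d N \<Longrightarrow> continuous_on (state_space d N) (g x)"
    "\<And>x \<phi>. x \<in> site_box d N \<Longrightarrow> \<phi> \<in> interior_space d N \<Longrightarrow>
        ((\<lambda>t. F (\<phi>(x := t))) has_real_derivative g x \<phi>) (at (\<phi> x))"
    "\<And>x \<phi>. x \<in> site_box d N \<Longrightarrow> \<phi> \<in> interior_space d N \<Longrightarrow> partial x F \<phi> = g x \<phi>"
    by blast
  have "\<exists>h. continuous_on (state_space d N) h \<and>
    (\<forall>\<phi>\<in>interior_space d N. ((\<lambda>t. partial x F (\<phi>(y := t))) has_real_derivative h \<phi>) (at (\<phi> y)))"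
    if "x \<in> site_box d N" "y \<in> site_box d N" for x y
  proof -
    have "has_partial_ext d N y (partial x F)" using F that by (auto simp: Cc2_def)
    then obtain h where "continuous_on (state_space d N) h"
      "\<And>\<phi>. \<phi> \<in> interior_space d N \<Longrightarrow> ((\<lambda>t. partial x F (\<phi>(y := t))) has_real_derivative h \<phi>) (at (\<phi> y))"
      by (rule has_partial_extE) blast
    then show ?thesis by blast
  qed
  note ex = this
  define H where "H x y = (SOME h. continuous_on (state_space d N) h \<and>
    (\<forall>\<phi>\<in>interior_space d N. ((\<lambda>t. partial x F (\<phi>(y := t))) has_real_derivative h \<phi>) (at (\<phi> y))))" for x y
  have H: "\<And>x y. x \<in> site_box d N \<Longrightarrow> y \<in> site_box d N \<Longrightarrow> continuous_on (state_space d N) (H x y)"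
    "\<And>x y \<phi>. x \<in> site_box d N \<Longrightarrow> y \<in> site_box d N \<Longrightarrow> \<phi> \<in> interior_space d N \<Longrightarrow>
       ((\<lambda>t. partial x F (\<phi>(y := t))) has_real_derivative H x y \<phi>) (at (\<phi> y))"
    using someI_ex[OF ex] unfolding H_def by blast+
  have "C2_data d N F g H"
    unfolding C2_data_def
  proof (intro conjI ballI)
    fix x y \<phi> assume a: "x \<in> site_box d N" "y \<in> site_box d N" "\<phi> \<in> interior_space d N"
    show "((\<lambda>t. g x (\<phi>(y := t))) has_real_derivative H x y \<phi>) (at (\<phi> y))"
      using H(2)[OF a] line_deriv_cong[of \<phi> d N y "partial x F" "g x", OF a(3,2) g(3)[OF a(1)]] by blast
  qed (use Cc g H in auto)
  with Cc show "(\<exists>g H. C2_data d N F g H) \<and> (\<exists>R>0. supported_in d N R F)" by blast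
next
  assume "(\<exists>g H. C2_data d N F g H) \<and> (\<exists>R>0. supported_in d N R F)"
  then obtain g H where D: "C2_data d N F g H" and s: "\<exists>R>0. supported_in d N R F" by blast
  have "has_partial_ext d N y (partial x F)" if "x \<in> site_box d N" "y \<in> site_box d N" for x y
  proof (rule has_partial_extI[OF C2_dataD(4)[OF D that]])
    fix \<phi> assume \<phi>: "\<phi> \<in> interior_space d N"
    show "((\<lambda>t. partial x F (\<phi>(y := t))) has_real_derivative H x y \<phi>) (at (\<phi> y))"
      using C2_dataD(5)[OF D that \<phi>] line_deriv_cong[of \<phi> d N y "partial x F" "g x", OF \<phi> that(2) C2_data_partial[OF D that(1)]] by blast
  qed
  moreover have "has_partial_ext d N x F" if "x \<in> site_box d N" for x
    by (rule has_partial_extI[OF C2_dataD(2,3)[OF D that]])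
  ultimately show "F \<in> Cc2 d N"
    using s C2_dataD(1)[OF D] by (auto simp: Cc2_def Cc_state_iff)
qed

text \<open>
  Near an interior point outside the cube the function is \<open>0\<close> along the line, so its derivative is \<open>0\<close>; boundary
  points follow by continuity.
\<close>

lemma C2_data_supported:
  assumes D: "C2_data d N F g H" and s: "supported_in d N R F" and x: "x \<in> site_box d N"
  shows "supported_in d N R (g x)"
  unfolding supported_in_def
proof (intro ballI impI)
  fix \<phi> y assume \<phi>: "\<phi> \<in> state_space d N" and y: "y \<in> site_box d N" and R: "R < \<phi> y"
  have int: "g x \<psi> = 0" if \<psi>: "\<psi> \<in> interior_space d N" and R: "R < \<psi> y" for \<psi>
  proof -
    have "\<forall>\<^sub>F t in nhds (\<psi> x). t \<in> {0<..} \<inter> {t. R < (\<psi>(x := t)) y}"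
    proof (rule eventually_nhds_in_open)
      show "open ({0<..} \<inter> {t. R < (\<psi>(x := t)) y})"
        by (cases "x = y") (auto simp: greaterThan_def[symmetric])
      show "\<psi> x \<in> {0<..} \<inter> {t. R < (\<psi>(x := t)) y}"
        using R interior_space_pos[OF \<psi> x] by (cases "y = x") auto
    qed
    then have ev: "\<forall>\<^sub>F t in nhds (\<psi> x). F (\<psi>(x := t)) = 0"
    proof eventually_elim
      case (elim t)
      then have "\<psi>(x := t) \<in> state_space d N"
        using interior_subset_state \<psi> by (intro state_space_upd x) auto
      then show ?case using s y elim by (auto simp: supported_in_def)
    qed
    have "((\<lambda>t. F (\<psi>(x := t))) has_real_derivative 0) (at (\<psi> x))"
      using DERIV_cong_ev[OF refl ev refl, of 0] by simp
    with C2_dataD(3)[OF D x \<psi>] show ?thesis by (rule DERIV_unique)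
  qed
  have "(\<lambda>n. g x (lift_interface d N \<phi> (inverse (real (Suc n))))) \<longlonglongrightarrow> g x \<phi>"
    by (rule tendsto_lift[OF C2_dataD(2)[OF D x] \<phi>])
  moreover have "g x (lift_interface d N \<phi> (inverse (real (Suc n)))) = 0" for n
  proof (rule int[OF lift_in_interior[OF \<phi>]])
    have "0 < inverse (real (Suc n))" by simp
    then show "R < lift_interface d N \<phi> (inverse (real (Suc n))) y"
      using R y unfolding lift_interface_def by (simp only: if_True)
  qed simp
  ultimately show "g x \<phi> = 0" by (simp add: LIMSEQ_const_iff)
qed

lemma C2_data_const: "C2_data d N (\<lambda>_. c) (\<lambda>_ _. 0) (\<lambda>_ _ _. 0)"
  by (simp add: C2_data_def)

lemma C2_data_coord: "C2_data d N (\<lambda>\<phi>. \<phi> z) (\<lambda>x _. if x = z then 1 else 0) (\<lambda>_ _ _. 0)"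
  unfolding C2_data_def by (auto intro!: continuous_on_coord derivative_eq_intros)

lemma C2_data_add:
  assumes "C2_data d N F g H" "C2_data d N F' g' H'"
  shows "C2_data d N (\<lambda>\<phi>. F \<phi> + F' \<phi>) (\<lambda>x \<phi>. g x \<phi> + g' x \<phi>) (\<lambda>x y \<phi>. H x y \<phi> + H' x y \<phi>)"
  using assms unfolding C2_data_def by (auto intro!: continuous_on_add DERIV_add)

lemma C2_data_mult:
  assumes D: "C2_data d N F g H" and D': "C2_data d N F' g' H'"
  shows "C2_data d N (\<lambda>\<phi>. F \<phi> * F' \<phi>) (\<lambda>x \<phi>. F \<phi> * g' x \<phi> + g x \<phi> * F' \<phi>)
     (\<lambda>x y \<phi>. (F \<phi> * H' x y \<phi> + g y \<phi> * g' x \<phi>) + (g x \<phi> * g' y \<phi> + H x y \<phi> * F' \<phi>))"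
proof -
  have m: "((\<lambda>t. f (\<phi>(y := t)) * f' (\<phi>(y := t))) has_real_derivative f \<phi> * l' + l * f' \<phi>) (at (\<phi> y))"
    if "((\<lambda>t. f (\<phi>(y := t))) has_real_derivative l) (at (\<phi> y))"
      "((\<lambda>t. f' (\<phi>(y := t))) has_real_derivative l') (at (\<phi> y))"
    for f f' l l' y and \<phi> :: interface
    using DERIV_mult[OF that] by (simp add: algebra_simps)
  show ?thesis unfolding C2_data_def
    by (intro conjI ballI continuous_on_add continuous_on_mult DERIV_add m
        C2_dataD[OF D] C2_dataD[OF D']; assumption)
qed

lemma C2_data_compose:
  assumes D: "C2_data d N F g H" and d1: "\<And>t. (\<eta> has_real_derivative \<eta>' t) (at t)"
    and d2: "\<And>t. (\<eta>' has_real_derivative \<eta>'' t) (at t)" and c: "continuous_on UNIV \<eta>''"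
  shows "C2_data d N (\<lambda>\<phi>. \<eta> (F \<phi>)) (\<lambda>x \<phi>. \<eta>' (F \<phi>) * g x \<phi>)
     (\<lambda>x y \<phi>. \<eta>' (F \<phi>) * H x y \<phi> + (\<eta>'' (F \<phi>) * g y \<phi>) * g x \<phi>)"
proof -
  have c1: "continuous_on UNIV \<eta>" "continuous_on UNIV \<eta>'"
    using d1 d2 DERIV_continuous_on by blast+
  have cc: "continuous_on (state_space d N) (\<lambda>\<phi>. h (F \<phi>))" if "continuous_on UNIV h" for h :: "real \<Rightarrow> real"
    by (rule continuous_on_compose2[OF that C2_dataD(1)[OF D]]) simp
  have ch: "((\<lambda>t. h (F (\<phi>(y := t)))) has_real_derivative h' (F \<phi>) * g y \<phi>) (at (\<phi> y))"
    if "\<And>t. (h has_real_derivative h' t) (at t)" "y \<in> site_box d N" "\<phi> \<in> interior_space d N" for h h' y \<phi>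
    using DERIV_chain2[of h "h' (F \<phi>)" "\<lambda>t. F (\<phi>(y := t))" "\<phi> y", OF _ C2_dataD(3)[OF D that(2,3)]] that(1)
    by simp
  have m: "((\<lambda>t. f (\<phi>(y := t)) * f' (\<phi>(y := t))) has_real_derivative f \<phi> * l' + l * f' \<phi>) (at (\<phi> y))"
    if "((\<lambda>t. f (\<phi>(y := t))) has_real_derivative l) (at (\<phi> y))"
      "((\<lambda>t. f' (\<phi>(y := t))) has_real_derivative l') (at (\<phi> y))"
    for f f' l l' y and \<phi> :: interface
    using DERIV_mult[OF that] by (simp add: algebra_simps)
  show ?thesis unfolding C2_data_def
  proof (intro conjI ballI)
    fix x y \<phi> assume a: "x \<in> site_box d N" "y \<in> site_box d N" "\<phi> \<in> interior_space d N"
    show "((\<lambda>t. \<eta>' (F (\<phi>(y := t))) * g x (\<phi>(y := t))) has_real_derivative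
         \<eta>' (F \<phi>) * H x y \<phi> + \<eta>'' (F \<phi>) * g y \<phi> * g x \<phi>) (at (\<phi> y))"
      by (rule m[of "\<lambda>\<phi>. \<eta>' (F \<phi>)", OF ch[OF d2 a(2,3)] C2_dataD(5)[OF D a]])
  qed (auto intro!: continuous_intros cc c1 c C2_dataD[OF D] ch d1)
qed

lemma C2_data_prod:
  assumes "finite A" "\<And>a. a \<in> A \<Longrightarrow> \<exists>g H. C2_data d N (F a) g H"
  shows "\<exists>g H. C2_data d N (\<lambda>\<phi>. \<Prod>a\<in>A. F a \<phi>) g H"
  using assms
proof (induction A rule: finite_induct)
  case empty
  then show ?case using C2_data_const[of d N 1] by auto
next
  case (insert a A)
  then obtain g' H' where P: "C2_data d N (\<lambda>\<phi>. \<Prod>a\<in>A. F a \<phi>) g' H'" by auto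
  obtain g H where "C2_data d N (F a) g H" using insert.prems[of a] by blast
  note this P
  from C2_data_mult[OF this] insert show ?case by auto
qed

lemma Cc2_add:
  assumes "F \<in> Cc2 d N" "G \<in> Cc2 d N"
  shows "(\<lambda>\<phi>. F \<phi> + G \<phi>) \<in> Cc2 d N"
proof -
  obtain g H g' H' where D: "C2_data d N F g H" "C2_data d N G g' H'" using assms by (auto simp: Cc2_iff)
  obtain R R' where R: "R > 0" "supported_in d N R F" "R' > 0" "supported_in d N R' G"
    using assms by (auto simp: Cc2_iff)
  have "supported_in d N (max R R') (\<lambda>\<phi>. F \<phi> + G \<phi>)"
    using supported_in_mono[OF R(2), of "max R R'"] supported_in_mono[OF R(4), of "max R R'"]
    by (auto simp: supported_in_def)
  then show ?thesis using C2_data_add[OF D] R by (auto simp: Cc2_iff intro!: exI[of _ "max R R'"])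
qed

lemma Cc2_mult_left:
  assumes "C2_data d N G g' H'" "F \<in> Cc2 d N"
  shows "(\<lambda>\<phi>. G \<phi> * F \<phi>) \<in> Cc2 d N"
proof -
  obtain g H R where D: "C2_data d N F g H" and R: "R > 0" "supported_in d N R F"
    using assms by (auto simp: Cc2_iff)
  have "supported_in d N R (\<lambda>\<phi>. G \<phi> * F \<phi>)" using R by (simp add: supported_in_def)
  then show ?thesis using C2_data_mult[OF assms(1) D] R by (auto simp: Cc2_iff)
qed

lemma Cc2_mult: "F \<in> Cc2 d N \<Longrightarrow> G \<in> Cc2 d N \<Longrightarrow> (\<lambda>\<phi>. F \<phi> * G \<phi>) \<in> Cc2 d N"
  using Cc2_mult_left Cc2_iff by blast

lemma Cc2_scale: "F \<in> Cc2 d N \<Longrightarrow> (\<lambda>\<phi>. c * F \<phi>) \<in> Cc2 d N"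
  by (rule Cc2_mult_left[OF C2_data_const])

lemma Cc2_compose:
  assumes "F \<in> Cc2 d N" "\<eta> 0 = 0" "\<And>t. (\<eta> has_real_derivative \<eta>' t) (at t)"
    "\<And>t. (\<eta>' has_real_derivative \<eta>'' t) (at t)" "continuous_on UNIV \<eta>''"
  shows "(\<lambda>\<phi>. \<eta> (F \<phi>)) \<in> Cc2 d N"
proof -
  obtain g H R where D: "C2_data d N F g H" and R: "R > 0" "supported_in d N R F"
    using assms by (auto simp: Cc2_iff)
  have "supported_in d N R (\<lambda>\<phi>. \<eta> (F \<phi>))" using R assms(2) by (simp add: supported_in_def)
  then show ?thesis using C2_data_compose[OF D assms(3-5)] R by (auto simp: Cc2_iff)
qed

lemma DERIV_pos_part_power:
  "((\<lambda>t::real. max 0 t ^ (Suc (Suc k))) has_real_derivative (real (Suc (Suc k)) * max 0 t ^ Suc k)) (at t)"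
proof -
  consider "t < 0" | "t > 0" | "t = 0" by linarith
  then show ?thesis
  proof cases
    case 1
    have ev: "\<forall>\<^sub>F x in nhds t. max 0 x ^ Suc (Suc k) = 0"
      using eventually_nhds_in_open[of "{..<0}" t] 1 by (auto elim!: eventually_mono)
    show ?thesis using DERIV_cong_ev[OF refl ev refl, of 0] 1 by simp
  next
    case 2
    have ev: "\<forall>\<^sub>F x in nhds t. max 0 x ^ Suc (Suc k) = x ^ Suc (Suc k)"
      using eventually_nhds_in_open[of "{0<..}" t] 2 by (auto elim!: eventually_mono)
    have "((\<lambda>x. x ^ Suc (Suc k)) has_real_derivative real (Suc (Suc k)) * t ^ Suc k) (at t)"
      using DERIV_pow[of "Suc (Suc k)" t] by simp
    then show ?thesis using DERIV_cong_ev[OF refl ev refl] 2 by simp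
  next
    case 3
    have "(\<lambda>h::real. max 0 h ^ Suc (Suc k) / h) \<midarrow>0\<rightarrow> 0"
    proof (rule Lim_transform_eventually)
      have "((\<lambda>h::real. max 0 h ^ Suc k) \<longlongrightarrow> max 0 0 ^ Suc k) (at 0)" by (intro tendsto_intros)
      then show "((\<lambda>h::real. max 0 h ^ Suc k) \<longlongrightarrow> 0) (at 0)" by simp
      show "\<forall>\<^sub>F h::real in at 0. max 0 h ^ Suc k = max 0 h ^ Suc (Suc k) / h"
        by (auto simp: eventually_at max_def intro!: exI[of _ 1])
    qed
    then show ?thesis using 3 by (simp add: DERIV_def)
  qed
qed

text \<open>The cube of the positive part is the simplest \<open>C\<^sup>2\<close> function vanishing exactly on a half line.\<close>

lemma C2_data_pos_part_cube:
  assumes "C2_data d N F g H"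
  shows "C2_data d N (\<lambda>\<phi>. max 0 (F \<phi>) ^ 3) (\<lambda>x \<phi>. (3 * max 0 (F \<phi>) ^ 2) * g x \<phi>)
     (\<lambda>x y \<phi>. (3 * max 0 (F \<phi>) ^ 2) * H x y \<phi> + ((6 * max 0 (F \<phi>)) * g y \<phi>) * g x \<phi>)"
proof (rule C2_data_compose[OF assms])
  show "((\<lambda>t. max 0 t ^ 3) has_real_derivative 3 * (max 0 t)\<^sup>2) (at t)" for t :: real
    using DERIV_pos_part_power[of 1 t] by (simp add: numeral_eq_Suc)
  have "((\<lambda>t. max 0 t ^ 2) has_real_derivative 2 * (max 0 t)) (at t)" for t :: real
    using DERIV_pos_part_power[of 0 t] by (simp add: numeral_eq_Suc)
  from DERIV_cmult[OF this, of 3]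
  show "((\<lambda>t. 3 * max 0 t ^ 2) has_real_derivative 6 * (max 0 t)) (at t)" for t :: real
    by simp
  show "continuous_on UNIV (\<lambda>t::real. 6 * max 0 t)" by (intro continuous_intros)
qed

section \<open>Transfer to sequence space\<close>

lemma ex_enumeration:
  assumes "finite A"
  obtains h :: "'i \<Rightarrow> nat" and e n where "\<And>i. i \<in> A \<Longrightarrow> h i < n" "\<And>i. i \<in> A \<Longrightarrow> e (h i) = i"
    "\<And>k. k < n \<Longrightarrow> e k \<in> A" "\<And>k. k < n \<Longrightarrow> h (e k) = k"
proof -
  obtain h where h: "bij_betw h A {0..<card A}" using ex_bij_betw_finite_nat[OF assms] by blast
  show thesis
    by (rule that[of h "card A" "inv_into A h"])
       (use h bij_betwE[OF h] bij_betwE[OF bij_betw_inv_into[OF h]] in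
        \<open>auto simp: bij_betw_inv_into_left bij_betw_inv_into_right\<close>)
qed

definition unindex :: "'i set \<Rightarrow> ('i \<Rightarrow> nat) \<Rightarrow> (nat \<Rightarrow> real) \<Rightarrow> 'i \<Rightarrow> real" where
  "unindex A h \<psi> = (\<lambda>i\<in>A. \<psi> (h i))"

lemma continuous_on_unindex: "continuous_on S (unindex A h)"
proof (rule continuous_on_coordinatewise_then_product)
  show "continuous_on S (\<lambda>\<psi>. unindex A h \<psi> i)" for i
    by (cases "i \<in> A")
       (auto simp: unindex_def intro: continuous_on_subset[OF continuous_on_product_coordinates])
qed

lemma unindex_index:
  assumes "\<phi> \<in> PiE A X" "\<And>i. i \<in> A \<Longrightarrow> h i < n" "\<And>i. i \<in> A \<Longrightarrow> e (h i) = i"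
  shows "unindex A h (\<lambda>k. if k < n then \<phi> (e k) else c) = \<phi>"
proof
  fix i
  show "unindex A h (\<lambda>k. if k < n then \<phi> (e k) else c) i = \<phi> i"
  proof (cases "i \<in> A")
    case True
    then show ?thesis using assms(2,3)[OF True] by (simp add: unindex_def)
  next
    case False
    then show ?thesis using PiE_arb[OF assms(1) False] by (simp add: unindex_def)
  qed
qed

lemma borel_measurable_PiM_coord:
  assumes "i \<in> A" "(\<lambda>t. t) \<in> borel_measurable (M i)"
  shows "(\<lambda>\<phi>. \<phi> i) \<in> borel_measurable (PiM A M)"
  using measurable_compose[of "\<lambda>\<phi>. \<phi> i" "PiM A M" "M i" "\<lambda>t. t" borel] assms
    measurable_component_singleton[OF assms(1), of M] by simp

text \<open>
  The Borel sets of the full function space are too many for the product \<open>\<sigma>\<close>-algebra when the index type is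
  uncountable. On \<open>nat \<Rightarrow> real\<close> the two agree, and \<open>f\<close> factors through it.
\<close>

lemma borel_measurable_continuous_PiE:
  fixes f :: "('i \<Rightarrow> real) \<Rightarrow> real"
  assumes fin: "finite A" and c: "continuous_on (PiE A X) f"
    and M: "\<And>i. i \<in> A \<Longrightarrow> sets (M i) = sets (restrict_space borel (X i))"
  shows "f \<in> borel_measurable (PiM A M)"
proof -
  obtain h :: "'i \<Rightarrow> nat" and e n where h: "\<And>i. i \<in> A \<Longrightarrow> h i < n" "\<And>i. i \<in> A \<Longrightarrow> e (h i) = i"
    "\<And>k. k < n \<Longrightarrow> e k \<in> A" "\<And>k. k < n \<Longrightarrow> h (e k) = k" by (rule ex_enumeration[OF fin], rule that)
  define T where "T = {\<psi>. \<forall>i\<in>A. \<psi> (h i) \<in> X i}"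
  define \<Psi> where "\<Psi> \<phi> = (\<lambda>k. if k < n then \<phi> (e k) else (0::real))" for \<phi>
  have sp: "space (M i) = X i" if "i \<in> A" for i
    using sets_eq_imp_space_eq[OF M[OF that]] by (simp add: space_restrict_space)
  have spP: "space (PiM A M) = PiE A X" by (auto simp: space_PiM sp intro!: PiE_cong)
  have "continuous_on T (\<lambda>\<psi>. f (unindex A h \<psi>))"
    by (rule continuous_on_compose2[OF c continuous_on_unindex]) (auto simp: T_def unindex_def)
  then have m1: "(\<lambda>\<psi>. f (unindex A h \<psi>)) \<in> borel_measurable (restrict_space borel T)"
    by (rule borel_measurable_continuous_on_restrict)
  have m2: "\<Psi> \<in> measurable (PiM A M) (restrict_space borel T)"
  proof (rule measurable_restrict_space2)
    show "\<Psi> \<in> space (PiM A M) \<rightarrow> T" using h spP by (auto simp: T_def \<Psi>_def)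
    show "\<Psi> \<in> borel_measurable (PiM A M)"
    proof (rule measurable_coordinatewise_then_product)
      fix k
      show "(\<lambda>\<phi>. \<Psi> \<phi> k) \<in> borel_measurable (PiM A M)"
      proof (cases "k < n")
        case True
        have "(\<lambda>t. t) \<in> borel_measurable (M (e k))"
          unfolding measurable_cong_sets[OF M[OF h(3)[OF True]] refl]
          by (rule measurable_restrict_space1) simp
        from borel_measurable_PiM_coord[of "e k" A M, OF h(3)[OF True] this]
        show ?thesis using True by (simp add: \<Psi>_def)
      qed (simp add: \<Psi>_def)
    qed
  qed
  have "(\<lambda>\<phi>. f (unindex A h (\<Psi> \<phi>))) \<in> borel_measurable (PiM A M)"
    by (rule measurable_compose[OF m2 m1])
  moreover have "f (unindex A h (\<Psi> \<phi>)) = f \<phi>" if "\<phi> \<in> space (PiM A M)" for \<phi>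
    using unindex_index[of \<phi> A X h n e 0] that spP h by (simp add: \<Psi>_def)
  ultimately show ?thesis by (simp cong: measurable_cong)
qed

text \<open>
  The set is a continuous image of a subset of the second countable space \<open>nat \<Rightarrow> real\<close>.
\<close>

lemma Lindelof_PiE:
  fixes X :: "'i \<Rightarrow> real set"
  assumes fin: "finite A" and op: "\<And>U. U \<in> \<F> \<Longrightarrow> openin (top_of_set (PiE A X)) U"
  obtains \<F>' where "\<F>' \<subseteq> \<F>" "countable \<F>'" "\<Union>\<F>' = \<Union>\<F>"
proof -
  obtain h :: "'i \<Rightarrow> nat" and e n where h: "\<And>i. i \<in> A \<Longrightarrow> h i < n" "\<And>i. i \<in> A \<Longrightarrow> e (h i) = i"
    "\<And>k. k < n \<Longrightarrow> e k \<in> A" "\<And>k. k < n \<Longrightarrow> h (e k) = k" by (rule ex_enumeration[OF fin], rule that)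
  define T where "T = {\<psi>. \<forall>i\<in>A. \<psi> (h i) \<in> X i}"
  have "openin (top_of_set T) (T \<inter> unindex A h -` U)" if "U \<in> \<F>" for U
    by (rule continuous_openin_preimage[OF continuous_on_unindex _ op[OF that]])
       (auto simp: T_def unindex_def)
  then have "openin (top_of_set T) W" if "W \<in> (\<lambda>U. T \<inter> unindex A h -` U) ` \<F>" for W
    using that by blast
  from Lindelof_openin[of "(\<lambda>U. T \<inter> unindex A h -` U) ` \<F>", OF this]
  obtain \<G> where \<G>: "\<G> \<subseteq> (\<lambda>U. T \<inter> unindex A h -` U) ` \<F>" "countable \<G>"
    "\<Union>\<G> = \<Union>((\<lambda>U. T \<inter> unindex A h -` U) ` \<F>)" by blast
  then obtain \<F>' where F': "countable \<F>'" "\<F>' \<subseteq> \<F>" "\<G> = (\<lambda>U. T \<inter> unindex A h -` U) ` \<F>'"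
    using countable_subset_image[of \<G> "\<lambda>U. T \<inter> unindex A h -` U" \<F>] by blast
  have "\<phi> \<in> \<Union>\<F>'" if "U \<in> \<F>" "\<phi> \<in> U" for \<phi> U
  proof -
    define \<psi> where "\<psi> = (\<lambda>k. if k < n then \<phi> (e k) else 0)"
    have \<phi>: "\<phi> \<in> PiE A X" using openin_imp_subset[OF op[OF that(1)]] that(2) by auto
    have "unindex A h \<psi> = \<phi>" unfolding \<psi>_def by (rule unindex_index[OF \<phi> h(1,2)])
    moreover have "\<psi> \<in> T" using h \<phi> by (auto simp: T_def \<psi>_def)
    ultimately have "\<psi> \<in> \<Union>\<G>" using that unfolding \<G>(3) by auto
    then show ?thesis using F'(3) \<open>unindex A h \<psi> = \<phi>\<close> by auto
  qed
  then have "\<Union>\<F>' = \<Union>\<F>" using F'(2) by blast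
  then show thesis by (rule that[OF F'(2,1)])
qed

text \<open>
  The complement of the essential support is a union of null-open sets, possibly uncountable, which by the
  Lindelof property may be replaced by a countable one.
\<close>

lemma AE_zero_off_ess_support:
  fixes X :: "'i \<Rightarrow> real set" and M :: "('i \<Rightarrow> real) measure"
  assumes fin: "finite A" and sp: "space M = PiE A X"
  shows "AE p in M. p \<notin> ess_support M u \<longrightarrow> u p = 0"
proof -
  define \<F> where "\<F> = {U. openin (top_of_set (space M)) U \<and> (AE p in M. p \<in> U \<longrightarrow> u p = 0)}"
  have "openin (top_of_set (PiE A X)) U" if "U \<in> \<F>" for U using that by (simp add: \<F>_def sp)
  then obtain \<F>' where F': "\<F>' \<subseteq> \<F>" "countable \<F>'" "\<Union>\<F>' = \<Union>\<F>"
    by (rule Lindelof_PiE[OF fin])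
  have "AE p in M. \<forall>U\<in>\<F>'. p \<in> U \<longrightarrow> u p = 0"
    using F' by (subst AE_ball_countable) (auto simp: \<F>_def)
  then show ?thesis
  proof (rule AE_mp, intro AE_I2 impI)
    fix p assume p: "p \<in> space M" "\<forall>U\<in>\<F>'. p \<in> U \<longrightarrow> u p = 0" "p \<notin> ess_support M u"
    then have "p \<in> \<Union>\<F>" by (auto simp: ess_support_def \<F>_def)
    then show "u p = 0" using F'(3) p(2) by blast
  qed
qed

section \<open>Test functions\<close>

text \<open>
  The theorem is applied on a cube in \<open>nat \<Rightarrow> real\<close>, to the algebra of functions that come from \<open>C\<^sup>2\<close> functions
  of the interface; the coordinates separate points.
\<close>

lemma C2_data_stone_weierstrass:
  assumes f: "continuous_on (state_cube d N R) f" and e: "e > 0"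
  obtains G g H where "C2_data d N G g H" "\<And>\<phi>. \<phi> \<in> state_cube d N R \<Longrightarrow> \<bar>f \<phi> - G \<phi>\<bar> < e"
proof -
  obtain h :: "site \<Rightarrow> nat" and k n where h: "\<And>i. i \<in> site_box d N \<Longrightarrow> h i < n" "\<And>i. i \<in> site_box d N \<Longrightarrow> k (h i) = i"
    "\<And>j. j < n \<Longrightarrow> k j \<in> site_box d N" "\<And>j. j < n \<Longrightarrow> h (k j) = j"
    by (rule ex_enumeration[OF finite_site_box], rule that)
  define S where "S = PiE {..<n} (\<lambda>_. {0..R})"
  let ?\<Phi> = "unindex (site_box d N) h"
  define P where "P r \<longleftrightarrow> (\<exists>G g H. C2_data d N G g H \<and> r = (\<lambda>\<psi>. G (?\<Phi> \<psi>)))" for r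
  have \<Phi>S: "?\<Phi> ` S \<subseteq> state_cube d N R"
    using h(1) by (force simp: S_def state_cube_def unindex_def PiE_def Pi_def)
  have sub: "?\<Phi> ` S \<subseteq> state_space d N" using \<Phi>S state_cube_subset by blast
  have cont: "continuous_on S (\<lambda>\<psi>. F (?\<Phi> \<psi>))" if "continuous_on (state_cube d N R) F" for F :: "interface \<Rightarrow> real"
    by (rule continuous_on_compose2[OF that continuous_on_unindex \<Phi>S])
  have "\<exists>r. P r \<and> (\<forall>\<psi>\<in>S. \<bar>f (?\<Phi> \<psi>) - r \<psi>\<bar> < e)"
  proof (rule Stone_Weierstrass_HOL)
    show "compact S" unfolding S_def by (rule compact_cube) simp
    show "P (\<lambda>_. c)" for c unfolding P_def using C2_data_const[of d N c] by blast
    show "continuous_on S r" if "P r" for r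
      using that cont continuous_on_subset[OF C2_dataD(1) state_cube_subset] unfolding P_def by blast
    show "P (\<lambda>x. r x + q x)" if "P r \<and> P q" for r q
      using that C2_data_add unfolding P_def by fast
    show "P (\<lambda>x. r x * q x)" if "P r \<and> P q" for r q
      using that C2_data_mult unfolding P_def by fast
    show "\<exists>r. P r \<and> r \<psi> \<noteq> r \<psi>'" if "\<psi> \<in> S \<and> \<psi>' \<in> S \<and> \<psi> \<noteq> \<psi>'" for \<psi> \<psi>'
    proof -
      have "\<exists>j<n. \<psi> j \<noteq> \<psi>' j"
      proof (rule ccontr)
        assume "\<not> ?thesis"
        then have "\<psi> = \<psi>'"
          using that by (intro PiE_ext[of \<psi> "{..<n}" "\<lambda>_. {0..R}" \<psi>']) (auto simp: S_def)
        with that show False by simp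
      qed
      then obtain j where j: "j < n" "\<psi> j \<noteq> \<psi>' j" by blast
      have "P (\<lambda>\<psi>. ?\<Phi> \<psi> (k j))" unfolding P_def using C2_data_coord[of d N "k j"] by blast
      then show ?thesis using j h by (intro exI[of _ "\<lambda>\<psi>. ?\<Phi> \<psi> (k j)"]) (simp add: unindex_def)
    qed
    show "continuous_on S (\<lambda>\<psi>. f (?\<Phi> \<psi>))" by (rule cont[OF f])
  qed fact
  then obtain G g H where G: "C2_data d N G g H" "\<And>\<psi>. \<psi> \<in> S \<Longrightarrow> \<bar>f (?\<Phi> \<psi>) - G (?\<Phi> \<psi>)\<bar> < e"
    unfolding P_def by blast
  have "\<bar>f \<phi> - G \<phi>\<bar> < e" if \<phi>: "\<phi> \<in> state_cube d N R" for \<phi>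
  proof -
    define \<psi> where "\<psi> = (\<lambda>j. if j < n then \<phi> (k j) else undefined)"
    have "?\<Phi> \<psi> = \<phi>"
      unfolding \<psi>_def by (rule unindex_index[OF \<phi>[unfolded state_cube_def] h(1,2)])
    moreover have "\<psi> \<in> S" using h \<phi> by (auto simp: S_def \<psi>_def state_cube_def PiE_def extensional_def)
    ultimately show ?thesis using G(2)[of \<psi>] by simp
  qed
  then show thesis by (rule that[OF G(1)])
qed

text \<open>
  A \<open>C\<^sup>2\<close> function with values in \<open>[0, 1]\<close>, positive exactly on the open ball of radius \<open>R > 0\<close>.
\<close>

definition cutoff :: "nat \<Rightarrow> nat \<Rightarrow> real \<Rightarrow> interface \<Rightarrow> real" where
  "cutoff d N R \<phi> = max 0 (1 - (\<Sum>x\<in>site_box d N. (\<phi> x)\<^sup>2) / R\<^sup>2) ^ 3"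

definition cutoff_grad :: "nat \<Rightarrow> nat \<Rightarrow> real \<Rightarrow> site \<Rightarrow> interface \<Rightarrow> real" where
  "cutoff_grad d N R x \<phi> =
     (3 * max 0 (1 - (\<Sum>x\<in>site_box d N. (\<phi> x)\<^sup>2) / R\<^sup>2) ^ 2) * ((- 1 / R\<^sup>2) * (2 * \<phi> x))"

lemma C2_data_square_sum:
  "C2_data d N (\<lambda>\<phi>. \<Sum>z\<in>site_box d N. (\<phi> z)\<^sup>2) (\<lambda>x \<phi>. 2 * \<phi> x) (\<lambda>x y \<phi>. if x = y then 2 else 0)"
  unfolding C2_data_def
proof (intro conjI ballI)
  show "continuous_on (state_space d N) (\<lambda>\<phi>. \<Sum>z\<in>site_box d N. (\<phi> z)\<^sup>2)"
    by (intro continuous_intros continuous_on_coord)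
  show "continuous_on (state_space d N) (\<lambda>\<phi>. 2 * \<phi> x)" for x
    by (intro continuous_intros continuous_on_coord)
  fix x y and \<phi> :: interface assume x: "x \<in> site_box d N"
  have "((\<lambda>t. \<Sum>z\<in>site_box d N. ((\<phi>(x := t)) z)\<^sup>2) has_real_derivative
      (\<Sum>z\<in>site_box d N. if z = x then 2 * \<phi> x else 0)) (at (\<phi> x))"
  proof (rule DERIV_sum)
    show "((\<lambda>t. ((\<phi>(x := t)) z)\<^sup>2) has_real_derivative (if z = x then 2 * \<phi> x else 0)) (at (\<phi> x))" for z
      by (cases "z = x") (auto intro!: derivative_eq_intros)
  qed
  then show "((\<lambda>t. \<Sum>z\<in>site_box d N. ((\<phi>(x := t)) z)\<^sup>2) has_real_derivative 2 * \<phi> x) (at (\<phi> x))"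
    using x by (simp add: finite_site_box)
  show "((\<lambda>t. 2 * (\<phi>(y := t)) x) has_real_derivative (if x = y then 2 else 0)) (at (\<phi> y))"
    by (cases "x = y") (auto intro!: derivative_eq_intros)
qed auto

lemma C2_data_cutoff: "\<exists>H. C2_data d N (cutoff d N R) (cutoff_grad d N R) H"
proof -
  define c where "c = - 1 / R\<^sup>2"
  have "C2_data d N (\<lambda>\<phi>. 1 + c * (\<Sum>z\<in>site_box d N. (\<phi> z)\<^sup>2)) (\<lambda>x \<phi>. c * (2 * \<phi> x))
      (\<lambda>x y \<phi>. c * (if x = y then 2 else 0) + (0 * (2 * \<phi> y)) * (2 * \<phi> x))"
    by (rule C2_data_compose[OF C2_data_square_sum, where \<eta>="\<lambda>t. 1 + c * t" and \<eta>'="\<lambda>_. c" and \<eta>''="\<lambda>_. 0"])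
       (auto intro!: derivative_eq_intros)
  moreover have "1 + c * q = 1 - q / R\<^sup>2" for q by (simp add: c_def)
  ultimately have "C2_data d N (\<lambda>\<phi>. 1 - (\<Sum>z\<in>site_box d N. (\<phi> z)\<^sup>2) / R\<^sup>2) (\<lambda>x \<phi>. c * (2 * \<phi> x))
      (\<lambda>x y \<phi>. c * (if x = y then 2 else 0) + (0 * (2 * \<phi> y)) * (2 * \<phi> x))"
    by simp
  from C2_data_pos_part_cube[OF this] show ?thesis
    unfolding cutoff_def[abs_def] cutoff_grad_def[abs_def] c_def by blast
qed

lemma square_le_square_sum: "x \<in> site_box d N \<Longrightarrow> (\<phi> x)\<^sup>2 \<le> (\<Sum>z\<in>site_box d N. ((\<phi> z)\<^sup>2 :: real))"
  by (rule member_le_sum) (auto simp: finite_site_box)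

lemma cutoff_supported:
  assumes "R > 0"
  shows "supported_in d N R (cutoff d N R)"
  unfolding supported_in_def
proof (intro ballI impI)
  fix \<phi> x assume x: "x \<in> site_box d N" "R < \<phi> x"
  have "R\<^sup>2 \<le> (\<phi> x)\<^sup>2" using x assms by (intro power_mono) auto
  also note square_le_square_sum[OF x(1)]
  finally show "cutoff d N R \<phi> = 0" using assms by (simp add: cutoff_def field_simps max_def)
qed

lemma cutoff_Cc2: "R > 0 \<Longrightarrow> cutoff d N R \<in> Cc2 d N"
  unfolding Cc2_iff using C2_data_cutoff[of d N R] cutoff_supported[of R d N] by blast

lemma cutoff_bounds: "0 \<le> cutoff d N R \<phi>" "cutoff d N R \<phi> \<le> 1"
proof -
  have "0 \<le> (\<Sum>x\<in>site_box d N. (\<phi> x)\<^sup>2) / R\<^sup>2" by (intro divide_nonneg_nonneg sum_nonneg) auto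
  then show "cutoff d N R \<phi> \<le> 1" unfolding cutoff_def by (intro power_le_one) auto
qed (simp add: cutoff_def)

lemma cutoff_grad_bound:
  assumes R: "R > 0" and x: "x \<in> site_box d N"
  shows "\<bar>cutoff_grad d N R x \<phi>\<bar> \<le> 6 / R"
proof (cases "(\<Sum>x\<in>site_box d N. (\<phi> x)\<^sup>2) \<le> R\<^sup>2")
  case True
  define m where "m = max 0 (1 - (\<Sum>x\<in>site_box d N. (\<phi> x)\<^sup>2) / R\<^sup>2)"
  have "0 \<le> (\<Sum>x\<in>site_box d N. (\<phi> x)\<^sup>2) / R\<^sup>2" by (intro divide_nonneg_nonneg sum_nonneg) auto
  then have m: "0 \<le> m" "m \<le> 1" by (auto simp: m_def)
  have "m\<^sup>2 \<le> 1" using m by (intro power_le_one) auto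
  have "(\<phi> x)\<^sup>2 \<le> R\<^sup>2" using square_le_square_sum[OF x, of \<phi>] True by linarith
  then have "\<bar>\<phi> x\<bar> \<le> R" using R by (simp add: abs_le_square_iff[symmetric])
  have "\<bar>cutoff_grad d N R x \<phi>\<bar> = (3 * m\<^sup>2) * ((1 / R\<^sup>2) * (2 * \<bar>\<phi> x\<bar>))"
    using R by (simp add: cutoff_grad_def m_def[symmetric] abs_mult)
  also have "\<dots> \<le> (3 * 1) * ((1 / R\<^sup>2) * (2 * R))"
    by (intro mult_mono) (use \<open>m\<^sup>2 \<le> 1\<close> \<open>\<bar>\<phi> x\<bar> \<le> R\<close> R in auto)
  also have "\<dots> = 6 / R" using R by (simp add: power2_eq_square)
  finally show ?thesis .
next
  case False
  then have "1 - (\<Sum>x\<in>site_box d N. (\<phi> x)\<^sup>2) / R\<^sup>2 \<le> 0" using R by (simp add: field_simps)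
  then show ?thesis using R by (simp add: cutoff_grad_def)
qed

text \<open>
  Dividing by a smooth cutoff before approximating, and multiplying by it afterwards, turns
  Stone-Weierstrass on a cube into uniform density among compactly supported functions.
\<close>

lemma Cc2_uniformly_dense:
  assumes f: "f \<in> Cc (state_space d N)" and e: "e > 0"
  shows "\<exists>g\<in>Cc2 d N. \<forall>\<phi>\<in>state_space d N. \<bar>f \<phi> - g \<phi>\<bar> < e"
proof -
  obtain R0 where R0: "R0 > 0" "supported_in d N R0 f" and fc: "continuous_on (state_space d N) f"
    using f by (auto simp: Cc_state_iff)
  define K where "K = real (card (site_box d N)) + 1"
  have K: "K \<ge> 1" by (simp add: K_def)
  define R where "R = R0 * K"
  have R: "R > 0" using R0 K by (simp add: R_def)
  define \<delta> where "\<delta> = (1 - (K - 1) / K\<^sup>2) ^ 3"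
  have K1: "(K - 1) / K\<^sup>2 < 1"
  proof -
    have "1 * K \<le> K * K" by (rule mult_right_mono) (use K in auto)
    then have "K - 1 < K * K" by linarith
    then show ?thesis using K by (simp add: divide_less_eq power2_eq_square)
  qed
  have \<delta>: "\<delta> > 0" using K1 by (simp add: \<delta>_def)
  have low: "\<delta> \<le> cutoff d N R \<phi>" if "\<phi> \<in> state_cube d N R0" for \<phi>
  proof -
    have "(\<Sum>x\<in>site_box d N. (\<phi> x)\<^sup>2) \<le> (\<Sum>x\<in>site_box d N. R0\<^sup>2)"
      using that by (intro sum_mono power_mono) (auto simp: state_cube_def PiE_def Pi_def)
    also have "\<dots> = (K - 1) * R0\<^sup>2" by (simp add: K_def)
    finally have "(\<Sum>x\<in>site_box d N. (\<phi> x)\<^sup>2) / R\<^sup>2 \<le> (K - 1) * R0\<^sup>2 / R\<^sup>2" by (intro divide_right_mono) auto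
    also have "\<dots> = (K - 1) / K\<^sup>2" using R0 by (simp add: R_def power_mult_distrib)
    finally show ?thesis unfolding \<delta>_def cutoff_def using K1 by (intro power_mono) auto
  qed
  have cc: "continuous_on (state_space d N) (cutoff d N R)"
    using C2_data_cutoff[of d N R] C2_dataD(1) by blast
  define q where "q \<phi> = f \<phi> / max (cutoff d N R \<phi>) \<delta>" for \<phi>
  have "continuous_on (state_cube d N R) q"
    unfolding q_def using \<delta>
    by (intro continuous_on_subset[OF _ state_cube_subset] continuous_intros fc cc) (auto simp: max_def)
  from C2_data_stone_weierstrass[OF this e] obtain G g H where
    G: "C2_data d N G g H" and Ge: "\<And>\<phi>. \<phi> \<in> state_cube d N R \<Longrightarrow> \<bar>q \<phi> - G \<phi>\<bar> < e" by blast
  have q: "f \<phi> = q \<phi> * cutoff d N R \<phi>" if \<phi>: "\<phi> \<in> state_space d N" for \<phi>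
  proof (cases "\<phi> \<in> state_cube d N R0")
    case True
    then show ?thesis using low[OF True] \<delta> by (simp add: q_def max_def)
  next
    case False
    then have "f \<phi> = 0" using supported_inD[OF R0(2)] \<phi> by blast
    then show ?thesis by (simp add: q_def)
  qed
  have "\<bar>f \<phi> - G \<phi> * cutoff d N R \<phi>\<bar> < e" if \<phi>: "\<phi> \<in> state_space d N" for \<phi>
  proof (cases "\<phi> \<in> state_cube d N R")
    case True
    have "f \<phi> - G \<phi> * cutoff d N R \<phi> = (q \<phi> - G \<phi>) * cutoff d N R \<phi>"
      using q[OF \<phi>] by (simp add: left_diff_distrib)
    then have "\<bar>f \<phi> - G \<phi> * cutoff d N R \<phi>\<bar> = \<bar>q \<phi> - G \<phi>\<bar> * cutoff d N R \<phi>"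
      using cutoff_bounds by (simp add: abs_mult)
    also have "\<dots> \<le> \<bar>q \<phi> - G \<phi>\<bar> * 1" by (intro mult_left_mono cutoff_bounds) auto
    finally show ?thesis using Ge[OF True] by simp
  next
    case False
    then have "cutoff d N R \<phi> = 0" using supported_inD[OF cutoff_supported[OF R]] \<phi> by blast
    then show ?thesis using q[OF \<phi>] e by simp
  qed
  then have "\<forall>\<phi>\<in>state_space d N. \<bar>f \<phi> - G \<phi> * cutoff d N R \<phi>\<bar> < e" by (rule ballI)
  then show ?thesis by (rule bexI[OF _ Cc2_mult_left[OF G cutoff_Cc2[OF R]]])
qed

text \<open>
  The indicator of an open box is the increasing limit of \<open>1 - exp (- n P)\<close>, where \<open>P\<close> is a \<open>C\<^sup>2\<close>
  function that is positive exactly on the box.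
\<close>

definition box_bump :: "nat \<Rightarrow> nat \<Rightarrow> (site \<Rightarrow> real) \<Rightarrow> (site \<Rightarrow> real) \<Rightarrow> interface \<Rightarrow> real" where
  "box_bump d N a b \<phi> = (\<Prod>x\<in>site_box d N. max 0 (\<phi> x - a x) ^ 3 * max 0 (b x - \<phi> x) ^ 3)"

lemma box_bump_nonneg: "0 \<le> box_bump d N a b \<phi>"
  unfolding box_bump_def by (intro prod_nonneg ballI mult_nonneg_nonneg zero_le_power) auto

lemma box_bump_pos_iff: "0 < box_bump d N a b \<phi> \<longleftrightarrow> (\<forall>x\<in>site_box d N. a x < \<phi> x \<and> \<phi> x < b x)"
proof -
  have "box_bump d N a b \<phi> = 0 \<longleftrightarrow> (\<exists>x\<in>site_box d N. max 0 (\<phi> x - a x) ^ 3 * max 0 (b x - \<phi> x) ^ 3 = 0)"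
    unfolding box_bump_def by (simp add: finite_site_box)
  also have "\<dots> \<longleftrightarrow> (\<exists>x\<in>site_box d N. \<not> (a x < \<phi> x \<and> \<phi> x < b x))"
    by (intro bex_cong refl) (auto simp: max_def)
  finally show ?thesis using box_bump_nonneg[of d N a b \<phi>] by (auto simp: less_le)
qed

lemma box_bump_Cc2: "(\<lambda>\<phi>. 1 - exp (- (c * box_bump d N a b \<phi>))) \<in> Cc2 d N"
proof -
  have aff: "\<exists>g H. C2_data d N (\<lambda>\<phi>. m * \<phi> x + k) g H" for m k and x :: site
    using C2_data_add[OF C2_data_mult[OF C2_data_const C2_data_coord] C2_data_const] by blast
  have fac: "\<exists>g H. C2_data d N (\<lambda>\<phi>. max 0 (\<phi> x - a x) ^ 3 * max 0 (b x - \<phi> x) ^ 3) g H" for x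
  proof -
    obtain g H where 1: "C2_data d N (\<lambda>\<phi>. 1 * \<phi> x + (- a x)) g H" using aff by blast
    obtain g' H' where 2: "C2_data d N (\<lambda>\<phi>. (-1) * \<phi> x + b x) g' H'" using aff by blast
    from C2_data_mult[OF C2_data_pos_part_cube[OF 1] C2_data_pos_part_cube[OF 2]]
    show ?thesis by (auto simp: algebra_simps)
  qed
  have "\<exists>g H. C2_data d N (box_bump d N a b) g H"
    unfolding box_bump_def[abs_def] by (rule C2_data_prod[OF finite_site_box fac])
  then obtain g H where D: "C2_data d N (box_bump d N a b) g H" by blast
  have D': "\<exists>g H. C2_data d N (\<lambda>\<phi>. 1 - exp (- (c * box_bump d N a b \<phi>))) g H"
    by (intro exI, rule C2_data_compose[OF D, where \<eta>="\<lambda>t. 1 - exp (- (c * t))"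
          and \<eta>'="\<lambda>t. c * exp (- (c * t))" and \<eta>''="\<lambda>t. - (c * c * exp (- (c * t)))"])
       (auto intro!: derivative_eq_intros continuous_intros)
  define R where "R = Max (insert 1 (b ` site_box d N))"
  have R: "R \<ge> 1" "\<And>x. x \<in> site_box d N \<Longrightarrow> b x \<le> R" by (auto simp: R_def finite_site_box)
  have "supported_in d N R (\<lambda>\<phi>. 1 - exp (- (c * box_bump d N a b \<phi>)))"
    unfolding supported_in_def
  proof (intro ballI impI)
    fix \<phi> x assume x: "x \<in> site_box d N" "R < \<phi> x"
    then have "\<not> 0 < box_bump d N a b \<phi>" using R(2)[of x] unfolding box_bump_pos_iff by force
    then have "box_bump d N a b \<phi> = 0" using box_bump_nonneg[of d N a b \<phi>] by linarith
    then show "1 - exp (- (c * box_bump d N a b \<phi>)) = 0" by simp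
  qed
  with D' R(1) show ?thesis unfolding Cc2_iff by (intro conjI exI[of _ R]) auto
qed

lemma box_bump_limit:
  "(\<lambda>n. 1 - exp (- (real n * box_bump d N a b \<phi>))) \<longlonglongrightarrow> (if \<forall>x\<in>site_box d N. a x < \<phi> x \<and> \<phi> x < b x then 1 else 0)"
proof (cases "0 < box_bump d N a b \<phi>")
  case True
  have "filterlim (\<lambda>n. box_bump d N a b \<phi> * real n) at_top sequentially"
    using True by (intro filterlim_tendsto_pos_mult_at_top[OF tendsto_const _ filterlim_real_sequentially])
  then have "filterlim (\<lambda>n. - (real n * box_bump d N a b \<phi>)) at_bot sequentially"
    by (simp add: filterlim_uminus_at_bot mult.commute)
  from filterlim_compose[OF exp_at_bot this]
  have "(\<lambda>n. exp (- (real n * box_bump d N a b \<phi>))) \<longlonglongrightarrow> 0" .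
  from tendsto_diff[OF tendsto_const[of 1] this] show ?thesis
    using True box_bump_pos_iff[of d N a b \<phi>] by simp
next
  case False
  then have "box_bump d N a b \<phi> = 0" using box_bump_nonneg[of d N a b \<phi>] by linarith
  then show ?thesis using False box_bump_pos_iff[of d N a b \<phi>] by auto
qed

section \<open>The reference measure\<close>

lemma space_site_measure [simp]: "space (site_measure s) = {0..}"
  unfolding site_measure_def by (rule space_measure_of) (auto simp: sets_restrict_space)

lemma sets_site_measure: "sets (site_measure s) = sets (restrict_space borel {0..})"
proof -
  have "sets (site_measure s) = sigma_sets {0..} (sets (restrict_space borel {0::real..}))"
    unfolding site_measure_def by (rule sets_measure_of) (auto simp: sets_restrict_space)
  also have "\<dots> = sets (restrict_space borel {0..})"
    using sets.sigma_sets_eq[of "restrict_space borel {0::real..}"] by (simp add: space_restrict_space)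
  finally show ?thesis .
qed

lemma sets_site_measure_iff: "A \<in> sets (site_measure s) \<longleftrightarrow> A \<subseteq> {0..} \<and> A \<in> sets borel"
  unfolding sets_site_measure by (subst sets_restrict_space_iff) auto

lemma measurable_site_measure: "f \<in> measurable borel M \<Longrightarrow> f \<in> measurable (site_measure s) M"
  unfolding measurable_cong_sets[OF sets_site_measure refl] by (rule measurable_restrict_space1)

lemma emeasure_site_measure:
  assumes "A \<in> sets (site_measure s)"
  shows "emeasure (site_measure s) A = ennreal s * indicator A 0 + emeasure lborel A"
proof (rule emeasure_measure_of[OF site_measure_def _ _ _ assms])
  show "sets (restrict_space borel {0::real..}) \<subseteq> Pow {0..}" by (auto simp: sets_restrict_space)
  show "positive (sets (site_measure s)) (\<lambda>A. ennreal s * indicator A 0 + emeasure lborel A)"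
    by (simp add: positive_def)
  show "countably_additive (sets (site_measure s)) (\<lambda>A. ennreal s * indicator A 0 + emeasure lborel A)"
  proof (rule countably_additiveI)
    fix A :: "nat \<Rightarrow> real set" assume A: "range A \<subseteq> sets (site_measure s)" "disjoint_family A"
    then have "range A \<subseteq> sets lborel" by (auto simp: sets_site_measure_iff)
    then have "(\<Sum>i. emeasure lborel (A i)) = emeasure lborel (\<Union>i. A i)"
      using A(2) by (rule suminf_emeasure)
    moreover have "(\<Sum>i. indicator (A i) 0) = (indicator (\<Union>i. A i) 0 :: ennreal)"
      using A(2) by (rule suminf_indicator)
    ultimately show "(\<Sum>i. ennreal s * indicator (A i) 0 + emeasure lborel (A i))
        = ennreal s * indicator (\<Union>i. A i) 0 + emeasure lborel (\<Union>i. A i)"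
      by (subst suminf_add[symmetric]) auto
  qed
qed

lemma sigma_finite_site_measure: "sigma_finite_measure (site_measure s)"
proof
  define \<A> where "\<A> = range (\<lambda>n::nat. {0..real n})"
  have m: "{0..real n} \<in> sets (site_measure s)" for n by (auto simp: sets_site_measure_iff)
  show "\<exists>A. countable A \<and> A \<subseteq> sets (site_measure s) \<and> \<Union>A = space (site_measure s) \<and>
      (\<forall>a\<in>A. emeasure (site_measure s) a \<noteq> \<infinity>)"
  proof (intro exI[of _ \<A>] conjI ballI)
    show "countable \<A>" by (simp add: \<A>_def)
    show "\<A> \<subseteq> sets (site_measure s)" using m by (auto simp: \<A>_def)
    show "\<Union>\<A> = space (site_measure s)" using real_arch_simple by (fastforce simp: \<A>_def)
    show "emeasure (site_measure s) a \<noteq> \<infinity>" if "a \<in> \<A>" for a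
      using that m by (auto simp: \<A>_def emeasure_site_measure ennreal_mult_eq_top_iff)
  qed
qed

lemma product_sigma_finite_site: "product_sigma_finite (\<lambda>_::site. site_measure s)"
  by (simp add: product_sigma_finite_def sigma_finite_site_measure)

text \<open>
  Away from the atom at \<open>0\<close> the site measure is Lebesgue measure; integrals against it reduce to Lebesgue
  integrals and the value of the integrand at \<open>0\<close>.
\<close>

lemma restrict_site_measure_pos:
  "restrict_space (site_measure s) {0<..} = restrict_space lborel {0<..}"
proof (rule measure_eqI)
  have m: "{0<..} \<inter> space (site_measure s) \<in> sets (site_measure s)"
    by (auto simp: sets_site_measure_iff Int_absorb2 subset_eq)
  have iff: "A \<in> sets (restrict_space (site_measure s) {0<..}) \<longleftrightarrow> A \<subseteq> {0<..} \<and> A \<in> sets borel" for A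
    unfolding sets_restrict_space_iff[OF m] by (auto simp: sets_site_measure_iff)
  have iff': "A \<in> sets (restrict_space lborel {0<..}) \<longleftrightarrow> A \<subseteq> {0<..} \<and> A \<in> sets borel" for A :: "real set"
    by (subst sets_restrict_space_iff) auto
  show "sets (restrict_space (site_measure s) {0<..}) = sets (restrict_space lborel {0<..})"
    using iff iff' by blast
  fix A assume "A \<in> sets (restrict_space (site_measure s) {0<..})"
  then have A: "A \<subseteq> {0<..}" "A \<in> sets borel" using iff by auto
  then have "A \<in> sets (site_measure s)" by (auto simp: sets_site_measure_iff)
  then have "emeasure (site_measure s) A = emeasure lborel A"
    using A by (auto simp: emeasure_site_measure indicator_def)
  then show "emeasure (restrict_space (site_measure s) {0<..}) A = emeasure (restrict_space lborel {0<..}) A"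
    using A m by (simp add: emeasure_restrict_space)
qed

lemma integral_site_measure_pos:
  fixes k :: "real \<Rightarrow> real"
  shows "(\<integral>t. (if t > 0 then k t else 0) \<partial>site_measure s) = (\<integral>t. (if t > 0 then k t else 0) \<partial>lborel)"
proof -
  have m: "{0<..} \<inter> space (site_measure s) \<in> sets (site_measure s)"
    by (auto simp: sets_site_measure_iff Int_absorb2 subset_eq)
  have "(\<integral>t. (if t > 0 then k t else 0) \<partial>site_measure s) = integral\<^sup>L (restrict_space (site_measure s) {0<..}) k"
    unfolding integral_restrict_space[OF m] by (intro Bochner_Integration.integral_cong) (auto simp: indicator_def)
  also have "\<dots> = (\<integral>t. (if t > 0 then k t else 0) \<partial>lborel)"
    unfolding restrict_site_measure_pos
    by (subst integral_restrict_space) (auto simp: indicator_def intro!: Bochner_Integration.integral_cong)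
  finally show ?thesis .
qed

lemma nn_integral_site_measure_le:
  assumes [measurable]: "f \<in> borel_measurable borel"
  shows "(\<integral>\<^sup>+t. f t \<partial>site_measure s) \<le> ennreal s * f 0 + (\<integral>\<^sup>+t. f t \<partial>lborel)"
proof -
  have mf [measurable]: "f \<in> borel_measurable (site_measure s)"
    by (rule measurable_site_measure[OF assms])
  have m0 [measurable]: "{0} \<in> sets (site_measure s)" by (auto simp: sets_site_measure_iff)
  have m1: "{0<..} \<in> sets (site_measure s)" by (auto simp: sets_site_measure_iff)
  have m1': "{0<..} \<inter> space (site_measure s) \<in> sets (site_measure s)"
    by (auto simp: sets_site_measure_iff Int_absorb2 subset_eq)
  have "(\<integral>\<^sup>+t. f t \<partial>site_measure s) = (\<integral>\<^sup>+t. f 0 * indicator {0} t + f t * indicator {0<..} t \<partial>site_measure s)"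
    by (intro nn_integral_cong) (auto simp: indicator_def)
  also have "\<dots> = (\<integral>\<^sup>+t. f 0 * indicator {0} t \<partial>site_measure s) + (\<integral>\<^sup>+t. f t * indicator {0<..} t \<partial>site_measure s)"
    using m1 by (intro nn_integral_add) auto
  also have "(\<integral>\<^sup>+t. f 0 * indicator {0} t \<partial>site_measure s) = ennreal s * f 0"
    by (subst nn_integral_cmult_indicator[OF m0]) (simp add: emeasure_site_measure[OF m0] mult.commute)
  also have "(\<integral>\<^sup>+t. f t * indicator {0<..} t \<partial>site_measure s) = integral\<^sup>N (restrict_space (site_measure s) {0<..}) f"
    by (rule nn_integral_restrict_space[OF m1', symmetric])
  also have "\<dots> = (\<integral>\<^sup>+t. f t * indicator {0<..} t \<partial>lborel)"
    unfolding restrict_site_measure_pos by (subst nn_integral_restrict_space) auto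
  also have "\<dots> \<le> (\<integral>\<^sup>+t. f t \<partial>lborel)"
    by (intro nn_integral_mono) (auto simp: indicator_def)
  finally show ?thesis by (simp add: add_left_mono)
qed

lemma nn_integral_translate:
  fixes c :: real
  assumes "f \<in> borel_measurable borel"
  shows "(\<integral>\<^sup>+t. f (t - c) \<partial>lborel) = (\<integral>\<^sup>+t. f t \<partial>lborel)"
  using nn_integral_real_affine[OF assms, of 1 "- c"] by (simp add: add.commute)

lemma space_reference_measure: "space (reference_measure d N s) = state_space d N"
  by (simp add: reference_measure_def space_PiM state_space_def)

lemma continuous_imp_reference_measurable:
  fixes f :: "interface \<Rightarrow> real"
  assumes "continuous_on (state_space d N) f"
  shows "f \<in> borel_measurable (reference_measure d N s)"
  unfolding reference_measure_def
  by (rule borel_measurable_continuous_PiE[OF finite_site_box assms[unfolded state_space_def]])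
     (rule sets_site_measure)

text \<open>
  Along a rank-decreasing map \<open>par\<close> the sites may be integrated out one by one, starting with those of
  maximal rank: a single factor then depends on the integration variable, and its integral is
  bounded uniformly in the remaining variables.
\<close>

lemma nn_integral_tree_bound:
  fixes par :: "site \<Rightarrow> site" and r :: "site \<Rightarrow> int" and k :: "real \<Rightarrow> ennreal"
  assumes k [measurable]: "k \<in> borel_measurable borel"
    and C: "\<And>c. (\<integral>\<^sup>+t. k (t - c) \<partial>site_measure s) \<le> C"
    and r: "\<And>x. r (par x) < r x" and "finite A"
  shows "(\<integral>\<^sup>+\<phi>. (\<Prod>x\<in>A. k (\<phi> x - (if par x \<in> A then \<phi> (par x) else 0))) \<partial>(\<Pi>\<^sub>M x\<in>A. site_measure s)) \<le> C ^ card A"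
  using \<open>finite A\<close>
proof (induction A rule: finite_ranking_induct[where f=r])
  case empty
  interpret product_sigma_finite "\<lambda>_::site. site_measure s" by (rule product_sigma_finite_site)
  show ?case by (simp add: PiM_empty)
next
  case (insert x S)
  interpret product_sigma_finite "\<lambda>_::site. site_measure s" by (rule product_sigma_finite_site)
  show ?case
  proof (cases "x \<in> S")
    case True
    then show ?thesis using insert by (simp add: insert_absorb)
  next
    case False
    define F where "F A \<phi> = (\<Prod>x\<in>A. k (\<phi> x - (if par x \<in> A then \<phi> (par x) else 0)))" for A \<phi>
    have id [measurable]: "(\<lambda>t. t) \<in> borel_measurable (site_measure s)"
      by (rule measurable_site_measure) simp
    have co [measurable]: "(\<lambda>\<phi>. \<phi> y) \<in> borel_measurable (\<Pi>\<^sub>M x\<in>A. site_measure s)" if "y \<in> A" for y A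
      by (rule borel_measurable_PiM_coord[of _ _ "\<lambda>_. site_measure s", OF that id])
    have mF: "F A \<in> borel_measurable (\<Pi>\<^sub>M x\<in>A. site_measure s)" for A
      unfolding F_def[abs_def]
    proof (rule borel_measurable_prod_ennreal)
      fix y assume y: "y \<in> A"
      show "(\<lambda>\<phi>. k (\<phi> y - (if par y \<in> A then \<phi> (par y) else 0))) \<in> borel_measurable (\<Pi>\<^sub>M x\<in>A. site_measure s)"
      proof -
        have "(\<lambda>\<phi>. \<phi> y - (if par y \<in> A then \<phi> (par y) else 0)) \<in> borel_measurable (\<Pi>\<^sub>M x\<in>A. site_measure s)"
        proof (cases "par y \<in> A")
          case True
          show ?thesis unfolding if_P[OF True] by (rule borel_measurable_diff[OF co[OF y] co[OF True]])
        next
          case False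
          show ?thesis unfolding if_not_P[OF False] by (rule borel_measurable_diff[OF co[OF y] borel_measurable_const])
        qed
        from measurable_compose[OF this k] show ?thesis .
      qed
    qed
    have par: "par y \<noteq> x" if "y \<in> insert x S" for y
      using r[of y] insert(2)[of y] that by (metis insert_iff less_le_not_le)
    have split: "F (insert x S) (\<phi>(x := t)) = k (t - (if par x \<in> S then \<phi> (par x) else 0)) * F S \<phi>" for \<phi> t
    proof -
      have "F (insert x S) (\<phi>(x := t)) = k ((\<phi>(x := t)) x - (if par x \<in> insert x S then (\<phi>(x := t)) (par x) else 0)) *
          (\<Prod>y\<in>S. k ((\<phi>(x := t)) y - (if par y \<in> insert x S then (\<phi>(x := t)) (par y) else 0)))"
        unfolding F_def using insert(1) False by (rule prod.insert)
      also have "(\<Prod>y\<in>S. k ((\<phi>(x := t)) y - (if par y \<in> insert x S then (\<phi>(x := t)) (par y) else 0))) = F S \<phi>"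
        unfolding F_def using False par by (intro prod.cong refl) auto
      also have "(if par x \<in> insert x S then (\<phi>(x := t)) (par x) else 0) = (if par x \<in> S then \<phi> (par x) else 0)"
        using par[of x] by auto
      finally show ?thesis unfolding fun_upd_same .
    qed
    have "(\<integral>\<^sup>+\<phi>. F (insert x S) \<phi> \<partial>(\<Pi>\<^sub>M x\<in>insert x S. site_measure s))
        = (\<integral>\<^sup>+\<phi>. (\<integral>\<^sup>+t. F (insert x S) (\<phi>(x := t)) \<partial>site_measure s) \<partial>(\<Pi>\<^sub>M x\<in>S. site_measure s))"
      by (rule product_nn_integral_insert[OF insert(1) False mF])
    also have "\<dots> = (\<integral>\<^sup>+\<phi>. (\<integral>\<^sup>+t. k (t - (if par x \<in> S then \<phi> (par x) else 0)) \<partial>site_measure s) * F S \<phi> \<partial>(\<Pi>\<^sub>M x\<in>S. site_measure s))"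
      unfolding split
    proof (intro nn_integral_cong nn_integral_multc)
      show "(\<lambda>t. k (t - c)) \<in> borel_measurable (site_measure s)" for c
        by (rule measurable_site_measure) measurable
    qed
    also have "\<dots> \<le> (\<integral>\<^sup>+\<phi>. C * F S \<phi> \<partial>(\<Pi>\<^sub>M x\<in>S. site_measure s))"
      by (intro nn_integral_mono mult_right_mono C) auto
    also have "\<dots> = C * (\<integral>\<^sup>+\<phi>. F S \<phi> \<partial>(\<Pi>\<^sub>M x\<in>S. site_measure s))"
      by (rule nn_integral_cmult[OF mF])
    also have "\<dots> \<le> C * C ^ card S"
      using insert(3) unfolding F_def by (intro mult_left_mono) auto
    finally show ?thesis using insert(1) False by (simp add: F_def)
  qed
qed

section \<open>The Gibbs measure\<close>

lemma abs_le_euc_dist: "i < d \<Longrightarrow> \<bar>real_of_int (x i - y i)\<bar> \<le> euc_dist d x y"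
proof -
  assume "i < d"
  then have "(real_of_int (x i - y i))\<^sup>2 \<le> (\<Sum>i<d. (real_of_int (x i - y i))\<^sup>2)"
    by (intro member_le_sum[of i "{..<d}" "\<lambda>i. (real_of_int (x i - y i))\<^sup>2"]) auto
  from real_sqrt_le_mono[OF this] show ?thesis by (simp add: euc_dist_def L2_set_def)
qed

lemma finite_site_closure: "finite (site_closure d N)"
proof -
  have "site_boundary d N \<subseteq> ({..<d} \<rightarrow>\<^sub>E {0..int N + 1})"
  proof
    fix x assume "x \<in> site_boundary d N"
    then obtain y where x: "x \<in> int_lattice d" and y: "y \<in> site_box d N" "euc_dist d x y = 1"
      by (auto simp: site_boundary_def)
    have "x i \<in> {0..int N + 1}" if "i < d" for i
    proof -
      have "\<bar>real_of_int (x i - y i)\<bar> \<le> 1" using abs_le_euc_dist[OF that, of x y] y by simp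
      then have "\<bar>x i - y i\<bar> \<le> 1" by linarith
      moreover have "y i \<in> {1..int N}"
        by (rule PiE_mem[OF y(1)[unfolded site_box_def]]) (use that in simp)
      ultimately show ?thesis by (simp add: abs_le_iff)
    qed
    then show "x \<in> ({..<d} \<rightarrow>\<^sub>E {0..int N + 1})"
      by (intro PiE_I) (use PiE_arb[OF x[unfolded int_lattice_def]] in \<open>auto simp del: atLeastAtMost_iff\<close>)
  qed
  then have "finite (site_boundary d N)" by (rule finite_subset) (auto intro!: finite_PiE)
  then show ?thesis by (simp add: site_closure_def finite_site_box)
qed

text \<open>
  The bonds from each site to its parent form a forest in the lattice, rooted outside the box.
\<close>

definition site_parent :: "site \<Rightarrow> site" where
  "site_parent x = x(0 := x 0 - 1)"

lemma euc_dist_parent: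
  assumes "d \<ge> 1"
  shows "euc_dist d x (site_parent x) = 1" "euc_dist d (site_parent x) x = 1"
proof -
  have *: "(\<Sum>i<d. (if i = 0 then 1 else 0 :: real)) = 1" using assms by (subst sum.delta) auto
  have "(\<Sum>i<d. (real_of_int (x i - site_parent x i))\<^sup>2) = (\<Sum>i<d. (if i = 0 then 1 else 0))"
    "(\<Sum>i<d. (real_of_int (site_parent x i - x i))\<^sup>2) = (\<Sum>i<d. (if i = 0 then 1 else 0))"
    by (intro sum.cong refl, simp add: site_parent_def)+
  then show "euc_dist d x (site_parent x) = 1" "euc_dist d (site_parent x) x = 1"
    unfolding euc_dist_def L2_set_def * by simp_all
qed

lemma site_parent_closure:
  assumes "d \<ge> 1" "x \<in> site_box d N"
  shows "site_parent x \<in> site_closure d N"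
proof (cases "site_parent x \<in> site_box d N")
  case False
  have "site_parent x \<in> int_lattice d"
    using assms by (auto simp: int_lattice_def site_box_def site_parent_def PiE_def extensional_def)
  then have "site_parent x \<in> site_boundary d N"
    using False assms(2) euc_dist_parent(2)[OF assms(1)] unfolding site_boundary_def by blast
  then show ?thesis by (simp add: site_closure_def)
qed (simp add: site_closure_def)

text \<open>
  The double sum runs over ordered pairs, so that each parent bond occurs twice, with equal values by
  symmetry of \<open>V\<close>; this cancels the factor \<open>1 / 2\<close>. The remaining bonds are bounded below by \<open>- b\<close>.
\<close>

lemma Hamiltonian_lower_bound:
  assumes d: "d \<ge> 1" and V: "\<And>r. V r \<ge> - b" and sym: "\<And>r. V (- r) = V r" and b: "b \<ge> 0"
  shows "\<exists>c. \<forall>\<phi>. Hamiltonian d N V \<phi> \<ge> (\<Sum>x\<in>site_box d N. V (ext0 d N \<phi> x - ext0 d N \<phi> (site_parent x))) - c"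
proof -
  define P where "P = {(x, y). x \<in> site_closure d N \<and> y \<in> site_closure d N \<and> euc_dist d x y = 1}"
  have "P \<subseteq> site_closure d N \<times> site_closure d N" by (auto simp: P_def)
  then have finP: "finite P" by (rule finite_subset) (simp add: finite_site_closure)
  define P1 where "P1 = (\<lambda>x. (x, site_parent x)) ` site_box d N"
  define P2 where "P2 = (\<lambda>x. (site_parent x, x)) ` site_box d N"
  have sub: "P1 \<union> P2 \<subseteq> P"
    using euc_dist_parent[OF d] site_parent_closure[OF d] by (auto simp: P1_def P2_def P_def site_closure_def)
  have disj: "P1 \<inter> P2 = {}"
  proof -
    have "x \<noteq> site_parent z \<or> site_parent x \<noteq> z" for x z
    proof (rule ccontr)
      assume "\<not> ?thesis"
      then have "x = site_parent z" "z = site_parent x" by auto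
      from this[THEN arg_cong[where f="\<lambda>f. f 0"]] show False by (simp add: site_parent_def)
    qed
    then show ?thesis by (auto simp: P1_def P2_def)
  qed
  define S where "S \<phi> = (\<Sum>x\<in>site_box d N. V (ext0 d N \<phi> x - ext0 d N \<phi> (site_parent x)))" for \<phi>
  have "Hamiltonian d N V \<phi> \<ge> S \<phi> - b * card P / 2" for \<phi>
  proof -
    define f where "f = (\<lambda>(x, y). V (ext0 d N \<phi> x - ext0 d N \<phi> y))"
    have f1: "sum f P1 = S \<phi>" unfolding P1_def S_def
      by (subst sum.reindex) (auto simp: inj_on_def f_def)
    have f2: "sum f P2 = S \<phi>" unfolding P2_def S_def
    proof (subst sum.reindex)
      show "sum (f \<circ> (\<lambda>x. (site_parent x, x))) (site_box d N)
          = (\<Sum>x\<in>site_box d N. V (ext0 d N \<phi> x - ext0 d N \<phi> (site_parent x)))"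
        using sym by (intro sum.cong refl) (simp add: f_def, metis minus_diff_eq)
    qed (auto simp: inj_on_def)
    have "sum f P = sum f (P1 \<union> P2) + sum f (P - (P1 \<union> P2))"
      using sum.subset_diff[OF sub finP, of f] by simp
    also have "sum f (P1 \<union> P2) = sum f P1 + sum f P2"
      by (rule sum.union_disjoint) (auto simp: P1_def P2_def finite_site_box disj[unfolded P1_def P2_def])
    finally have eq: "sum f P = 2 * S \<phi> + sum f (P - (P1 \<union> P2))" using f1 f2 by simp
    have "sum f (P - (P1 \<union> P2)) \<ge> (\<Sum>_\<in>P - (P1 \<union> P2). - b)"
      by (rule sum_mono) (auto simp: f_def V)
    moreover have "(\<Sum>_\<in>P - (P1 \<union> P2). - b) \<ge> - b * card P"
    proof -
      have "card (P - (P1 \<union> P2)) \<le> card P" by (rule card_mono[OF finP]) auto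
      then show ?thesis using b by (simp add: mult.commute mult_left_mono)
    qed
    ultimately have "sum f (P - (P1 \<union> P2)) \<ge> - b * card P" by linarith
    moreover have "Hamiltonian d N V \<phi> = sum f P / 2"
      by (simp add: Hamiltonian_def P_def f_def)
    ultimately show ?thesis using eq by (simp add: field_simps)
  qed
  then show ?thesis unfolding S_def by blast
qed

lemma continuous_Hamiltonian:
  assumes V: "continuous_on UNIV V"
  shows "continuous_on (state_space d N) (Hamiltonian d N V)"
  unfolding Hamiltonian_def[abs_def] case_prod_beta
proof (intro continuous_on_mult continuous_on_const continuous_on_sum)
  have e: "continuous_on (state_space d N) (\<lambda>\<phi>. ext0 d N \<phi> x)" for x
    by (cases "x \<in> site_box d N") (simp_all add: ext0_def continuous_on_coord)
  show "continuous_on (state_space d N) (\<lambda>\<phi>. V (ext0 d N \<phi> (fst p) - ext0 d N \<phi> (snd p)))" for p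
    by (rule continuous_on_compose2[OF V continuous_on_diff[OF e e]]) simp
qed

text \<open>
  After bounding the Hamiltonian by the forest of parent bonds, each site contributes at most
  \<open>C = s exp b + \<integral> exp (- V)\<close>, where the first summand comes from the atom.
\<close>

lemma integrable_Boltzmann_factor:
  assumes d: "d \<ge> 1" and V: "\<And>r. V r \<ge> - b" and sym: "\<And>r. V (- r) = V r" and b: "b \<ge> 0"
    and c: "continuous_on UNIV V" and int: "integrable lborel (\<lambda>r. exp (- V r))"
  shows "integrable (reference_measure d N s) (\<lambda>\<phi>. exp (- Hamiltonian d N V \<phi>))"
proof (rule integrableI_bounded)
  show "(\<lambda>\<phi>. exp (- Hamiltonian d N V \<phi>)) \<in> borel_measurable (reference_measure d N s)"
    by (intro continuous_imp_reference_measurable continuous_intros continuous_Hamiltonian c)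
  define k where "k t = ennreal (exp (- V t))" for t
  have [measurable]: "V \<in> borel_measurable borel" using c by (rule borel_measurable_continuous_onI)
  have k [measurable]: "k \<in> borel_measurable borel" unfolding k_def by measurable
  define C where "C = ennreal s * ennreal (exp b) + (\<integral>\<^sup>+t. k t \<partial>lborel)"
  have "(\<integral>\<^sup>+t. k t \<partial>lborel) < \<infinity>"
    unfolding k_def using nn_integral_eq_integral[OF int] by simp
  then have Cfin: "C < \<infinity>" by (auto simp: C_def ennreal_mult_less_top)
  have C: "(\<integral>\<^sup>+t. k (t - a) \<partial>site_measure s) \<le> C" for a
  proof -
    have "(\<integral>\<^sup>+t. k (t - a) \<partial>site_measure s) \<le> ennreal s * k (0 - a) + (\<integral>\<^sup>+t. k (t - a) \<partial>lborel)"
      by (rule nn_integral_site_measure_le) measurable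
    also have "(\<integral>\<^sup>+t. k (t - a) \<partial>lborel) = (\<integral>\<^sup>+t. k t \<partial>lborel)" by (rule nn_integral_translate[OF k])
    also have "ennreal s * k (0 - a) \<le> ennreal s * ennreal (exp b)"
      unfolding k_def using V[of "0 - a"] by (intro mult_left_mono ennreal_leI) auto
    finally show ?thesis by (simp add: C_def add_right_mono)
  qed
  obtain c0 where c0: "\<And>\<phi>. Hamiltonian d N V \<phi> \<ge>
      (\<Sum>x\<in>site_box d N. V (ext0 d N \<phi> x - ext0 d N \<phi> (site_parent x))) - c0"
    using Hamiltonian_lower_bound[of d b V, OF d V sym b] by blast
  have le: "ennreal (norm (exp (- Hamiltonian d N V \<phi>))) \<le> ennreal (exp c0) *
      (\<Prod>x\<in>site_box d N. k (\<phi> x - (if site_parent x \<in> site_box d N then \<phi> (site_parent x) else 0)))" for \<phi>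
  proof -
    have "exp (- Hamiltonian d N V \<phi>) \<le> exp (c0 + (\<Sum>x\<in>site_box d N. - V (ext0 d N \<phi> x - ext0 d N \<phi> (site_parent x))))"
      using c0[of \<phi>] by (simp add: sum_negf)
    also have "\<dots> = exp c0 * (\<Prod>x\<in>site_box d N. exp (- V (ext0 d N \<phi> x - ext0 d N \<phi> (site_parent x))))"
      by (simp add: exp_add exp_sum finite_site_box)
    also have "(\<Prod>x\<in>site_box d N. exp (- V (ext0 d N \<phi> x - ext0 d N \<phi> (site_parent x))))
       = (\<Prod>x\<in>site_box d N. exp (- V (\<phi> x - (if site_parent x \<in> site_box d N then \<phi> (site_parent x) else 0))))"
      by (intro prod.cong refl) (simp add: ext0_def)
    finally have "ennreal (norm (exp (- Hamiltonian d N V \<phi>))) \<le> ennreal (exp c0 *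
      (\<Prod>x\<in>site_box d N. exp (- V (\<phi> x - (if site_parent x \<in> site_box d N then \<phi> (site_parent x) else 0)))))"
      by (intro ennreal_leI) simp
    also have "\<dots> = ennreal (exp c0) *
      (\<Prod>x\<in>site_box d N. k (\<phi> x - (if site_parent x \<in> site_box d N then \<phi> (site_parent x) else 0)))"
      unfolding k_def by (subst ennreal_mult) (auto simp: prod_ennreal intro!: prod_nonneg)
    finally show ?thesis .
  qed
  have "(\<integral>\<^sup>+\<phi>. ennreal (norm (exp (- Hamiltonian d N V \<phi>))) \<partial>reference_measure d N s)
     \<le> (\<integral>\<^sup>+\<phi>. ennreal (exp c0) * (\<Prod>x\<in>site_box d N. k (\<phi> x - (if site_parent x \<in> site_box d N then \<phi> (site_parent x) else 0)))
        \<partial>reference_measure d N s)"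
    by (intro nn_integral_mono le)
  also have "\<dots> = ennreal (exp c0) * (\<integral>\<^sup>+\<phi>. (\<Prod>x\<in>site_box d N. k (\<phi> x - (if site_parent x \<in> site_box d N then \<phi> (site_parent x) else 0)))
        \<partial>reference_measure d N s)"
  proof (rule nn_integral_cmult, rule borel_measurable_prod_ennreal)
    fix x assume x: "x \<in> site_box d N"
    have m: "(\<lambda>\<phi>. \<phi> y) \<in> borel_measurable (reference_measure d N s)" for y
      by (rule continuous_imp_reference_measurable[OF continuous_on_coord])
    show "(\<lambda>\<phi>. k (\<phi> x - (if site_parent x \<in> site_box d N then \<phi> (site_parent x) else 0)))
        \<in> borel_measurable (reference_measure d N s)"
    proof -
      have "(\<lambda>\<phi>. \<phi> x - (if site_parent x \<in> site_box d N then \<phi> (site_parent x) else 0))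
          \<in> borel_measurable (reference_measure d N s)"
        by (cases "site_parent x \<in> site_box d N") (simp_all add: borel_measurable_diff[OF m m] m)
      from measurable_compose[OF this k] show ?thesis .
    qed
  qed
  also have "\<dots> \<le> ennreal (exp c0) * C ^ card (site_box d N)"
    unfolding reference_measure_def
    by (intro mult_left_mono nn_integral_tree_bound[OF k C, where r="\<lambda>x. x 0"] finite_site_box)
       (auto simp: site_parent_def)
  also have "\<dots> < \<infinity>" using Cfin by (simp add: ennreal_mult_less_top power_less_top_ennreal)
  finally show "(\<integral>\<^sup>+\<phi>. ennreal (norm (exp (- Hamiltonian d N V \<phi>))) \<partial>reference_measure d N s) < \<infinity>" .
qed

section \<open>Density of test functions\<close>

text \<open>
  The exhaustion \<open>J\<close> plays the role of \<open>\<Omega>\<close> in coordinates that are not constrained.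
\<close>

lemma sets_PiM_generated_by_boxes:
  fixes A :: "'i set" and M :: "'i \<Rightarrow> 'b measure" and \<E> :: "'b set set" and J :: "nat \<Rightarrow> 'b set"
  assumes fin: "finite A" and E: "\<E> \<subseteq> Pow \<Omega>" and J: "\<And>n. J n \<in> \<E>" "incseq J" "(\<Union>n. J n) = \<Omega>"
    and M: "\<And>i. i \<in> A \<Longrightarrow> sets (M i) = sigma_sets \<Omega> \<E>" and sp: "\<And>i. i \<in> A \<Longrightarrow> space (M i) = \<Omega>"
  shows "sets (PiM A M) = sigma_sets (PiE A (\<lambda>_. \<Omega>)) {PiE A X |X. \<forall>i\<in>A. X i \<in> \<E>}"
proof -
  define P where "P = {PiE A X |X. \<forall>i\<in>A. X i \<in> \<E>}"
  define S where "S = PiE A (\<lambda>_. \<Omega>)"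
  have PS: "P \<subseteq> Pow S" using E by (auto simp: P_def S_def PiE_def Pi_def)
  define N where "N = sigma S P"
  have N: "sets N = sigma_sets S P" "space N = S" using PS by (auto simp: N_def)
  have "sets (PiM A M) \<subseteq> sets N"
  proof (rule sets_PiM_in_sets)
    show "space N = (\<Pi>\<^sub>E i\<in>A. space (M i))" unfolding N S_def using sp by (auto intro!: PiE_cong)
    fix i B assume i: "i \<in> A" and B: "B \<in> sets (M i)"
    have "(\<lambda>\<phi>. \<phi> i) \<in> measurable N (M i)"
    proof (rule measurable_sigma_sets[OF M[OF i] E])
      show "(\<lambda>\<phi>. \<phi> i) \<in> space N \<rightarrow> \<Omega>" using i by (auto simp: N S_def)
      fix Y assume Y: "Y \<in> \<E>"
      \<comment> \<open>The other coordinates are exhausted by \<open>J\<close>; monotonicity and finiteness of \<open>A\<close> give a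
        common index.\<close>
      have "(\<lambda>\<phi>. \<phi> i) -` Y \<inter> space N = (\<Union>n. PiE A (\<lambda>j. if j = i then Y else J n))"
      proof (intro equalityI subsetI)
        fix \<phi> assume \<phi>: "\<phi> \<in> (\<lambda>\<phi>. \<phi> i) -` Y \<inter> space N"
        then have "\<forall>j\<in>A. \<exists>n. \<phi> j \<in> J n" using J(3) by (auto simp: N S_def)
        from bchoice[OF this] obtain m where m: "\<And>j. j \<in> A \<Longrightarrow> \<phi> j \<in> J (m j)" by blast
        define n where "n = Max (m ` A)"
        have "\<phi> j \<in> J n" if "j \<in> A" for j
          using m[OF that] incseqD[OF J(2), of "m j" n] that fin by (auto simp: n_def)
        then have "\<phi> \<in> PiE A (\<lambda>j. if j = i then Y else J n)"
          using \<phi> by (auto simp: N S_def PiE_def)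
        then show "\<phi> \<in> (\<Union>n. PiE A (\<lambda>j. if j = i then Y else J n))" by blast
      next
        fix \<phi> assume "\<phi> \<in> (\<Union>n. PiE A (\<lambda>j. if j = i then Y else J n))"
        then obtain n where n: "\<phi> \<in> PiE A (\<lambda>j. if j = i then Y else J n)" by blast
        have "\<phi> j \<in> \<Omega>" if "j \<in> A" for j
          using PiE_mem[OF n that] J(1)[of n] Y E by (auto split: if_splits)
        moreover have "\<phi> i \<in> Y" using PiE_mem[OF n i] by simp
        ultimately show "\<phi> \<in> (\<lambda>\<phi>. \<phi> i) -` Y \<inter> space N"
          using PiE_arb[OF n] by (auto simp: N S_def PiE_def extensional_def)
      qed
      also have "\<dots> \<in> sets N"
        unfolding N using J(1) Y by (intro sigma_sets.Union sigma_sets.Basic) (auto simp: P_def)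
      finally show "(\<lambda>\<phi>. \<phi> i) -` Y \<inter> space N \<in> sets N" .
    qed
    from measurable_sets[OF this B] show "{x \<in> space N. x i \<in> B} \<in> sets N"
      by (simp add: vimage_def Int_def conj_commute)
  qed
  moreover have "sets N \<subseteq> sets (PiM A M)"
  proof -
    have "P \<subseteq> sets (PiM A M)"
      using M E by (auto simp: P_def intro!: sets_PiM_I_finite fin sigma_sets.Basic)
    moreover have "space (PiM A M) = S" unfolding S_def space_PiM using sp by (auto intro!: PiE_cong)
    ultimately show ?thesis unfolding N using sets.sigma_sets_subset by metis
  qed
  ultimately show ?thesis unfolding N P_def S_def by blast
qed

lemma sets_site_measure_generated:
  "sets (site_measure s) = sigma_sets {0..} (range (\<lambda>(a, b). {0..} \<inter> {a<..<b}))"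
proof -
  have b: "sets borel = sigma_sets UNIV (range (\<lambda>(a, b). {a<..<b::real}))"
    unfolding borel_eq_box by (simp add: image_def box_real)
  have "{0::real..} \<in> sigma_sets UNIV (range (\<lambda>(a, b). {a<..<b::real}))" unfolding b[symmetric] by simp
  from sigma_sets_Int[OF this] show ?thesis
    unfolding sets_site_measure sets_restrict_space b by (simp add: image_image case_prod_beta)
qed

text \<open>
  The \<open>L\<^sup>2\<close>-closure of a linear space of functions: the sets with indicator in it form a Dynkin
  system, so density can be read off from a generator stable under intersection.
\<close>

lemma densely_definedI:
  fixes M :: "'a measure"
  assumes fin: "finite_measure M" and D: "D \<subseteq> L2_space M"
    and add: "\<And>u v. u \<in> D \<Longrightarrow> v \<in> D \<Longrightarrow> (\<lambda>p. u p + v p) \<in> D"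
    and scale: "\<And>c u. u \<in> D \<Longrightarrow> (\<lambda>p. c * u p) \<in> D" and zero: "(\<lambda>_. 0) \<in> D"
    and gen: "sets M = sigma_sets (space M) G" "Int_stable G" "G \<subseteq> Pow (space M)"
    and G: "\<And>A. A \<in> G \<Longrightarrow> \<exists>U. (\<forall>n. U n \<in> D) \<and> L2_conv M U (indicator A)"
    and one: "\<exists>A. (\<forall>n::nat. A n \<in> G) \<and> incseq A \<and> (\<Union>n. A n) = space M"
  shows "densely_defined M D"
proof -
  interpret finite_measure M by fact
  define K where "K = {f \<in> L2_space M. \<forall>e>0. \<exists>g\<in>D. (\<integral>p. (f p - g p)\<^sup>2 \<partial>M) < e}"
  have DL: "g \<in> L2_space M" if "g \<in> D" for g using that D by blast
  have K_L2: "f \<in> L2_space M" if "f \<in> K" for f using that by (simp add: K_def)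
  have K_closed: "f \<in> K" if U: "\<And>n. U n \<in> K" and conv: "L2_conv M U f" for U f
  proof -
    have "\<exists>g\<in>D. (\<integral>p. (f p - g p)\<^sup>2 \<partial>M) < e" if e: "e > 0" for e
    proof -
      have "(\<lambda>n. \<integral>p. (U n p - f p)\<^sup>2 \<partial>M) \<longlonglongrightarrow> 0" using conv by (simp add: L2_conv_def)
      from order_tendstoD(2)[OF this, of "e/4"] e obtain n where n: "(\<integral>p. (U n p - f p)\<^sup>2 \<partial>M) < e / 4"
        using eventually_happens'[OF sequentially_bot] by fastforce
      have "e / 4 > 0" using e by simp
      with U[of n] obtain g where g: "g \<in> D" "(\<integral>p. (U n p - g p)\<^sup>2 \<partial>M) < e / 4"
        unfolding K_def by blast
      note m = L2_conv_mem(1)[OF conv, of n] L2_conv_mem(2)[OF conv] DL[OF g(1)]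
      have "(\<integral>p. (f p - g p)\<^sup>2 \<partial>M) = (\<integral>p. ((f p - U n p) + (U n p - g p))\<^sup>2 \<partial>M)" by simp
      also have "\<dots> \<le> 2 * (\<integral>p. (f p - U n p)\<^sup>2 \<partial>M) + 2 * (\<integral>p. (U n p - g p)\<^sup>2 \<partial>M)"
        by (intro L2_add_bound L2_diff m)
      also have "(\<integral>p. (f p - U n p)\<^sup>2 \<partial>M) = (\<integral>p. (U n p - f p)\<^sup>2 \<partial>M)" by (simp add: power2_commute)
      finally have "(\<integral>p. (f p - g p)\<^sup>2 \<partial>M) < e" using n g(2) by linarith
      then show ?thesis using g(1) by blast
    qed
    then show ?thesis using L2_conv_mem(2)[OF conv] by (simp add: K_def)
  qed
  have D_K: "g \<in> K" if "g \<in> D" for g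
    unfolding K_def using DL[OF that] that by (auto intro!: bexI[of _ g])
  have K_iff: "f \<in> K \<longleftrightarrow> (\<exists>U. (\<forall>n. U n \<in> D) \<and> L2_conv M U f)" for f
  proof
    assume f: "f \<in> K"
    have "\<exists>g. g \<in> D \<and> (\<integral>p. (f p - g p)\<^sup>2 \<partial>M) < inverse (real (Suc n))" for n
    proof -
      have "0 < inverse (real (Suc n))" by simp
      then show ?thesis using f unfolding K_def by blast
    qed
    then have "\<forall>n. \<exists>g. g \<in> D \<and> (\<integral>p. (f p - g p)\<^sup>2 \<partial>M) < inverse (real (Suc n))" by blast
    from choice[OF this] obtain U where U: "\<And>n. U n \<in> D" "\<And>n. (\<integral>p. (f p - U n p)\<^sup>2 \<partial>M) < inverse (real (Suc n))"
      by blast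
    have "(\<lambda>n. \<integral>p. (f p - U n p)\<^sup>2 \<partial>M) \<longlonglongrightarrow> 0"
    proof (rule tendsto_sandwich[OF _ _ tendsto_const LIMSEQ_inverse_real_of_nat])
      show "\<forall>\<^sub>F n in sequentially. (\<integral>p. (f p - U n p)\<^sup>2 \<partial>M) \<le> inverse (real (Suc n))"
        by (intro always_eventually allI less_imp_le U(2))
    qed simp
    then have "L2_conv M U f" using U(1) DL K_L2[OF f] by (simp add: L2_conv_def power2_commute)
    with U(1) show "\<exists>U. (\<forall>n. U n \<in> D) \<and> L2_conv M U f" by blast
  next
    assume "\<exists>U. (\<forall>n. U n \<in> D) \<and> L2_conv M U f"
    then obtain U where U: "\<And>n. U n \<in> D" "L2_conv M U f" by blast
    show "f \<in> K" by (rule K_closed[OF D_K[OF U(1)] U(2)])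
  qed
  have K_add: "(\<lambda>p. f p + g p) \<in> K" if "f \<in> K" "g \<in> K" for f g
  proof -
    obtain U W where "\<And>n. U n \<in> D" "L2_conv M U f" "\<And>n. W n \<in> D" "L2_conv M W g"
      using \<open>f \<in> K\<close> \<open>g \<in> K\<close> unfolding K_iff by blast
    then show ?thesis unfolding K_iff
      by (intro exI[of _ "\<lambda>n p. U n p + W n p"] conjI allI add L2_conv_add)
  qed
  have K_scale: "(\<lambda>p. c * f p) \<in> K" if "f \<in> K" for c f
  proof -
    obtain U where "\<And>n. U n \<in> D" "L2_conv M U f" using \<open>f \<in> K\<close> unfolding K_iff by blast
    then show ?thesis unfolding K_iff
      by (intro exI[of _ "\<lambda>n p. c * U n p"] conjI allI scale L2_conv_scale)
  qed
  have K_cong: "g \<in> K" if "f \<in> K" "\<And>p. p \<in> space M \<Longrightarrow> f p = g p" for f g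
  proof -
    obtain U where U: "\<And>n. U n \<in> D" "L2_conv M U f" using \<open>f \<in> K\<close> unfolding K_iff by blast
    have "g \<in> borel_measurable M"
      using L2_measurable[OF K_L2[OF that(1)]] that(2) by (simp cong: measurable_cong)
    then have "L2_conv M U g" by (rule L2_conv_cong_AE[OF U(2)]) (use that(2) in \<open>auto intro: AE_I2\<close>)
    with U(1) show ?thesis unfolding K_iff by blast
  qed
  have one_L2: "(\<lambda>_. 1) \<in> L2_space M" by (simp add: L2_space_def)
  have K_incseq: "indicator (\<Union>n. A n) \<in> K" if A: "\<And>n::nat. indicator (A n) \<in> K" "\<And>n. A n \<in> sets M" "incseq A" for A
  proof (rule K_closed[OF A(1)], rule L2_conv_dominated[OF one_L2])
    show "indicator (A n) \<in> borel_measurable M" for n using A(2) by simp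
    show "indicator (\<Union>n. A n) \<in> borel_measurable M" using A(2) by (intro borel_measurable_indicator sets.countable_UN) auto
    show "AE p in M. (\<lambda>n. indicator (A n) p :: real) \<longlonglongrightarrow> indicator (\<Union>n. A n) p"
      by (intro AE_I2 LIMSEQ_indicator_incseq A(3))
  qed (auto simp: indicator_def)
  have K_zero: "(\<lambda>_. 0) \<in> K" by (rule D_K[OF zero])
  obtain J where J: "\<And>n::nat. J n \<in> G" "incseq J" "(\<Union>n. J n) = space M" using one by blast
  have G_K: "indicator A \<in> K" if "A \<in> G" for A using G[OF that] unfolding K_iff .
  have G_sets: "A \<in> sets M" if "A \<in> G" for A unfolding gen(1) by (rule sigma_sets.Basic[OF that])
  have K_space: "indicator (space M) \<in> K"
    using K_incseq[of J, OF G_K[OF J(1)] G_sets[OF J(1)] J(2)] unfolding J(3) .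
  have ind: "indicator A \<in> K" if A: "A \<in> sets M" for A
  proof (rule sigma_sets_induct_disjoint[OF gen(2,3) A[unfolded gen(1)]])
    show "indicator A \<in> K" if "A \<in> G" for A by (rule G_K[OF that])
    have "indicator {} = (\<lambda>_::'a. 0::real)" by auto
    then show "indicator {} \<in> K" using K_zero by simp
  next
    fix A assume "A \<in> sigma_sets (space M) G" and A: "indicator A \<in> K"
    then have "A \<in> sets M" using gen(1) by simp
    then have As: "A \<subseteq> space M" by (rule sets.sets_into_space)
    show "indicator (space M - A) \<in> K"
      by (rule K_cong[OF K_add[OF K_space K_scale[OF A, of "-1"]]]) (use As in \<open>auto simp: indicator_def\<close>)
  next
    fix A :: "nat \<Rightarrow> 'a set" assume dis: "disjoint_family A" and s: "range A \<subseteq> sigma_sets (space M) G"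
      and A: "\<And>i. indicator (A i) \<in> K"
    have sA: "A i \<in> sets M" for i using s gen(1) by auto
    define B where "B n = (\<Union>i<n. A i)" for n
    have "indicator (B n) \<in> K" for n
    proof (induction n)
      case 0
      have "indicator {} = (\<lambda>_::'a. 0::real)" by auto
      then show ?case using K_zero by (simp add: B_def)
    next
      case (Suc n)
      have "indicator (B (Suc n)) p = (indicator (B n) p + indicator (A n) p :: real)" for p
      proof -
        have "A n \<inter> B n = {}" using dis by (auto simp: B_def disjoint_family_on_def) (metis IntI UNIV_I empty_iff nat_neq_iff)
        then show ?thesis by (auto simp: B_def indicator_def less_Suc_eq)
      qed
      then have "indicator (B (Suc n)) = (\<lambda>p. indicator (B n) p + indicator (A n) p :: real)" by blast
      with K_add[OF Suc A[of n]] show ?case by simp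
    qed
    moreover have "B n \<in> sets M" for n unfolding B_def using sA by (intro sets.finite_UN) auto
    moreover have "incseq B" unfolding B_def by (intro monoI UN_mono) auto
    ultimately have "indicator (\<Union>n. B n) \<in> K" by (rule K_incseq)
    moreover have "(\<Union>n. B n) = (\<Union>i. A i)" by (auto simp: B_def)
    ultimately show "indicator (\<Union>i. A i) \<in> K" by simp
  qed
  have K_sum: "(\<lambda>p. \<Sum>y\<in>Y. c y * indicator (A y) p) \<in> K" if "finite Y" "\<And>y. y \<in> Y \<Longrightarrow> A y \<in> sets M"
    for Y :: "real set" and c and A :: "real \<Rightarrow> 'a set"
    using that
  proof (induction Y rule: finite_induct)
    case (insert y Y)
    have "(\<lambda>p. c y * indicator (A y) p + (\<Sum>y\<in>Y. c y * indicator (A y) p)) \<in> K"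
      using insert by (intro K_add K_scale ind) auto
    then show ?case unfolding sum.insert[OF insert(1,2)] .
  qed (simp add: K_zero)
  have simp_K: "f \<in> K" if "simple_function M f" for f :: "'a \<Rightarrow> real"
  proof -
    have "(\<lambda>p. \<Sum>y\<in>f ` space M. y * indicator (f -` {y} \<inter> space M) p) \<in> K"
      using that by (intro K_sum simple_functionD)
    then show ?thesis
    proof (rule K_cong)
      fix p assume p: "p \<in> space M"
      have "(\<Sum>y\<in>f ` space M. y * indicator (f -` {y} \<inter> space M) p) = (\<Sum>y\<in>f ` space M. if y = f p then f p else 0)"
        by (intro sum.cong refl) (use p in \<open>auto simp: indicator_def\<close>)
      also have "\<dots> = f p" using p simple_functionD(1)[OF that] by simp
      finally show "(\<Sum>y\<in>f ` space M. y * indicator (f -` {y} \<inter> space M) p) = f p" .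
    qed
  qed
  have all: "f \<in> K" if f: "f \<in> L2_space M" for f
  proof -
    obtain F where F: "\<And>i. simple_function M (F i)" "\<And>x. x \<in> space M \<Longrightarrow> (\<lambda>i. F i x) \<longlonglongrightarrow> f x"
      "\<And>i x. x \<in> space M \<Longrightarrow> dist (F i x) 0 \<le> 2 * dist (f x) 0"
      using borel_measurable_implies_sequence_metric[OF L2_measurable[OF f], of 0] by blast
    have "L2_conv M F f"
    proof (rule L2_conv_dominated[OF L2_scale[OF f, of 2]])
      show "F n \<in> borel_measurable M" for n by (rule borel_measurable_simple_function[OF F(1)])
      show "f \<in> borel_measurable M" by (rule L2_measurable[OF f])
      show "AE p in M. (\<lambda>n. F n p) \<longlonglongrightarrow> f p" by (rule AE_I2[OF F(2)])
      show "AE p in M. \<bar>F n p\<bar> \<le> \<bar>2 * f p\<bar>" for n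
        using F(3)[of _ n] by (intro AE_I2) (simp add: dist_real_def abs_mult)
    qed
    then show ?thesis by (rule K_closed[OF simp_K[OF F(1)]])
  qed
  show ?thesis unfolding densely_defined_def
  proof (intro conjI ballI allI impI D)
    fix f and e :: real assume f: "f \<in> L2_space M" and e: "e > 0"
    have "e\<^sup>2 > 0" using e by simp
    with all[OF f] obtain g where g: "g \<in> D" "(\<integral>p. (f p - g p)\<^sup>2 \<partial>M) < e\<^sup>2"
      unfolding K_def by blast
    have "sqrt (\<integral>p. (f p - g p)\<^sup>2 \<partial>M) < sqrt (e\<^sup>2)" using g(2) by (rule real_sqrt_less_mono)
    then have "L2_norm M (\<lambda>p. f p - g p) < e"
      using e by (simp add: L2_norm_def L2_inner_def power2_eq_square)
    then show "\<exists>g\<in>D. L2_norm M (\<lambda>p. f p - g p) < e" using g(1) by blast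
  qed
qed

text \<open>Approximating \<open>f\<close> itself by elements of the dense set gives \<open>\<integral> f\<^sup>2 = 0\<close>.\<close>

lemma AE_zero_if_orthogonal_to_dense:
  assumes dense: "densely_defined M D" and f: "f \<in> L2_space M"
    and orth: "\<And>g. g \<in> D \<Longrightarrow> (\<integral>p. f p * g p \<partial>M) = 0"
  shows "AE p in M. f p = 0"
proof -
  have "\<exists>g. g \<in> D \<and> L2_norm M (\<lambda>p. f p - g p) < inverse (real (Suc n))" for n
  proof -
    have "0 < inverse (real (Suc n))" by simp
    then show ?thesis using dense f unfolding densely_defined_def by blast
  qed
  then have "\<forall>n. \<exists>g. g \<in> D \<and> L2_norm M (\<lambda>p. f p - g p) < inverse (real (Suc n))" by blast
  from choice[OF this] obtain U where U: "\<And>n. U n \<in> D" "\<And>n. L2_norm M (\<lambda>p. f p - U n p) < inverse (real (Suc n))"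
    by blast
  have UL: "U n \<in> L2_space M" for n using U(1) dense by (auto simp: densely_defined_def)
  have "(\<lambda>n. L2_norm M (\<lambda>p. f p - U n p)) \<longlonglongrightarrow> 0"
  proof (rule tendsto_sandwich[OF _ _ tendsto_const LIMSEQ_inverse_real_of_nat])
    show "\<forall>\<^sub>F n in sequentially. 0 \<le> L2_norm M (\<lambda>p. f p - U n p)"
      by (simp add: L2_norm_def L2_inner_def)
    show "\<forall>\<^sub>F n in sequentially. L2_norm M (\<lambda>p. f p - U n p) \<le> inverse (real (Suc n))"
      by (intro always_eventually allI less_imp_le U(2))
  qed
  then have "L2_conv M U f"
    using UL f unfolding L2_norm_tendsto_iff by (simp add: L2_conv_def power2_commute)
  from L2_conv_inner[OF L2_conv_const[OF f] this] have "(\<integral>p. (f p)\<^sup>2 \<partial>M) = 0"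
    using orth[OF U(1)] by (simp add: LIMSEQ_const_iff power2_eq_square)
  then show ?thesis using L2_AE_zero_iff[OF f] by simp
qed

section \<open>The form of the wetting model\<close>

lemma tendsto_lift_upd:
  assumes c: "continuous_on (state_space d N) f" and \<phi>: "\<phi> \<in> state_space d N"
    and x: "x \<in> site_box d N" and t: "t \<ge> 0"
  shows "(\<lambda>n. f ((lift_interface d N \<phi> (inverse (real (Suc n))))(x := t))) \<longlonglongrightarrow> f (\<phi>(x := t))"
proof -
  have "continuous_on {0..} (\<lambda>\<epsilon>. (lift_interface d N \<phi> \<epsilon>)(x := t))"
  proof (rule continuous_on_coordinatewise_then_product)
    show "continuous_on {0..} (\<lambda>\<epsilon>. ((lift_interface d N \<phi> \<epsilon>)(x := t)) i)" for i
      by (cases "i = x") (use continuous_on_product_then_coordinatewise[OF continuous_on_lift] in auto)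
  qed
  then have "continuous_on {0..} (\<lambda>\<epsilon>. f ((lift_interface d N \<phi> \<epsilon>)(x := t)))"
    by (rule continuous_on_compose2[OF c]) (use state_space_upd[OF lift_in_state[OF \<phi>] x t] in auto)
  from continuous_on_tendsto_compose[OF this LIMSEQ_inverse_real_of_nat] show ?thesis by simp
qed

text \<open>
  The fundamental theorem of calculus for \<open>t F(\<phi>(x := t))\<close>, which vanishes at both ends. On lines inside the
  boundary the partial derivative is only given as a limit, so these lines are approximated by
  interior ones.
\<close>

lemma integral_line_zero:
  assumes D: "C2_data d N F g H" and s: "supported_in d N R F" and R: "R > 0"
    and x: "x \<in> site_box d N" and \<phi>: "\<phi> \<in> state_space d N"
  shows "(\<integral>t. (if t > 0 then t * g x (\<phi>(x := t)) + F (\<phi>(x := t)) else 0) \<partial>lborel) = 0"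
proof -
  define k where "k \<psi> t = t * g x (\<psi>(x := t)) + F (\<psi>(x := t))" for \<psi> t
  have gs: "supported_in d N R (g x)" by (rule C2_data_supported[OF D s x])
  have kc: "continuous_on {0..R + 1} (k \<psi>)" if "\<psi> \<in> state_space d N" for \<psi>
    unfolding k_def using that x
    by (intro continuous_intros continuous_on_subset[OF continuous_on_upd_comp[OF C2_dataD(2)[OF D x]]]
        continuous_on_subset[OF continuous_on_upd_comp[OF C2_dataD(1)[OF D]]]) auto
  have si: "set_integrable lborel {0..R + 1} (k \<psi>)" if "\<psi> \<in> state_space d N" for \<psi>
    by (rule borel_integrable_atLeastAtMost'[OF kc[OF that]])
  define L where "L \<psi> = (\<integral>t. indicator {0..R + 1} t *\<^sub>R k \<psi> t \<partial>lborel)" for \<psi>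
  have int: "L \<psi> = 0" if \<psi>: "\<psi> \<in> interior_space d N" for \<psi>
  proof -
    have \<psi>S: "\<psi> \<in> state_space d N" using \<psi> interior_subset_state by blast
    have "(k \<psi> has_integral ((R + 1) * F (\<psi>(x := R + 1)) - 0 * F (\<psi>(x := 0)))) {0..R + 1}"
    proof (rule fundamental_theorem_of_calculus_interior[where f="\<lambda>t. t * F (\<psi>(x := t))"])
      show "continuous_on {0..R + 1} (\<lambda>t. t * F (\<psi>(x := t)))"
        by (intro continuous_intros continuous_on_subset[OF continuous_on_upd_comp[OF C2_dataD(1)[OF D] \<psi>S x]]) auto
      fix t assume t: "t \<in> {0<..<R + 1}"
      have "((\<lambda>r. F ((\<psi>(x := t))(x := r))) has_real_derivative g x (\<psi>(x := t))) (at ((\<psi>(x := t)) x))"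
        by (rule C2_dataD(3)[OF D x interior_space_upd[OF \<psi> x]]) (use t in auto)
      then have "((\<lambda>r. F (\<psi>(x := r))) has_real_derivative g x (\<psi>(x := t))) (at t)" by simp
      from DERIV_mult[OF DERIV_ident this]
      show "((\<lambda>t. t * F (\<psi>(x := t))) has_vector_derivative k \<psi> t) (at t)"
        unfolding has_real_derivative_iff_has_vector_derivative[symmetric] k_def by (simp add: algebra_simps)
    qed (use R in auto)
    moreover have "F (\<psi>(x := R + 1)) = 0"
      using s state_space_upd[OF \<psi>S x, of "R + 1"] x R unfolding supported_in_def
      by (metis fun_upd_same less_add_one less_eq_real_def add_nonneg_nonneg zero_le_one)
    ultimately have "(k \<psi> has_integral 0) {0..R + 1}" by simp
    then show ?thesis
      using set_borel_integral_eq_integral(2)[OF si[OF \<psi>S]] by (simp add: L_def set_lebesgue_integral_def integral_unique)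
  qed
  obtain B0 where B0: "B0 \<ge> 0" "\<And>\<psi>. \<psi> \<in> state_space d N \<Longrightarrow> \<bar>F \<psi>\<bar> \<le> B0"
    using Cc_bounded[OF C2_dataD(1)[OF D] s] by blast
  obtain B1 where B1: "B1 \<ge> 0" "\<And>\<psi>. \<psi> \<in> state_space d N \<Longrightarrow> \<bar>g x \<psi>\<bar> \<le> B1"
    using Cc_bounded[OF C2_dataD(2)[OF D x] gs] by blast
  define e where "e n = inverse (real (Suc n))" for n
  have e: "e n > 0" for n by (simp add: e_def)
  have lS: "lift_interface d N \<phi> (e n) \<in> state_space d N" for n
    by (rule lift_in_state[OF \<phi> less_imp_le[OF e]])
  have "(\<lambda>n. L (lift_interface d N \<phi> (e n))) \<longlonglongrightarrow> L \<phi>"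
    unfolding L_def
  proof (rule integral_dominated_convergence[where w="\<lambda>t. indicator {0..R + 1} t *\<^sub>R ((R + 1) * B1 + B0)"])
    show "(\<lambda>t. indicator {0..R + 1} t *\<^sub>R k \<phi> t) \<in> borel_measurable lborel"
      using si[OF \<phi>] by (simp add: set_integrable_def borel_measurable_integrable)
    show "(\<lambda>t. indicator {0..R + 1} t *\<^sub>R k (lift_interface d N \<phi> (e n)) t) \<in> borel_measurable lborel" for n
      using si[OF lS] by (simp add: set_integrable_def borel_measurable_integrable)
    show "integrable lborel (\<lambda>t. indicator {0..R + 1} t *\<^sub>R ((R + 1) * B1 + B0))"
      using borel_integrable_atLeastAtMost'[of 0 "R + 1" "\<lambda>_. (R + 1) * B1 + B0"]
      by (simp add: set_integrable_def)
    show "AE t in lborel. (\<lambda>n. indicator {0..R + 1} t *\<^sub>R k (lift_interface d N \<phi> (e n)) t)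
        \<longlonglongrightarrow> indicator {0..R + 1} t *\<^sub>R k \<phi> t"
    proof (rule AE_I2)
      fix t :: real
      show "(\<lambda>n. indicator {0..R + 1} t *\<^sub>R k (lift_interface d N \<phi> (e n)) t)
        \<longlonglongrightarrow> indicator {0..R + 1} t *\<^sub>R k \<phi> t"
      proof (cases "t \<in> {0..R + 1}")
        case True
        then have t: "t \<ge> 0" by simp
        show ?thesis unfolding k_def e_def
          by (intro tendsto_intros tendsto_lift_upd C2_dataD(1)[OF D] C2_dataD(2)[OF D x] \<phi> x t)
      qed simp
    qed
    show "AE t in lborel. norm (indicator {0..R + 1} t *\<^sub>R k (lift_interface d N \<phi> (e n)) t)
        \<le> indicator {0..R + 1} t *\<^sub>R ((R + 1) * B1 + B0)" for n
    proof (rule AE_I2)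
      fix t :: real
      show "norm (indicator {0..R + 1} t *\<^sub>R k (lift_interface d N \<phi> (e n)) t)
        \<le> indicator {0..R + 1} t *\<^sub>R ((R + 1) * B1 + B0)"
      proof (cases "t \<in> {0..R + 1}")
        case True
        have u: "(lift_interface d N \<phi> (e n))(x := t) \<in> state_space d N"
          by (rule state_space_upd[OF lS x]) (use True in simp)
        have "\<bar>k (lift_interface d N \<phi> (e n)) t\<bar> \<le> \<bar>t * g x ((lift_interface d N \<phi> (e n))(x := t))\<bar> + \<bar>F ((lift_interface d N \<phi> (e n))(x := t))\<bar>"
          unfolding k_def by (rule abs_triangle_ineq)
        also have "\<dots> \<le> (R + 1) * B1 + B0"
          unfolding abs_mult by (intro add_mono mult_mono B0(2)[OF u] B1(2)[OF u]) (use True R in auto)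
        finally show ?thesis using True by simp
      qed simp
    qed
  qed
  moreover have "L (lift_interface d N \<phi> (e n)) = 0" for n by (rule int[OF lift_in_interior[OF \<phi> e]])
  ultimately have "L \<phi> = 0" by (simp add: LIMSEQ_const_iff)
  moreover have "(\<integral>t. (if t > 0 then k \<phi> t else 0) \<partial>lborel) = L \<phi>"
    unfolding L_def
  proof (rule integral_cong_AE)
    have z: "k \<phi> t = 0" if t: "t > R" for t
    proof -
      have "\<phi>(x := t) \<in> state_space d N" by (rule state_space_upd[OF \<phi> x]) (use t R in linarith)
      moreover have "R < (\<phi>(x := t)) x" using t by simp
      ultimately have "F (\<phi>(x := t)) = 0" "g x (\<phi>(x := t)) = 0"
        using s gs x unfolding supported_in_def by blast+
      then show ?thesis by (simp add: k_def)
    qed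
    have eq: "(if t > 0 then k \<phi> t else 0) = indicator {0<..} t *\<^sub>R (indicator {0..R + 1} t *\<^sub>R k \<phi> t)" for t
      using z[of t] by (auto simp: indicator_def)
    show m: "(\<lambda>t. indicator {0..R + 1} t *\<^sub>R k \<phi> t) \<in> borel_measurable lborel"
      using si[OF \<phi>] by (simp add: set_integrable_def borel_measurable_integrable)
    show "(\<lambda>t. if t > 0 then k \<phi> t else 0) \<in> borel_measurable lborel"
      unfolding eq by (intro borel_measurable_scaleR m) simp
    show "AE t in lborel. (if t > 0 then k \<phi> t else 0) = indicator {0..R + 1} t *\<^sub>R k \<phi> t"
      using AE_lborel_singleton[of 0] by eventually_elim (unfold eq, auto simp: indicator_def)
  qed
  ultimately have "(\<integral>t. (if t > 0 then k \<phi> t else 0) \<partial>lborel) = 0" by simp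
  then show ?thesis unfolding k_def .
qed

lemma Cc2_zero: "(\<lambda>_. 0) \<in> Cc2 d N"
  using Cc2_scale[OF cutoff_Cc2[of 1 d N], of 0] by simp

text \<open>
  The value \<open>0\<close> at pinned sites turns the sum over strata into a single integral.
\<close>

definition wet_grad :: "nat \<Rightarrow> nat \<Rightarrow> site \<Rightarrow> (interface \<Rightarrow> real) \<Rightarrow> interface \<Rightarrow> real" where
  "wet_grad d N x F \<phi> = (if \<phi> x > 0 then partial_ext d N x F \<phi> else 0)"

locale wetting =
  fixes d N :: nat and s b :: real and V :: "real \<Rightarrow> real"
  assumes d: "d \<ge> 1" and N: "N \<ge> 1" and s: "s > 0" and b: "b \<ge> 0" and V_ge: "\<And>r. V r \<ge> - b"
    and V_cont: "continuous_on UNIV V" and V_sym: "\<And>r. V (- r) = V r"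
    and V_int: "integrable lborel (\<lambda>r. exp (- V r))"
begin

abbreviation "\<mu> \<equiv> gibbs_measure d N V s"
abbreviation "\<nu> \<equiv> reference_measure d N s"
abbreviation "\<rho> \<equiv> gibbs_density d N V s"
abbreviation "S \<equiv> state_space d N"
abbreviation "\<Lambda> \<equiv> site_box d N"

text \<open>
  If the integral vanished, so would the strictly positive integrand almost everywhere, but the reference
  measure is not the null measure.
\<close>

lemma partition_function_pos: "partition_function d N V s > 0"
proof -
  interpret product_sigma_finite "\<lambda>_::site. site_measure s" by (rule product_sigma_finite_site)
  let ?f = "\<lambda>\<phi>. exp (- Hamiltonian d N V \<phi>)"
  have i: "integrable \<nu> ?f" by (rule integrable_Boltzmann_factor[OF d V_ge V_sym b V_cont V_int])
  have "emeasure (site_measure s) {0..} \<noteq> 0"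
    using s emeasure_site_measure[of "{0..}" s] by (auto simp: sets_site_measure_iff)
  moreover have "emeasure \<nu> (PiE \<Lambda> (\<lambda>_. {0..})) = (\<Prod>x\<in>\<Lambda>. emeasure (site_measure s) {0..})"
    unfolding reference_measure_def
    by (rule emeasure_PiM[OF finite_site_box]) (auto simp: sets_site_measure_iff)
  ultimately have ne: "emeasure \<nu> (space \<nu>) \<noteq> 0"
    by (simp add: space_reference_measure state_space_def)
  have "integral\<^sup>L \<nu> ?f \<noteq> 0"
  proof
    assume "integral\<^sup>L \<nu> ?f = 0"
    then have "AE \<phi> in \<nu>. False"
      using integral_nonneg_eq_0_iff_AE[OF i] by simp
    then have "emeasure \<nu> (space \<nu>) = 0"
      using AE_iff_measurable[of "space \<nu>" \<nu> "\<lambda>_. False"] by simp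
    with ne show False by blast
  qed
  moreover have "integral\<^sup>L \<nu> ?f \<ge> 0" by simp
  ultimately show ?thesis unfolding partition_function_def by linarith
qed

lemma density_pos: "\<rho> \<phi> > 0"
  using partition_function_pos by (simp add: gibbs_density_def)

lemma density_continuous: "continuous_on S \<rho>"
  unfolding gibbs_density_def[abs_def] by (intro continuous_intros continuous_Hamiltonian V_cont)

lemma density_measurable [measurable]: "\<rho> \<in> borel_measurable \<nu>"
  by (rule continuous_imp_reference_measurable[OF density_continuous])

lemma density_integrable: "integrable \<nu> \<rho>"
  unfolding gibbs_density_def[abs_def]
  by (intro integrable_mult_right integrable_Boltzmann_factor[OF d V_ge V_sym b V_cont V_int])

lemma sets_gibbs [measurable_cong]: "sets \<mu> = sets \<nu>"
  by (simp add: gibbs_measure_def)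

lemma space_gibbs: "space \<mu> = S"
  by (simp add: gibbs_measure_def space_reference_measure)

lemma finite_gibbs: "finite_measure \<mu>"
proof
  have "emeasure \<mu> (space \<mu>) = (\<integral>\<^sup>+\<phi>. ennreal (\<rho> \<phi>) \<partial>\<nu>)"
    unfolding gibbs_measure_def by (simp add: emeasure_density cong: nn_integral_cong)
  also have "\<dots> = ennreal (integral\<^sup>L \<nu> \<rho>)"
    by (rule nn_integral_eq_integral[OF density_integrable]) (use density_pos less_imp_le in auto)
  finally show "emeasure \<mu> (space \<mu>) \<noteq> \<infinity>" by simp
qed

lemma measurable_gibbs_iff: "f \<in> borel_measurable \<mu> \<longleftrightarrow> f \<in> borel_measurable \<nu>"
  by (simp add: gibbs_measure_def)

lemma continuous_measurable: "continuous_on S f \<Longrightarrow> f \<in> borel_measurable \<mu>" for f :: "interface \<Rightarrow> real"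
  unfolding measurable_gibbs_iff by (rule continuous_imp_reference_measurable)

lemma coord_measurable [measurable]: "(\<lambda>\<phi>. \<phi> x) \<in> borel_measurable \<mu>"
  by (rule continuous_measurable[OF continuous_on_coord])

lemma wet_part_measurable:
  fixes f :: "interface \<Rightarrow> real"
  assumes "continuous_on S f"
  shows "(\<lambda>\<phi>. if \<phi> x > 0 then f \<phi> else 0) \<in> borel_measurable \<mu>"
proof -
  note [measurable] = continuous_measurable[OF assms]
  show ?thesis by measurable
qed

lemma integral_gibbs:
  fixes f :: "interface \<Rightarrow> real"
  assumes "f \<in> borel_measurable \<mu>"
  shows "integral\<^sup>L \<mu> f = (\<integral>\<phi>. \<rho> \<phi> * f \<phi> \<partial>\<nu>)"
  unfolding gibbs_measure_def
  by (subst integral_density) (use assms density_pos less_imp_le in \<open>auto simp: measurable_gibbs_iff\<close>)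

lemma Cc_L2:
  fixes f :: "interface \<Rightarrow> real"
  assumes "continuous_on S f" "supported_in d N R f"
  shows "f \<in> L2_space \<mu>" "(\<lambda>\<phi>. if \<phi> x > 0 then f \<phi> else 0) \<in> L2_space \<mu>"
proof -
  obtain B where B: "B \<ge> 0" "\<And>\<phi>. \<phi> \<in> S \<Longrightarrow> \<bar>f \<phi>\<bar> \<le> B" using Cc_bounded[OF assms] by blast
  show "f \<in> L2_space \<mu>"
    by (rule L2_bounded[OF finite_gibbs continuous_measurable[OF assms(1)], where C=B]) (use B space_gibbs in auto)
  show "(\<lambda>\<phi>. if \<phi> x > 0 then f \<phi> else 0) \<in> L2_space \<mu>"
    by (rule L2_bounded[OF finite_gibbs wet_part_measurable[OF assms(1)], where C=B]) (use B space_gibbs in auto)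
qed

lemma Cc2_L2: "F \<in> Cc2 d N \<Longrightarrow> F \<in> L2_space \<mu>"
  using Cc_L2(1) C2_dataD(1) unfolding Cc2_iff by blast

lemma wet_grad_eq:
  assumes "C2_data d N F g H" "x \<in> \<Lambda>" "\<phi> \<in> S"
  shows "wet_grad d N x F \<phi> = (if \<phi> x > 0 then g x \<phi> else 0)"
  unfolding wet_grad_def C2_data_partial_ext[OF N assms] ..

lemma L2_cong:
  assumes "f \<in> L2_space \<mu>" "\<And>\<phi>. \<phi> \<in> S \<Longrightarrow> f \<phi> = g \<phi>"
  shows "g \<in> L2_space \<mu>"
proof (rule L2_bound[OF assms(1), where C=1])
  show "g \<in> borel_measurable \<mu>"
    using L2_measurable[OF assms(1)] assms(2) space_gibbs measurable_cong[of \<mu> f g borel] by simp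
qed (use assms(2) space_gibbs in auto)

lemma wet_grad_L2:
  assumes "F \<in> Cc2 d N" "x \<in> \<Lambda>"
  shows "wet_grad d N x F \<in> L2_space \<mu>"
proof -
  obtain g H R where D: "C2_data d N F g H" and R: "supported_in d N R F"
    using assms(1) unfolding Cc2_iff by blast
  show ?thesis
    by (rule L2_cong[OF Cc_L2(2)[OF C2_dataD(2)[OF D assms(2)] C2_data_supported[OF D R assms(2)], of x]])
       (simp add: wet_grad_eq[OF D assms(2)])
qed

lemma density_lower_bound:
  assumes "R > 0"
  obtains m where "m > 0" "\<And>\<phi>. \<phi> \<in> state_cube d N R \<Longrightarrow> m \<le> \<rho> \<phi>"
proof -
  have "(\<lambda>x\<in>\<Lambda>. 0) \<in> state_cube d N R" using assms by (auto simp: state_cube_def)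
  then have "state_cube d N R \<noteq> {}" by blast
  from continuous_attains_inf[OF compact_state_cube this continuous_on_subset[OF density_continuous state_cube_subset]]
  obtain \<psi> where "\<psi> \<in> state_cube d N R" "\<forall>\<phi>\<in>state_cube d N R. \<rho> \<psi> \<le> \<rho> \<phi>" by blast
  then show thesis using that[of "\<rho> \<psi>"] density_pos by blast
qed

lemma div_density_L2:
  assumes m: "f \<in> borel_measurable \<mu>" and bd: "\<And>\<phi>. \<phi> \<in> S \<Longrightarrow> \<bar>f \<phi>\<bar> \<le> B" and s: "supported_in d N R f" and R: "R > 0"
  shows "\<exists>C. \<forall>\<phi>\<in>S. \<bar>f \<phi> / \<rho> \<phi>\<bar> \<le> C" "(\<lambda>\<phi>. f \<phi> / \<rho> \<phi>) \<in> L2_space \<mu>"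
proof -
  obtain c where c: "c > 0" "\<And>\<phi>. \<phi> \<in> state_cube d N R \<Longrightarrow> c \<le> \<rho> \<phi>" using density_lower_bound[OF R] by blast
  have le: "\<bar>f \<phi> / \<rho> \<phi>\<bar> \<le> \<bar>B\<bar> / c" if \<phi>: "\<phi> \<in> S" for \<phi>
  proof (cases "\<phi> \<in> state_cube d N R")
    case True
    have "\<bar>f \<phi>\<bar> / \<rho> \<phi> \<le> \<bar>B\<bar> / c" using bd[OF \<phi>] c(1) c(2)[OF True] by (intro frac_le) auto
    then show ?thesis using density_pos[of \<phi>] by (simp add: abs_divide)
  next
    case False
    then have "f \<phi> = 0" using supported_inD[OF s] \<phi> by blast
    then show ?thesis using c(1) by simp
  qed
  then show "\<exists>C. \<forall>\<phi>\<in>S. \<bar>f \<phi> / \<rho> \<phi>\<bar> \<le> C" by blast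
  have "\<rho> \<in> borel_measurable \<mu>" by (rule continuous_measurable[OF density_continuous])
  then have "(\<lambda>\<phi>. f \<phi> / \<rho> \<phi>) \<in> borel_measurable \<mu>" using m by (intro borel_measurable_divide)
  then show "(\<lambda>\<phi>. f \<phi> / \<rho> \<phi>) \<in> L2_space \<mu>"
    by (rule L2_bounded[OF finite_gibbs]) (use le space_gibbs in auto)
qed

lemma integral_div_density:
  fixes f :: "interface \<Rightarrow> real"
  assumes "f \<in> borel_measurable \<mu>"
  shows "(\<integral>\<phi>. f \<phi> / \<rho> \<phi> \<partial>\<mu>) = integral\<^sup>L \<nu> f"
proof -
  have "\<rho> \<in> borel_measurable \<mu>" by (rule continuous_measurable[OF density_continuous])
  then have "(\<lambda>\<phi>. f \<phi> / \<rho> \<phi>) \<in> borel_measurable \<mu>" using assms by (intro borel_measurable_divide)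
  from integral_gibbs[OF this] have "(\<integral>\<phi>. f \<phi> / \<rho> \<phi> \<partial>\<mu>) = (\<integral>\<phi>. \<rho> \<phi> * (f \<phi> / \<rho> \<phi>) \<partial>\<nu>)" .
  also have "(\<lambda>\<phi>. \<rho> \<phi> * (f \<phi> / \<rho> \<phi>)) = f"
  proof
    show "\<rho> \<phi> * (f \<phi> / \<rho> \<phi>) = f \<phi>" for \<phi> using density_pos[of \<phi>] by simp
  qed
  finally show ?thesis .
qed

text \<open>
  Integration by parts against the reference measure in one coordinate. The weight \<open>\<phi> x\<close> kills the
  boundary term at \<open>\<phi> x = 0\<close>, so no test function has to vanish near the boundary.
\<close>

lemma integration_by_parts:
  assumes D: "C2_data d N F g H" and sp: "supported_in d N R F" and R: "R > 0" and x: "x \<in> \<Lambda>"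
  shows "(\<integral>\<phi>. (if \<phi> x > 0 then \<phi> x * g x \<phi> + F \<phi> else 0) \<partial>\<nu>) = 0"
proof -
  interpret product_sigma_finite "\<lambda>_::site. site_measure s" by (rule product_sigma_finite_site)
  define f where "f \<phi> = (if \<phi> x > 0 then \<phi> x * g x \<phi> + F \<phi> else 0)" for \<phi>
  have c: "continuous_on S (\<lambda>\<phi>. \<phi> x * g x \<phi> + F \<phi>)"
    by (intro continuous_intros continuous_on_coord C2_dataD(1)[OF D] C2_dataD(2)[OF D x])
  have s0: "supported_in d N R (\<lambda>\<phi>. \<phi> x * g x \<phi> + F \<phi>)"
    using sp C2_data_supported[OF D sp x] by (auto simp: supported_in_def)
  have fm: "f \<in> borel_measurable \<mu>" unfolding f_def[abs_def] by (rule wet_part_measurable[OF c])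
  obtain B where B: "\<And>\<phi>. \<phi> \<in> S \<Longrightarrow> \<bar>\<phi> x * g x \<phi> + F \<phi>\<bar> \<le> B" "B \<ge> 0" using Cc_bounded[OF c s0] by blast
  have "(\<lambda>\<phi>. f \<phi> / \<rho> \<phi>) \<in> L2_space \<mu>"
    by (rule div_density_L2(2)[OF fm _ _ R, of B]) (use B s0 in \<open>auto simp: f_def supported_in_def\<close>)
  moreover have "(\<lambda>_. 1) \<in> L2_space \<mu>" by (rule L2_bounded[OF finite_gibbs, of _ 1]) auto
  ultimately have "integrable \<mu> (\<lambda>\<phi>. f \<phi> / \<rho> \<phi> * 1)" by (rule L2_mult_integrable)
  then have "integrable \<nu> (\<lambda>\<phi>. \<rho> \<phi> *\<^sub>R (f \<phi> / \<rho> \<phi>))"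
    unfolding gibbs_measure_def
    by (subst (asm) integrable_density)
       (use fm density_pos less_imp_le in \<open>auto simp: measurable_gibbs_iff intro!: borel_measurable_divide\<close>)
  moreover have "\<rho> \<phi> *\<^sub>R (f \<phi> / \<rho> \<phi>) = f \<phi>" for \<phi> using density_pos[of \<phi>] by simp
  ultimately have int: "integrable (PiM (insert x (\<Lambda> - {x})) (\<lambda>_. site_measure s)) f"
    using x by (simp add: reference_measure_def insert_absorb)
  have "integral\<^sup>L \<nu> f = integral\<^sup>L (PiM (insert x (\<Lambda> - {x})) (\<lambda>_. site_measure s)) f"
    using x by (simp add: reference_measure_def insert_absorb)
  also have "\<dots> = (\<integral>\<psi>. (\<integral>t. f (\<psi>(x := t)) \<partial>site_measure s) \<partial>PiM (\<Lambda> - {x}) (\<lambda>_. site_measure s))"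
    by (rule product_integral_insert[OF _ _ int]) (auto simp: finite_site_box)
  also have "\<dots> = (\<integral>\<psi>. 0 \<partial>PiM (\<Lambda> - {x}) (\<lambda>_. site_measure s))"
  proof (rule Bochner_Integration.integral_cong[OF refl])
    fix \<psi> assume "\<psi> \<in> space (PiM (\<Lambda> - {x}) (\<lambda>_. site_measure s))"
    then have \<psi>: "\<psi>(x := 0) \<in> S"
      using x by (auto simp: space_PiM state_space_def PiE_def extensional_def Pi_def)
    have "f (\<psi>(x := t)) = (if t > 0 then t * g x (\<psi>(x := t)) + F (\<psi>(x := t)) else 0)" for t
      by (cases "t > 0") (simp_all add: f_def)
    then have "(\<integral>t. f (\<psi>(x := t)) \<partial>site_measure s)
        = (\<integral>t. (if t > 0 then t * g x (\<psi>(x := t)) + F (\<psi>(x := t)) else 0) \<partial>site_measure s)"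
      by simp
    also have "\<dots> = (\<integral>t. (if t > 0 then t * g x (\<psi>(x := t)) + F (\<psi>(x := t)) else 0) \<partial>lborel)"
      by (rule integral_site_measure_pos)
    also have "\<dots> = 0" using integral_line_zero[OF D sp R x \<psi>] unfolding fun_upd_upd .
    finally show "(\<integral>t. f (\<psi>(x := t)) \<partial>site_measure s) = 0" .
  qed
  finally show ?thesis by (simp add: f_def[abs_def])
qed

text \<open>
  Indicators of relatively open boxes are pointwise limits of test functions, and such boxes form a generator
  stable under intersection.
\<close>

lemma Cc2_dense: "densely_defined \<mu> (Cc2 d N)"
proof (rule densely_definedI[OF finite_gibbs])
  let ?\<E> = "range (\<lambda>(a, b). {0..} \<inter> {a<..<b::real})"
  define G where "G = {PiE \<Lambda> X |X. \<forall>x\<in>\<Lambda>. X x \<in> ?\<E>}"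
  have sp: "space \<mu> = PiE \<Lambda> (\<lambda>_. {0..})" by (simp add: space_gibbs state_space_def)
  define J where "J n = {0..} \<inter> {-1<..<real n}" for n
  have J: "J n \<in> ?\<E>" for n unfolding J_def by (rule range_eqI[of _ _ "(-1, real n)"]) simp
  have JU: "(\<Union>n. J n) = {0..}" using reals_Archimedean2 by (fastforce simp: J_def)
  have Jinc: "incseq J" by (auto simp: J_def incseq_def)
  show "sets \<mu> = sigma_sets (space \<mu>) G"
    unfolding sp G_def sets_gibbs reference_measure_def
    by (rule sets_PiM_generated_by_boxes[OF finite_site_box _ J Jinc JU])
       (auto simp: sets_site_measure_generated)
  show "Int_stable G"
  proof (rule Int_stableI)
    fix A B assume "A \<in> G" "B \<in> G"
    then obtain X Y where X: "A = PiE \<Lambda> X" "\<forall>x\<in>\<Lambda>. X x \<in> ?\<E>" and Y: "B = PiE \<Lambda> Y" "\<forall>x\<in>\<Lambda>. Y x \<in> ?\<E>"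
      by (auto simp: G_def)
    have "A \<inter> B = PiE \<Lambda> (\<lambda>x. X x \<inter> Y x)" unfolding X Y by (rule PiE_Int)
    moreover have "X x \<inter> Y x \<in> ?\<E>" if x: "x \<in> \<Lambda>" for x
    proof -
      obtain a b where "X x = {0..} \<inter> {a<..<b}" using bspec[OF X(2) x] by auto
      moreover obtain a' b' where "Y x = {0..} \<inter> {a'<..<b'}" using bspec[OF Y(2) x] by auto
      ultimately have "X x \<inter> Y x = {0..} \<inter> {max a a'<..<min b b'}" by auto
      then show ?thesis by (intro range_eqI[of _ _ "(max a a', min b b')"]) simp
    qed
    ultimately show "A \<inter> B \<in> G" unfolding G_def by blast
  qed
  show "G \<subseteq> Pow (space \<mu>)" unfolding G_def sp by (auto simp: PiE_def Pi_def)
  show "\<exists>A. (\<forall>n::nat. A n \<in> G) \<and> incseq A \<and> (\<Union>n. A n) = space \<mu>"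
  proof (intro exI[of _ "\<lambda>n. PiE \<Lambda> (\<lambda>_. J n)"] conjI allI)
    show "PiE \<Lambda> (\<lambda>_. J n) \<in> G" for n unfolding G_def using J by blast
    show "incseq (\<lambda>n. PiE \<Lambda> (\<lambda>_. J n))" using Jinc by (auto simp: incseq_def intro!: PiE_mono)
    show "(\<Union>n. PiE \<Lambda> (\<lambda>_. J n)) = space \<mu>"
    proof (intro equalityI subsetI)
      fix \<phi> assume \<phi>: "\<phi> \<in> space \<mu>"
      obtain n where n: "Max (insert 0 (\<phi> ` \<Lambda>)) < real n" using reals_Archimedean2 by blast
      have "\<phi> x \<in> J n" if "x \<in> \<Lambda>" for x
      proof -
        have "\<phi> x \<le> Max (insert 0 (\<phi> ` \<Lambda>))" using that by (intro Max_ge) (auto simp: finite_site_box)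
        then show ?thesis using n \<phi> that unfolding sp J_def by (auto dest: PiE_mem)
      qed
      then show "\<phi> \<in> (\<Union>n. PiE \<Lambda> (\<lambda>_. J n))" using \<phi> unfolding sp by (auto simp: PiE_def)
    qed (auto simp: sp J_def PiE_def Pi_def)
  qed
  show "\<exists>U. (\<forall>n. U n \<in> Cc2 d N) \<and> L2_conv \<mu> U (indicator A)" if A: "A \<in> G" for A
  proof -
    obtain X where X: "A = PiE \<Lambda> X" "\<forall>x\<in>\<Lambda>. X x \<in> ?\<E>" using A unfolding G_def by blast
    then have "\<forall>x\<in>\<Lambda>. \<exists>p. X x = {0..} \<inter> {fst p<..<snd p}" by fastforce
    from bchoice[OF this] obtain q where q: "\<And>x. x \<in> \<Lambda> \<Longrightarrow> X x = {0..} \<inter> {fst (q x)<..<snd (q x)}" by blast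
    define a where "a x = fst (q x)" for x
    define c where "c x = snd (q x)" for x
    define U where "U n = (\<lambda>\<phi>. 1 - exp (- (real n * box_bump d N a c \<phi>)))" for n
    have U: "U n \<in> Cc2 d N" for n unfolding U_def by (rule box_bump_Cc2)
    have lim: "(\<lambda>n. U n \<phi>) \<longlonglongrightarrow> indicator A \<phi>" if \<phi>: "\<phi> \<in> space \<mu>" for \<phi>
    proof -
      have "\<phi> \<in> A \<longleftrightarrow> (\<forall>x\<in>\<Lambda>. a x < \<phi> x \<and> \<phi> x < c x)"
        using \<phi> q unfolding X(1) sp by (auto simp: a_def c_def PiE_iff)
      then have "indicator A \<phi> = (if \<forall>x\<in>\<Lambda>. a x < \<phi> x \<and> \<phi> x < c x then 1 else 0 :: real)"
        by (simp add: indicator_def)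
      then show ?thesis unfolding U_def using box_bump_limit[of d N a c \<phi>] by simp
    qed
    have "L2_conv \<mu> U (indicator A)"
    proof (rule L2_conv_dominated)
      show "(\<lambda>_. 1) \<in> L2_space \<mu>" by (rule L2_bounded[OF finite_gibbs, of _ 1]) auto
      show m: "U n \<in> borel_measurable \<mu>" for n by (rule L2_measurable[OF Cc2_L2[OF U]])
      show "(indicator A :: interface \<Rightarrow> real) \<in> borel_measurable \<mu>"
        by (rule borel_measurable_LIMSEQ_real[OF lim m])
      show "AE \<phi> in \<mu>. (\<lambda>n. U n \<phi>) \<longlonglongrightarrow> indicator A \<phi>" by (rule AE_I2[OF lim])
      show "AE \<phi> in \<mu>. \<bar>U n \<phi>\<bar> \<le> \<bar>1\<bar>" for n
      proof (rule AE_I2)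
        fix \<phi>
        have "0 \<le> real n * box_bump d N a c \<phi>" by (intro mult_nonneg_nonneg box_bump_nonneg) simp
        then have "0 < exp (- (real n * box_bump d N a c \<phi>))" "exp (- (real n * box_bump d N a c \<phi>)) \<le> 1" by simp_all
        then show "\<bar>U n \<phi>\<bar> \<le> \<bar>1\<bar>" unfolding U_def by linarith
      qed
    qed
    with U show ?thesis by blast
  qed
qed (auto intro: Cc2_add Cc2_scale Cc2_L2 Cc2_zero)

end

context wetting
begin

lemma wet_region_measurable: "wet_region d N B \<inter> space \<mu> \<in> sets \<mu>"
proof -
  have "wet_region d N B \<inter> space \<mu> = {\<phi> \<in> space \<mu>. (\<forall>x\<in>\<Lambda>. \<phi> x > 0 \<longleftrightarrow> x \<in> B) \<and> B \<subseteq> \<Lambda>}"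
    unfolding space_gibbs wet_region_def by blast
  also have "\<dots> \<in> sets \<mu>"
  proof (intro sets.sets_Collect_conj sets.sets_Collect_finite_All finite_site_box sets.sets_Collect_const)
    show "{\<phi> \<in> space \<mu>. \<phi> x > 0 \<longleftrightarrow> x \<in> B} \<in> sets \<mu>" for x by measurable
  qed
  finally show ?thesis .
qed

text \<open>
  The strata \<open>wet_region d N B\<close> with \<open>x \<in> B\<close> partition \<open>{\<phi>. \<phi> x > 0}\<close>.
\<close>

lemma wetting_form_eq:
  assumes F: "F \<in> Cc2 d N" and G: "G \<in> Cc2 d N"
  shows "wetting_form d N V s F G = (\<Sum>x\<in>\<Lambda>. \<integral>\<phi>. wet_grad d N x F \<phi> * wet_grad d N x G \<phi> \<partial>\<mu>)"
proof -
  define h where "h x \<phi> = wet_grad d N x F \<phi> * wet_grad d N x G \<phi>" for x \<phi>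
  define \<B> where "\<B> = {B. B \<noteq> {} \<and> B \<subseteq> \<Lambda>}"
  have fB: "finite \<B>" unfolding \<B>_def using finite_site_box by auto
  have hi: "integrable \<mu> (h x)" if "x \<in> \<Lambda>" for x
    unfolding h_def by (intro L2_mult_integrable wet_grad_L2 F G that)
  have hB: "integrable \<mu> (\<lambda>\<phi>. indicator (wet_region d N B) \<phi> *\<^sub>R h x \<phi>)" if "x \<in> \<Lambda>" for x B
  proof (rule Bochner_Integration.integrable_bound[OF hi[OF that]])
    have "(\<lambda>\<phi>. indicator (wet_region d N B \<inter> space \<mu>) \<phi> *\<^sub>R h x \<phi>) \<in> borel_measurable \<mu>"
      using hi[OF that] wet_region_measurable by (intro borel_measurable_scaleR borel_measurable_indicator) auto
    then show "(\<lambda>\<phi>. indicator (wet_region d N B) \<phi> *\<^sub>R h x \<phi>) \<in> borel_measurable \<mu>"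
      by (rule measurable_cong[THEN iffD1, rotated]) (auto simp: indicator_def)
  qed (auto simp: indicator_def)
  have st: "(\<integral>\<phi>. partial_ext d N x F \<phi> * partial_ext d N x G \<phi> \<partial>gibbs_wet d N V s B)
      = (\<integral>\<phi>. indicator (wet_region d N B) \<phi> *\<^sub>R h x \<phi> \<partial>\<mu>)" if "x \<in> B" for x B
    unfolding gibbs_wet_def integral_restrict_space[OF wet_region_measurable]
    by (intro Bochner_Integration.integral_cong refl)
       (use that in \<open>auto simp: indicator_def h_def wet_grad_def wet_region_def\<close>)
  have pt: "(\<Sum>B\<in>\<B>. if x \<in> B then indicator (wet_region d N B) \<phi> *\<^sub>R h x \<phi> else 0) = h x \<phi>"
    if x: "x \<in> \<Lambda>" and \<phi>: "\<phi> \<in> S" for x \<phi>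
  proof -
    define W where "W = {y \<in> \<Lambda>. \<phi> y > 0}"
    have "(\<Sum>B\<in>\<B>. if x \<in> B then indicator (wet_region d N B) \<phi> *\<^sub>R h x \<phi> else 0)
        = (\<Sum>B\<in>\<B>. if B = W then (if x \<in> W then h x \<phi> else 0) else 0)"
      using \<phi> by (intro sum.cong refl) (auto simp: wet_region_def W_def indicator_def)
    also have "\<dots> = (if W \<in> \<B> then (if x \<in> W then h x \<phi> else 0) else 0)" using fB by simp
    also have "\<dots> = h x \<phi>"
      using x by (auto simp: W_def \<B>_def h_def wet_grad_def)
    finally show ?thesis .
  qed
  have "wetting_form d N V s F G = (\<Sum>B\<in>\<B>. \<Sum>x\<in>B. \<integral>\<phi>. indicator (wet_region d N B) \<phi> *\<^sub>R h x \<phi> \<partial>\<mu>)"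
    unfolding wetting_form_def wet_form_def \<B>_def by (intro sum.cong refl st)
  also have "\<dots> = (\<Sum>B\<in>\<B>. \<Sum>x\<in>\<Lambda>. if x \<in> B then \<integral>\<phi>. indicator (wet_region d N B) \<phi> *\<^sub>R h x \<phi> \<partial>\<mu> else 0)"
  proof (rule sum.cong[OF refl])
    fix B assume "B \<in> \<B>"
    then have "\<Lambda> \<inter> B = B" by (auto simp: \<B>_def)
    then show "(\<Sum>x\<in>B. \<integral>\<phi>. indicator (wet_region d N B) \<phi> *\<^sub>R h x \<phi> \<partial>\<mu>)
        = (\<Sum>x\<in>\<Lambda>. if x \<in> B then \<integral>\<phi>. indicator (wet_region d N B) \<phi> *\<^sub>R h x \<phi> \<partial>\<mu> else 0)"
      using sum.inter_restrict[OF finite_site_box, of "\<lambda>x. \<integral>\<phi>. indicator (wet_region d N B) \<phi> *\<^sub>R h x \<phi> \<partial>\<mu>" d N B]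
      by simp
  qed
  also have "\<dots> = (\<Sum>x\<in>\<Lambda>. \<Sum>B\<in>\<B>. if x \<in> B then \<integral>\<phi>. indicator (wet_region d N B) \<phi> *\<^sub>R h x \<phi> \<partial>\<mu> else 0)"
    by (rule sum.swap)
  also have "\<dots> = (\<Sum>x\<in>\<Lambda>. \<Sum>B\<in>\<B>. \<integral>\<phi>. (if x \<in> B then indicator (wet_region d N B) \<phi> *\<^sub>R h x \<phi> else 0) \<partial>\<mu>)"
    by (intro sum.cong refl) simp
  also have "\<dots> = (\<Sum>x\<in>\<Lambda>. \<integral>\<phi>. (\<Sum>B\<in>\<B>. if x \<in> B then indicator (wet_region d N B) \<phi> *\<^sub>R h x \<phi> else 0) \<partial>\<mu>)"
  proof (intro sum.cong refl Bochner_Integration.integral_sum[symmetric])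
    show "integrable \<mu> (\<lambda>\<phi>. if x \<in> B then indicator (wet_region d N B) \<phi> *\<^sub>R h x \<phi> else 0)" if "x \<in> \<Lambda>" for x B
      using hB[OF that, of B] by (cases "x \<in> B") simp_all
  qed
  also have "\<dots> = (\<Sum>x\<in>\<Lambda>. integral\<^sup>L \<mu> (h x))"
    by (intro sum.cong refl Bochner_Integration.integral_cong) (use pt space_gibbs in auto)
  finally show ?thesis by (simp add: h_def[abs_def])
qed

text \<open>
  Closability. By integration by parts, the limit \<open>w\<close> of the gradients satisfies
  \<open>\<integral> w (\<phi> x) G / \<rho> d\<mu> = 0\<close> for every test function \<open>G\<close>. Since \<open>\<rho>\<close> is bounded below on cubes, the factor
  multiplying \<open>G\<close> is in \<open>L\<^sup>2\<close> once it is cut off, so it vanishes by density.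
\<close>

lemma wet_grad_closable:
  assumes U: "\<And>n. U n \<in> Cc2 d N" and U0: "L2_conv \<mu> U (\<lambda>_. 0)" and x: "x \<in> \<Lambda>"
    and w: "L2_conv \<mu> (\<lambda>n. wet_grad d N x (U n)) w"
  shows "AE \<phi> in \<mu>. w \<phi> = 0"
proof -
  have wL: "w \<in> L2_space \<mu>" by (rule L2_conv_mem(2)[OF w])
  have ortho: "(\<integral>\<phi>. w \<phi> * (\<phi> x * G \<phi> / \<rho> \<phi>) \<partial>\<mu>) = 0" if G: "G \<in> Cc2 d N" for G
  proof -
    obtain g H R where D: "C2_data d N G g H" and R: "R > 0" "supported_in d N R G"
      using G unfolding Cc2_iff by blast
    define a where "a \<phi> = \<phi> x * G \<phi> / \<rho> \<phi>" for \<phi>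
    define q where "q \<phi> = \<phi> x * g x \<phi> + G \<phi>" for \<phi>
    define c where "c \<phi> = (if \<phi> x > 0 then q \<phi> else 0) / \<rho> \<phi>" for \<phi>
    have ac: "continuous_on S (\<lambda>\<phi>. \<phi> x * G \<phi>)"
      by (intro continuous_intros continuous_on_coord C2_dataD(1)[OF D])
    have as: "supported_in d N R (\<lambda>\<phi>. \<phi> x * G \<phi>)" using R(2) by (simp add: supported_in_def)
    obtain Ba where Ba: "\<And>\<phi>. \<phi> \<in> S \<Longrightarrow> \<bar>\<phi> x * G \<phi>\<bar> \<le> Ba" using Cc_bounded[OF ac as] by blast
    have aL: "a \<in> L2_space \<mu>" unfolding a_def[abs_def]
      by (rule div_density_L2(2)[OF continuous_measurable[OF ac] Ba as R(1)])
    have qc: "continuous_on S q" unfolding q_def[abs_def]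
      by (intro continuous_intros continuous_on_coord C2_dataD(1)[OF D] C2_dataD(2)[OF D x])
    have qs: "supported_in d N R q"
      using R(2) C2_data_supported[OF D R(2) x] by (simp add: supported_in_def q_def)
    obtain Bq where Bq: "Bq \<ge> 0" "\<And>\<phi>. \<phi> \<in> S \<Longrightarrow> \<bar>q \<phi>\<bar> \<le> Bq" using Cc_bounded[OF qc qs] by blast
    have cL: "c \<in> L2_space \<mu>" unfolding c_def[abs_def]
      by (rule div_density_L2(2)[OF wet_part_measurable[OF qc] _ _ R(1), of _ Bq])
         (use Bq qs in \<open>auto simp: supported_in_def\<close>)
    have zero: "(\<integral>\<phi>. a \<phi> * wet_grad d N x (U n) \<phi> \<partial>\<mu>) + (\<integral>\<phi>. c \<phi> * U n \<phi> \<partial>\<mu>) = 0" for n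
    proof -
      obtain g' H' R' where D': "C2_data d N (U n) g' H'" using U[of n] unfolding Cc2_iff by blast
      define P where "P \<phi> = U n \<phi> * G \<phi>" for \<phi>
      define gP where "gP y \<phi> = U n \<phi> * g y \<phi> + g' y \<phi> * G \<phi>" for y \<phi>
      from C2_data_mult[OF D' D] obtain HP where DP: "C2_data d N P gP HP"
        unfolding P_def[abs_def] gP_def[abs_def] by blast
      have sP: "supported_in d N R P" using R(2) by (simp add: supported_in_def P_def)
      have cP: "continuous_on S (\<lambda>\<phi>. \<phi> x * gP x \<phi> + P \<phi>)"
        by (intro continuous_intros continuous_on_coord C2_dataD(1)[OF DP] C2_dataD(2)[OF DP x])
      have "0 = (\<integral>\<phi>. (if \<phi> x > 0 then \<phi> x * gP x \<phi> + P \<phi> else 0) \<partial>\<nu>)"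
        using integration_by_parts[OF DP sP R(1) x] by simp
      also have "\<dots> = (\<integral>\<phi>. (if \<phi> x > 0 then \<phi> x * gP x \<phi> + P \<phi> else 0) / \<rho> \<phi> \<partial>\<mu>)"
        by (rule integral_div_density[OF wet_part_measurable[OF cP], symmetric])
      also have "\<dots> = (\<integral>\<phi>. a \<phi> * wet_grad d N x (U n) \<phi> + c \<phi> * U n \<phi> \<partial>\<mu>)"
      proof (rule Bochner_Integration.integral_cong[OF refl])
        fix \<phi> assume "\<phi> \<in> space \<mu>"
        then have "\<phi> \<in> S" by (simp add: space_gibbs)
        then show "(if \<phi> x > 0 then \<phi> x * gP x \<phi> + P \<phi> else 0) / \<rho> \<phi> = a \<phi> * wet_grad d N x (U n) \<phi> + c \<phi> * U n \<phi>"
          by (simp add: wet_grad_eq[OF D' x] a_def c_def q_def P_def gP_def add_divide_distrib[symmetric])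
             (simp add: algebra_simps)
      qed
      also have "\<dots> = (\<integral>\<phi>. a \<phi> * wet_grad d N x (U n) \<phi> \<partial>\<mu>) + (\<integral>\<phi>. c \<phi> * U n \<phi> \<partial>\<mu>)"
        by (intro Bochner_Integration.integral_add L2_mult_integrable aL cL wet_grad_L2 Cc2_L2 U x)
      finally show ?thesis by simp
    qed
    have "(\<lambda>n. (\<integral>\<phi>. a \<phi> * wet_grad d N x (U n) \<phi> \<partial>\<mu>) + (\<integral>\<phi>. c \<phi> * U n \<phi> \<partial>\<mu>))
        \<longlonglongrightarrow> (\<integral>\<phi>. a \<phi> * w \<phi> \<partial>\<mu>) + (\<integral>\<phi>. c \<phi> * 0 \<partial>\<mu>)"
      by (intro tendsto_add L2_conv_inner L2_conv_const aL cL U0 w)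
    then have "(\<integral>\<phi>. a \<phi> * w \<phi> \<partial>\<mu>) = 0" unfolding zero by (simp add: LIMSEQ_const_iff)
    then show ?thesis by (simp add: a_def mult.commute)
  qed
  have part: "AE \<phi> in \<mu>. w \<phi> * (\<phi> x * cutoff d N (real (Suc k)) \<phi> / \<rho> \<phi>) = 0" for k
  proof (rule AE_zero_if_orthogonal_to_dense[OF Cc2_dense])
    define R where "R = real (Suc k)"
    have R: "R > 0" by (simp add: R_def)
    obtain H where D: "C2_data d N (cutoff d N R) (cutoff_grad d N R) H" using C2_data_cutoff by blast
    have cc: "continuous_on S (\<lambda>\<phi>. \<phi> x * cutoff d N R \<phi>)"
      by (intro continuous_intros continuous_on_coord C2_dataD(1)[OF D])
    have cs: "supported_in d N R (\<lambda>\<phi>. \<phi> x * cutoff d N R \<phi>)"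
      using cutoff_supported[OF R] by (simp add: supported_in_def)
    obtain B where B: "\<And>\<phi>. \<phi> \<in> S \<Longrightarrow> \<bar>\<phi> x * cutoff d N R \<phi>\<bar> \<le> B" using Cc_bounded[OF cc cs] by blast
    note dd = div_density_L2[OF continuous_measurable[OF cc] B cs R]
    obtain C where C: "\<And>\<phi>. \<phi> \<in> S \<Longrightarrow> \<bar>\<phi> x * cutoff d N R \<phi> / \<rho> \<phi>\<bar> \<le> C" using dd(1) by blast
    show "(\<lambda>\<phi>. w \<phi> * (\<phi> x * cutoff d N (real (Suc k)) \<phi> / \<rho> \<phi>)) \<in> L2_space \<mu>"
      unfolding R_def[symmetric]
    proof (rule L2_bound[OF wL, where C=C])
      show "(\<lambda>\<phi>. w \<phi> * (\<phi> x * cutoff d N R \<phi> / \<rho> \<phi>)) \<in> borel_measurable \<mu>"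
        by (intro borel_measurable_times L2_measurable[OF wL] L2_measurable[OF dd(2)])
      fix \<phi> assume "\<phi> \<in> space \<mu>"
      then have "\<bar>\<phi> x * cutoff d N R \<phi> / \<rho> \<phi>\<bar> \<le> C" using C space_gibbs by simp
      then show "\<bar>w \<phi> * (\<phi> x * cutoff d N R \<phi> / \<rho> \<phi>)\<bar> \<le> C * \<bar>w \<phi>\<bar>"
        unfolding abs_mult[of "w \<phi>"] by (subst mult.commute) (rule mult_right_mono, auto)
    qed
    fix G assume "G \<in> Cc2 d N"
    from ortho[OF Cc2_mult[OF cutoff_Cc2[OF R] this]]
    show "(\<integral>\<phi>. w \<phi> * (\<phi> x * cutoff d N (real (Suc k)) \<phi> / \<rho> \<phi>) * G \<phi> \<partial>\<mu>) = 0"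
      unfolding R_def[symmetric] by (simp add: mult.assoc mult.left_commute)
  qed
  have all: "AE \<phi> in \<mu>. \<forall>k. w \<phi> * (\<phi> x * cutoff d N (real (Suc k)) \<phi> / \<rho> \<phi>) = 0"
    unfolding AE_all_countable using part by blast
  \<comment> \<open>The gradients vanish identically at the pinned sites.\<close>
  obtain r :: "nat \<Rightarrow> nat" where "strict_mono r" and r: "AE \<phi> in \<mu>. (\<lambda>n. wet_grad d N x (U (r n)) \<phi>) \<longlonglongrightarrow> w \<phi>"
    using L2_conv_AE_subseq[OF w] by blast
  show ?thesis using all r
  proof eventually_elim
    fix \<phi> assume a: "\<forall>k. w \<phi> * (\<phi> x * cutoff d N (real (Suc k)) \<phi> / \<rho> \<phi>) = 0"
      and l: "(\<lambda>n. wet_grad d N x (U (r n)) \<phi>) \<longlonglongrightarrow> w \<phi>"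
    show "w \<phi> = 0"
    proof (cases "\<phi> x > 0")
      case True
      define Q where "Q = (\<Sum>y\<in>\<Lambda>. (\<phi> y)\<^sup>2)"
      have Q: "Q \<ge> 0" unfolding Q_def by (intro sum_nonneg) simp
      obtain k where k: "Q < real k" using reals_Archimedean2 by blast
      have "real k \<le> (real (Suc k))\<^sup>2" by (simp add: power2_eq_square algebra_simps)
      then have "Q / (real (Suc k))\<^sup>2 < 1" using k by (subst divide_less_eq_1_pos) auto
      then have "cutoff d N (real (Suc k)) \<phi> > 0" unfolding cutoff_def Q_def[symmetric] by simp
      then have "\<phi> x * cutoff d N (real (Suc k)) \<phi> / \<rho> \<phi> > 0"
        using True density_pos[of \<phi>] by simp
      with spec[OF a, of k] show ?thesis by (metis less_irrefl mult_eq_0_iff)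
    next
      case False
      then have "(\<lambda>n. wet_grad d N x (U (r n)) \<phi>) = (\<lambda>_. 0)" by (simp add: wet_grad_def)
      with l show ?thesis by (simp add: LIMSEQ_const_iff)
    qed
  qed
qed

sublocale gradient_form \<mu> "Cc2 d N" \<Lambda> "wet_grad d N" "wetting_form d N V s"
proof (rule gradient_form.intro[OF finite_gibbs], unfold_locales)
  show "finite \<Lambda>" by (rule finite_site_box)
  show "densely_defined \<mu> (Cc2 d N)" by (rule Cc2_dense)
  show "(\<lambda>_. 0) \<in> Cc2 d N" by (rule Cc2_zero)
  show "(\<lambda>p. u p + v p) \<in> Cc2 d N" if "u \<in> Cc2 d N" "v \<in> Cc2 d N" for u v by (rule Cc2_add[OF that])
  show "(\<lambda>p. c * u p) \<in> Cc2 d N" if "u \<in> Cc2 d N" for u c by (rule Cc2_scale[OF that])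
  show "wet_grad d N i u \<in> L2_space \<mu>" if "u \<in> Cc2 d N" "i \<in> \<Lambda>" for u i by (rule wet_grad_L2[OF that])
  show "wet_grad d N i (\<lambda>p. u p + v p) p = wet_grad d N i u p + wet_grad d N i v p"
    if u: "u \<in> Cc2 d N" and v: "v \<in> Cc2 d N" and i: "i \<in> \<Lambda>" and p: "p \<in> space \<mu>" for u v i p
  proof -
    obtain g H g' H' where D: "C2_data d N u g H" "C2_data d N v g' H'" using u v unfolding Cc2_iff by blast
    have p: "p \<in> S" using p by (simp add: space_gibbs)
    show ?thesis
      by (simp add: wet_grad_eq[OF C2_data_add[OF D] i p] wet_grad_eq[OF D(1) i p] wet_grad_eq[OF D(2) i p])
  qed
  show "wet_grad d N i (\<lambda>p. c * u p) p = c * wet_grad d N i u p"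
    if u: "u \<in> Cc2 d N" and i: "i \<in> \<Lambda>" and p: "p \<in> space \<mu>" for u c i p
  proof -
    obtain g H where D: "C2_data d N u g H" using u unfolding Cc2_iff by blast
    have p: "p \<in> S" using p by (simp add: space_gibbs)
    show ?thesis
      by (simp add: wet_grad_eq[OF C2_data_mult[OF C2_data_const D] i p] wet_grad_eq[OF D i p])
  qed
  show "wetting_form d N V s u v = (\<Sum>i\<in>\<Lambda>. \<integral>p. wet_grad d N i u p * wet_grad d N i v p \<partial>\<mu>)"
    if "u \<in> Cc2 d N" "v \<in> Cc2 d N" for u v by (rule wetting_form_eq[OF that])
  show "AE p in \<mu>. w i p = 0"
    if "\<And>n. U n \<in> Cc2 d N" "L2_conv \<mu> U (\<lambda>_. 0)" and w: "\<And>j. j \<in> \<Lambda> \<Longrightarrow> L2_conv \<mu> (\<lambda>n. wet_grad d N j (U n)) (w j)"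
      and i: "i \<in> \<Lambda>" for U w i
    by (rule wet_grad_closable[OF that(1,2) i w[OF i]])
  show "(\<lambda>p. \<eta> (u p)) \<in> Cc2 d N"
    if "u \<in> Cc2 d N" "\<eta> 0 = 0" "\<And>t. (\<eta> has_real_derivative \<eta>' t) (at t)"
      "\<And>t. (\<eta>' has_real_derivative \<eta>'' t) (at t)" "continuous_on UNIV \<eta>''" for u \<eta> \<eta>' \<eta>''
    by (rule Cc2_compose[OF that])
  show "wet_grad d N i (\<lambda>p. \<eta> (u p)) p = \<eta>' (u p) * wet_grad d N i u p"
    if u: "u \<in> Cc2 d N" and "\<eta> 0 = 0" and c: "\<And>t. (\<eta> has_real_derivative \<eta>' t) (at t)"
      "\<And>t. (\<eta>' has_real_derivative \<eta>'' t) (at t)" "continuous_on UNIV \<eta>''"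
      and i: "i \<in> \<Lambda>" and p: "p \<in> space \<mu>" for u \<eta> \<eta>' \<eta>'' i p
  proof -
    obtain g H where D: "C2_data d N u g H" using u unfolding Cc2_iff by blast
    have p: "p \<in> S" using p by (simp add: space_gibbs)
    show ?thesis
      by (simp add: wet_grad_eq[OF C2_data_compose[OF D c] i p] wet_grad_eq[OF D i p])
  qed
qed

text \<open>
  The cutoffs at radius \<open>n + 1\<close> have gradients bounded by \<open>6 / (n + 1)\<close>, and the measure is finite.
\<close>

lemma weak_grad_one: "weak_grad (\<lambda>_. 1) (\<lambda>_ _. 0)"
  unfolding weak_grad_def
proof (intro exI[of _ "\<lambda>n. cutoff d N (real (Suc n))"] conjI allI ballI)
  have one: "(\<lambda>_. C) \<in> L2_space \<mu>" for C by (rule L2_bounded[OF finite_gibbs, of _ "\<bar>C\<bar>"]) auto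
  show C: "cutoff d N (real (Suc n)) \<in> Cc2 d N" for n by (rule cutoff_Cc2) simp
  show "L2_conv \<mu> (\<lambda>n. cutoff d N (real (Suc n))) (\<lambda>_. 1)"
  proof (rule L2_conv_dominated[OF one[of 1]])
    show "cutoff d N (real (Suc n)) \<in> borel_measurable \<mu>" for n by (rule L2_measurable[OF Cc2_L2[OF C]])
    show "AE \<phi> in \<mu>. (\<lambda>n. cutoff d N (real (Suc n)) \<phi>) \<longlonglongrightarrow> 1"
    proof (rule AE_I2)
      fix \<phi> :: interface
      define Q where "Q = (\<Sum>y\<in>\<Lambda>. (\<phi> y)\<^sup>2)"
      have "(\<lambda>n. max 0 (1 - Q * (inverse (real (Suc n)))\<^sup>2) ^ 3) \<longlonglongrightarrow> max 0 (1 - Q * 0\<^sup>2) ^ 3"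
        by (intro tendsto_intros LIMSEQ_inverse_real_of_nat)
      then show "(\<lambda>n. cutoff d N (real (Suc n)) \<phi>) \<longlonglongrightarrow> 1"
        unfolding cutoff_def Q_def[symmetric] by (simp add: divide_inverse power_inverse)
    qed
    show "AE \<phi> in \<mu>. \<bar>cutoff d N (real (Suc n)) \<phi>\<bar> \<le> \<bar>1\<bar>" for n
      unfolding abs_of_nonneg[OF cutoff_bounds(1)] using cutoff_bounds(2) by (intro AE_I2) simp
  qed simp
  fix x assume x: "x \<in> \<Lambda>"
  have bd: "\<bar>wet_grad d N x (cutoff d N (real (Suc n))) \<phi>\<bar> \<le> 6 * inverse (real (Suc n))" if "\<phi> \<in> S" for n \<phi>
  proof -
    obtain H where D: "C2_data d N (cutoff d N (real (Suc n))) (cutoff_grad d N (real (Suc n))) H"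
      using C2_data_cutoff by blast
    have "\<bar>cutoff_grad d N (real (Suc n)) x \<phi>\<bar> \<le> 6 * inverse (real (Suc n))"
      using cutoff_grad_bound[OF _ x, of "real (Suc n)" \<phi>] by (simp add: divide_inverse)
    then show ?thesis unfolding wet_grad_eq[OF D x that] by (cases "\<phi> x > 0") auto
  qed
  show "L2_conv \<mu> (\<lambda>n. wet_grad d N x (cutoff d N (real (Suc n)))) (\<lambda>_. 0)"
  proof (rule L2_conv_dominated[OF one[of 6]])
    show "wet_grad d N x (cutoff d N (real (Suc n))) \<in> borel_measurable \<mu>" for n
      by (rule L2_measurable[OF wet_grad_L2[OF C x]])
    show "AE \<phi> in \<mu>. (\<lambda>n. wet_grad d N x (cutoff d N (real (Suc n))) \<phi>) \<longlonglongrightarrow> 0"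
    proof (rule AE_I2)
      fix \<phi> assume "\<phi> \<in> space \<mu>"
      then have \<phi>: "\<phi> \<in> S" by (simp add: space_gibbs)
      have lim: "(\<lambda>n. 6 * inverse (real (Suc n))) \<longlonglongrightarrow> 0"
        by (rule tendsto_mult_right_zero[OF LIMSEQ_inverse_real_of_nat])
      show "(\<lambda>n. wet_grad d N x (cutoff d N (real (Suc n))) \<phi>) \<longlonglongrightarrow> 0"
        by (rule Lim_null_comparison[OF _ lim]) (intro always_eventually allI, simp only: real_norm_def bd[OF \<phi>])
    qed
    show "AE \<phi> in \<mu>. \<bar>wet_grad d N x (cutoff d N (real (Suc n))) \<phi>\<bar> \<le> \<bar>6\<bar>" for n
    proof (rule AE_I2)
      fix \<phi> assume "\<phi> \<in> space \<mu>"
      then have "\<bar>wet_grad d N x (cutoff d N (real (Suc n))) \<phi>\<bar> \<le> 6 * inverse (real (Suc n))"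
        by (intro bd) (simp add: space_gibbs)
      also have "\<dots> \<le> 6 * 1" by (intro mult_left_mono) (auto simp: inverse_le_1_iff)
      finally show "\<bar>wet_grad d N x (cutoff d N (real (Suc n))) \<phi>\<bar> \<le> \<bar>6\<bar>" by simp
    qed
  qed simp
qed

end

theorem theorem5p4:
  fixes d N :: nat and s b :: real and V :: "real \<Rightarrow> real"
  defines "\<mu> \<equiv> gibbs_measure d N V s"
  defines "\<D> \<equiv> Cc2 d N"
  defines "\<E> \<equiv> wetting_form d N V s"
  assumes "d \<ge> 1" and "N \<ge> 1" and "s > 0"
    and "b \<ge> 0" and "\<And>r. V r \<ge> - b"
    and "V C1_differentiable_on UNIV"
    and "\<And>r. V (- r) = V r"
    and "integrable lborel (\<lambda>r. exp (- V r))"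
    and "\<And>x. x \<in> site_box d N \<Longrightarrow> force d N V x \<in> L2_space \<mu>"
  shows "densely_defined \<mu> \<D> \<and> positive_definite_form \<D> \<E> \<and> symmetric_bilinear_form \<mu> \<D> \<E> \<and>
         closable \<mu> \<D> \<E> \<and>
         symmetric_Dirichlet_form \<mu> (closure_dom \<mu> \<D> \<E>) (closure_form \<mu> \<D> \<E>) \<and>
         conservative_form \<mu> (closure_dom \<mu> \<D> \<E>) (closure_form \<mu> \<D> \<E>) \<and>
         strongly_local \<mu> (closure_dom \<mu> \<D> \<E>) (closure_form \<mu> \<D> \<E>) \<and>
         regular_form \<mu> (closure_dom \<mu> \<D> \<E>) (closure_form \<mu> \<D> \<E>)"
proof -
  interpret wetting d N s b V
    by unfold_locales (use assms C1_differentiable_imp_continuous_on in auto)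
  have sp: "space (gibbs_measure d N V s) = site_box d N \<rightarrow>\<^sub>E {0..}"
    by (simp add: space_gibbs state_space_def)
  have C: "Cc2 d N \<subseteq> Cc (space (gibbs_measure d N V s))" by (auto simp: Cc2_def space_gibbs)
  show ?thesis unfolding assms(1-3)
  proof (intro conjI)
    show "strongly_local (gibbs_measure d N V s)
        (closure_dom (gibbs_measure d N V s) (Cc2 d N) (wetting_form d N V s))
        (closure_form (gibbs_measure d N V s) (Cc2 d N) (wetting_form d N V s))"
      by (rule strongly_local_closure[OF gradient_form_axioms AE_zero_off_ess_support[OF finite_site_box sp]])
    show "regular_form (gibbs_measure d N V s)
        (closure_dom (gibbs_measure d N V s) (Cc2 d N) (wetting_form d N V s))
        (closure_form (gibbs_measure d N V s) (Cc2 d N) (wetting_form d N V s))"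
      by (rule regular_closure[OF gradient_form_axioms C])
         (simp only: space_gibbs Cc2_uniformly_dense)
  qed (rule Cc2_dense positive_definite bilinear closable_form Dirichlet_closure
         conservative_closure[OF weak_grad_one])+
qed

end
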